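(* Let $(X_i, i\in\mathbb{T}^* )$ be a super-critical spatially homogeneous $P^*$-bifurcating Markov chain on a Galton-Watson tree, and let $W=\lim_{q\to\infty} m^{-q}|\mathbb{G}_q^*|$ (limit a.s. and in $L^2$). Assume that the auxiliary Markov chain $Y$ is ergodic in the following sense: there exists a probability measure $\mu$ on $S$ such that for all $h\in C_b(S)$ and all $x\in S$, $\lim_{k\to\infty}\mathbb{E}_x[h(Y_k)]=\langle\mu,h\rangle$. Assume also that $x\mapsto P^*g(x)$ belongs to $C_b(\bar S)$ for all $g\in C_b(\bar S^3)$. Let $f\in C_b(\bar S^3)$. (1) Weak law of large numbers. As $r\to\infty$, the following convergences hold in probability: $$\mathbf{1}_{\{|\mathbb{G}_r^*|>0\}}\frac{1}{|\mathbb{G}_r^*|}\sum_{i\in\mathbb{G}_r^*}f(\Delta_i)\longrightarrow \langle\mu,P^*f\rangle\,\mathbf{1}_{\{W\neq0\}},\qquad \mathbf{1}_{\{|\mathbb{G}_r^*|>0\}}\frac{1}{|\mathbb{T}_r^*|}\sum_{i\in\mathbb{T}_r^*}f(\Delta_i)\longrightarrow \langle\mu,P^*f\rangle\,\mathbf{1}_{\{W\neq0\}}.$$ (2) Fluctuations. As $r\to\infty$, the following convergence holds in distribution: $$\mathbf{1}_{\{|\mathbb{G}_r^*|>0\}}\frac{1}{\sqrt{|\mathbb{T}_r^*|}}\sum_{i\in\mathbb{T}_r^*}\big(f(\Delta_i)-P^*f(X_i)\big)\longrightarrow \mathbf{1}_{\{W\neq0\}}\,\sigma G,$$ where $\sigma^2=\langle\mu,P^*(f^2)-(P^*f)^2\rangle$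 and $G$ is a Gaussian random variable with mean zero and variance $1$, independent of $W$.
   Context: Tree: $\mathbb{G}_0=\{\emptyset\}$, $\mathbb{G}_k=\{0,1\}^k$ for $k\ge1$, $\mathbb{T}_r=\bigcup_{0\le k\le r}\mathbb{G}_k$, $\mathbb{T}=\bigcup_{k\ge0}\mathbb{G}_k$; the two daughters of $i\in\mathbb{T}$ are $i0$ and $i1$ (with $\emptyset0=0$, $\emptyset1=1$). State space: $S$ is a metric space with its Borel $\sigma$-field $\mathcal{S}$; $\bar S=S\cup\{\partial\}$, where $\partial$ is an added (isolated) cemetery point, and $\bar{\mathcal S}$ is the $\sigma$-field generated by $\mathcal S$ and $\{\partial\}$. $C_b(E)$ denotes the bounded continuous real functions on $E$. Kernel: $P^*$ is a probability kernel from $\bar S$ to $\bar S^2$ with $P^*(\partial,\{(\partial,\partial)\})=1$. For measurable $g$ on $\bar S^3$, $P^*g(x)=\int_{\bar S^2} g(x,y,z)\,P^*(x,dy,dz)$ when this exists. $P^*$-bifurcating Markov chain ($P^*$-BMC): a process $(X_i,i\in\mathbb{T})$ with values in $\bar S$ such that $X_\emptyset$ has law $\nu$ and, for all bounded measurable real $(g_i,i\in\mathbb{T})$ on $\bar S^3$ and all $k\ge0$, $\mathbb{E}[\prod_{i\in\mathbb{G}_k}g_i(X_i,X_{i0},X_{i1})\mid\sigma(X_j;j\in\mathbb{T}_k)]=\prod_{i\in\mathbb{G}_k}P^*g_i(X_i)$. The law $\nu$ is carried by $S$. Let $\mathbb{T}^*=\{i\in\mathbb{T}:X_i\ne\partial\}$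 and $J^*=J\cap\mathbb{T}^*$ for $J\subset\mathbb{T}$; $(X_i,i\in\mathbb{T}^* )$ is called a $P^*$-BMC on a Galton-Watson tree. It is spatially homogeneous if $p_{1,0}=P^*(x,S\times S)$, $p_0=P^*(x,S\times\{\partial\})$, $p_1=P^*(x,\{\partial\}\times S)$ do not depend on $x\in S$, and then super-critical if $m:=2p_{1,0}+p_0+p_1>1$. $|J|$ is the cardinality of $J$. $\Delta_i=(X_i,X_{i0},X_{i1})$. Auxiliary chain: for $x\in S$ and $A\in\mathcal S$, $P_0^*(x,A)=P^*(x,A\times\bar S)$, $P_1^*(x,A)=P^*(x,\bar S\times A)$, $Q=\frac1m(P_0^*+P_1^* )$. $Y=(Y_n,n\in\mathbb{N})$ is a Markov chain on $S$ with transition kernel $Q$ and $Y_0$ distributed as $X_\emptyset$; $\mathbb{E}_x$ means the initial state is $x$. $\langle\mu,h\rangle=\int_S h\,d\mu$ (for $h$ defined on $\bar S$, the restriction to $S$ is integrated). An expression multiplied by the indicator of an event is $0$ off that event. *)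

theory Defs
  imports "HOL-Probability.Probability"
begin

text \<open>
  The state space \<open>S\<close> is a metric space type \<open>'a\<close>; the enlarged space is \<open>'a option\<close>, with the
  cemetery point rendered as \<open>None\<close> and topologised as an isolated point.
\<close>

instantiation option :: (topological_space) topological_space
begin

definition open_option :: "'a option set \<Rightarrow> bool" where
  "open_option U \<longleftrightarrow> open (Some -` U)"

instance
proof
  fix K :: "'a option set set"
  assume "\<forall>U\<in>K. open U"
  then have "open (\<Union>U\<in>K. Some -` U)" unfolding open_option_def by blast
  then show "open (\<Union>K)" unfolding open_option_def by (simp add: vimage_Union)
qed (auto simp: open_option_def vimage_Int)

end

lemma open_Some_image: "open U \<Longrightarrow> open (Some ` U)"
  by (simp add: open_option_def inj_vimage_image_eq)

lemma open_None: "open {None}"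
  by (simp add: open_option_def vimage_def)

lemma continuous_on_option_iff:
  fixes f :: "'a::topological_space option \<Rightarrow> 'b::topological_space"
  shows "continuous_on UNIV f \<longleftrightarrow> continuous_on UNIV (\<lambda>x. f (Some x))"
  by (auto simp: continuous_on_open_vimage open_option_def vimage_def)

lemma sets_borel_option:
  "sets (borel :: 'a::topological_space option measure) =
     sigma_sets UNIV (insert {None} ((\<lambda>A. Some ` A) ` sets borel))" (is "_ = sigma_sets UNIV ?R")
proof
  have "U \<in> sigma_sets UNIV ?R" if "open U" for U :: "'a option set"
  proof -
    have "Some -` U \<in> sets borel" using that by (simp add: open_option_def)
    then have 1: "Some ` (Some -` U) \<in> sigma_sets UNIV ?R" by (intro sigma_sets.Basic) blast
    have 2: "(if None \<in> U then {None} else {}) \<in> sigma_sets UNIV ?R"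
      by (simp add: sigma_sets.Empty sigma_sets.Basic)
    have "U = Some ` (Some -` U) \<union> (if None \<in> U then {None} else {})"
    proof (rule set_eqI)
      fix x show "x \<in> U \<longleftrightarrow> x \<in> Some ` (Some -` U) \<union> (if None \<in> U then {None} else {})"
        by (cases x) auto
    qed
    with sigma_sets_Un[OF 1 2] show ?thesis by simp
  qed
  then show "sets borel \<subseteq> sigma_sets UNIV ?R"
    unfolding sets_borel by (intro sigma_sets_mono) blast
next
  have N: "{None} \<in> sets (borel :: 'a option measure)" using open_None by (rule borel_open)
  have S: "Some ` A \<in> sets borel" if "A \<in> sigma_sets UNIV {U :: 'a set. open U}" for A
    using that
  proof (induction rule: sigma_sets.induct)
    case (Basic U) then show ?case by (simp add: open_Some_image)
  next
    case (Compl A)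
    have "Some ` (UNIV - A) = UNIV - Some ` A - {None}"
    proof (rule set_eqI)
      fix x show "x \<in> Some ` (UNIV - A) \<longleftrightarrow> x \<in> UNIV - Some ` A - {None}" by (cases x) auto
    qed
    moreover have "UNIV - Some ` A - {None} \<in> sets borel"
      using Compl.IH N by (intro sets.Diff) auto
    ultimately show ?case by simp
  next
    case (Union A)
    then have "(\<Union>i. Some ` A i) \<in> sets borel" by (intro sets.countable_UN) auto
    then show ?case by (simp add: image_UN)
  next
    case Empty then show ?case by simp
  qed
  have "?R \<subseteq> sets borel" using N S by (auto simp: sets_borel)
  then show "sigma_sets UNIV ?R \<subseteq> sets borel"
    using sets.sigma_sets_subset[of ?R "borel :: 'a option measure"] by simp
qed

instance option :: (second_countable_topology) second_countable_topology
proof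
  obtain B :: "'a set set" where B: "countable B" "topological_basis B"
    using ex_countable_basis by blast
  let ?B = "insert {None} ((\<lambda>A. Some ` A) ` B)"
  have "topological_basis ?B"
  proof (rule topological_basisI)
    have "open A" if "A \<in> B" for A using B(2) that by (rule topological_basis_open)
    then show "open U" if "U \<in> ?B" for U using that by (auto simp: open_None open_Some_image)
  next
    fix U :: "'a option set" and x assume U: "open U" "x \<in> U"
    show "\<exists>V\<in>?B. x \<in> V \<and> V \<subseteq> U"
    proof (cases x)
      case None then show ?thesis using U by auto
    next
      case (Some y)
      with U have "open (Some -` U)" "y \<in> Some -` U" by (auto simp: open_option_def)
      then obtain V where "V \<in> B" "y \<in> V" "V \<subseteq> Some -` U"
        using B(2) topological_basisE by blast
      with Some show ?thesis by (intro bexI[of _ "Some ` V"]) auto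
    qed
  qed
  with B(1) show "\<exists>B :: 'a option set set. countable B \<and> open = generate_topology B"
    by (intro exI[of _ ?B]) (auto simp: fun_eq_iff topological_basis_imp_subbasis)
qed

text \<open>
  Bounded continuous functions that are measurable for the ambient \<open>\<sigma>\<close>-field \<open>\<E>\<close>. On \<open>S\<close> and on
  \<open>S \<union> {\<partial>}\<close> that \<open>\<sigma>\<close>-field is the Borel one and measurability is automatic. On the triple product
  it is the product \<open>\<sigma>\<close>-field, and measurability is automatic for separable \<open>S\<close> (see
  \<open>Cb_triple\<close>); it has to be required for non-separable \<open>S\<close>, where the integral \<open>P\<^sup>* g\<close> of a
  continuous \<open>g\<close> need not make sense otherwise.
\<close>

definition Cb :: "'b::topological_space measure \<Rightarrow> ('b \<Rightarrow> real) set" where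
  "Cb \<E> = {f. continuous_on UNIV f \<and> bounded (range f) \<and> f \<in> borel_measurable \<E>}"

lemma Cb_borel: "Cb borel = {f. continuous_on UNIV f \<and> bounded (range f)}"
  by (auto simp: Cb_def intro: borel_measurable_continuous_onI)

abbreviation triple_borel ::
    "('a::topological_space option \<times> 'a option \<times> 'a option) measure" where
  "triple_borel \<equiv> borel \<Otimes>\<^sub>M (borel \<Otimes>\<^sub>M borel)"

lemma Cb_triple:
  "Cb (triple_borel :: ('a::second_countable_topology option \<times> 'a option \<times> 'a option) measure) =
     {f. continuous_on UNIV f \<and> bounded (range f)}"
  by (simp add: borel_prod Cb_borel)

text \<open>The binary tree: words over \<open>bool\<close>, the daughters of \<open>i\<close> being obtained by appending a letter.\<close>

definition generation :: "nat \<Rightarrow> bool list set" where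
  "generation k = {i. length i = k}"

definition tree :: "nat \<Rightarrow> bool list set" where
  "tree r = (\<Union>k\<le>r. generation k)"

definition alive :: "(bool list \<Rightarrow> 'w \<Rightarrow> 'a option) \<Rightarrow> bool list set \<Rightarrow> 'w \<Rightarrow> bool list set" where
  "alive X J \<omega> = {i\<in>J. X i \<omega> \<noteq> None}"

definition Delta ::
    "(bool list \<Rightarrow> 'w \<Rightarrow> 'a option) \<Rightarrow> bool list \<Rightarrow> 'w \<Rightarrow> 'a option \<times> 'a option \<times> 'a option" where
  "Delta X i \<omega> = (X i \<omega>, X (i @ [False]) \<omega>, X (i @ [True]) \<omega>)"

text \<open>
  \<open>P x\<close> is the measure \<open>P\<^sup>*(x, dy, dz)\<close> on pairs; \<open>kernel_op P g\<close> is \<open>P\<^sup>* g\<close>.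
\<close>

definition kernel_op ::
    "('a option \<Rightarrow> ('a option \<times> 'a option) measure) \<Rightarrow>
     ('a option \<times> 'a option \<times> 'a option \<Rightarrow> real) \<Rightarrow> 'a option \<Rightarrow> real" where
  "kernel_op P g x = (\<integral>(y, z). g (x, y, z) \<partial>P x)"

definition bmc_kernel ::
    "('a::topological_space option \<Rightarrow> ('a option \<times> 'a option) measure) \<Rightarrow> bool" where
  "bmc_kernel P \<longleftrightarrow>
     P \<in> borel \<rightarrow>\<^sub>M prob_algebra (borel \<Otimes>\<^sub>M borel) \<and> measure (P None) {(None, None)} = 1"

definition generated_by :: "'w measure \<Rightarrow> 'i set \<Rightarrow> ('i \<Rightarrow> 'w \<Rightarrow> 'b::topological_space) \<Rightarrow> 'w measure" where
  "generated_by M J X =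
     sigma (space M) (\<Union>j\<in>J. {X j -` A \<inter> space M | A. A \<in> sets borel})"

definition bmc ::
    "'w measure \<Rightarrow> 'a::topological_space option measure \<Rightarrow>
     ('a option \<Rightarrow> ('a option \<times> 'a option) measure) \<Rightarrow> (bool list \<Rightarrow> 'w \<Rightarrow> 'a option) \<Rightarrow> bool" where
  "bmc M \<nu> P X \<longleftrightarrow>
     (\<forall>i. X i \<in> M \<rightarrow>\<^sub>M borel) \<and>
     distr M borel (X []) = \<nu> \<and>
     (\<forall>g k. (\<forall>i. g i \<in> borel_measurable triple_borel \<and> bounded (range (g i))) \<longrightarrow>
        (AE \<omega> in M.
           real_cond_exp M (generated_by M (tree k) X)
             (\<lambda>\<omega>. \<Prod>i\<in>generation k. g i (Delta X i \<omega>)) \<omega> =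
           (\<Prod>i\<in>generation k. kernel_op P (g i) (X i \<omega>))))"

definition spatially_homogeneous ::
    "('a option \<Rightarrow> ('a option \<times> 'a option) measure) \<Rightarrow> real \<Rightarrow> real \<Rightarrow> real \<Rightarrow> bool" where
  "spatially_homogeneous P p10 p0 p1 \<longleftrightarrow>
     (\<forall>x. measure (P (Some x)) (range Some \<times> range Some) = p10 \<and>
          measure (P (Some x)) (range Some \<times> {None}) = p0 \<and>
          measure (P (Some x)) ({None} \<times> range Some) = p1)"

definition P0_star ::
    "('a::topological_space option \<Rightarrow> ('a option \<times> 'a option) measure) \<Rightarrow> 'a \<Rightarrow> 'a measure" where
  "P0_star P x = measure_of UNIV (sets borel) (\<lambda>A. emeasure (P (Some x)) ((Some ` A) \<times> UNIV))"

definition P1_star ::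
    "('a::topological_space option \<Rightarrow> ('a option \<times> 'a option) measure) \<Rightarrow> 'a \<Rightarrow> 'a measure" where
  "P1_star P x = measure_of UNIV (sets borel) (\<lambda>A. emeasure (P (Some x)) (UNIV \<times> (Some ` A)))"

definition Q_kernel ::
    "real \<Rightarrow> ('a::topological_space option \<Rightarrow> ('a option \<times> 'a option) measure) \<Rightarrow> 'a \<Rightarrow> 'a measure" where
  "Q_kernel m P x =
     measure_of UNIV (sets borel)
       (\<lambda>A. (emeasure (P0_star P x) A + emeasure (P1_star P x) A) / ennreal m)"

lemma Some_image_borel:
  "A \<in> sets (borel :: 'a::topological_space measure) \<Longrightarrow> Some ` A \<in> sets borel"
  unfolding sets_borel_option by (rule sigma_sets.Basic) blast

lemma
  fixes P :: "'a::topological_space option \<Rightarrow> ('a option \<times> 'a option) measure"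
  assumes P: "bmc_kernel P" and A: "A \<in> sets borel"
  shows emeasure_P0_star: "emeasure (P0_star P x) A = emeasure (P (Some x)) ((Some ` A) \<times> UNIV)"
    and emeasure_P1_star: "emeasure (P1_star P x) A = emeasure (P (Some x)) (UNIV \<times> (Some ` A))"
proof -
  have s: "sets (P (Some x)) = sets (borel \<Otimes>\<^sub>M borel)"
    using P measurable_space[of P borel "prob_algebra (borel \<Otimes>\<^sub>M borel)" "Some x"]
    by (auto simp: bmc_kernel_def space_prob_algebra)
  have sa: "sigma_algebra UNIV (sets (borel :: 'a measure))"
    by (metis sets.sigma_algebra_axioms space_borel)
  have U: "UNIV \<in> sets (borel :: 'a option measure)" by simp
  have "countably_additive (sets borel) (\<lambda>A. emeasure (P (Some x)) ((Some ` A) \<times> UNIV))"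
  proof (rule countably_additiveI)
    fix F :: "nat \<Rightarrow> 'a set" assume F: "range F \<subseteq> sets borel" "disjoint_family F"
    have "(\<Sum>i. emeasure (P (Some x)) ((Some ` F i) \<times> UNIV)) =
        emeasure (P (Some x)) (\<Union>i. (Some ` F i) \<times> UNIV)"
      using F by (intro suminf_emeasure)
        (auto simp: s disjoint_family_on_def intro!: pair_measureI Some_image_borel)
    also have "(\<Union>i. (Some ` F i) \<times> UNIV) = Some ` (\<Union>i. F i) \<times> (UNIV :: 'a option set)" by auto
    finally show "(\<Sum>i. emeasure (P (Some x)) ((Some ` F i) \<times> UNIV)) =
        emeasure (P (Some x)) (Some ` (\<Union>i. F i) \<times> UNIV)" .
  qed
  then show "emeasure (P0_star P x) A = emeasure (P (Some x)) ((Some ` A) \<times> UNIV)"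
    unfolding P0_star_def using A
    by (intro emeasure_measure_of_sigma[OF sa]) (auto simp: positive_def)
  have "countably_additive (sets borel) (\<lambda>A. emeasure (P (Some x)) (UNIV \<times> (Some ` A)))"
  proof (rule countably_additiveI)
    fix F :: "nat \<Rightarrow> 'a set" assume F: "range F \<subseteq> sets borel" "disjoint_family F"
    have "(\<Sum>i. emeasure (P (Some x)) (UNIV \<times> (Some ` F i))) =
        emeasure (P (Some x)) (\<Union>i. UNIV \<times> (Some ` F i))"
      using F by (intro suminf_emeasure)
        (auto simp: s disjoint_family_on_def intro!: pair_measureI Some_image_borel)
    also have "(\<Union>i. UNIV \<times> (Some ` F i)) = (UNIV :: 'a option set) \<times> Some ` (\<Union>i. F i)" by auto
    finally show "(\<Sum>i. emeasure (P (Some x)) (UNIV \<times> (Some ` F i))) =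
        emeasure (P (Some x)) (UNIV \<times> Some ` (\<Union>i. F i))" .
  qed
  then show "emeasure (P1_star P x) A = emeasure (P (Some x)) (UNIV \<times> (Some ` A))"
    unfolding P1_star_def using A
    by (intro emeasure_measure_of_sigma[OF sa]) (auto simp: positive_def)
qed

text \<open>
  The generated \<open>\<sigma>\<close>-field of \<open>Y\<^sub>0, \<dots>, Y\<^sub>n\<close> is the natural filtration. A family of probability measures
  \<open>N x\<close> under which one and the same process \<open>Y\<close> is a chain with initial law \<open>return borel x\<close> plays
  the role of \<open>(P\<^sub>x)\<close>, so that \<open>E\<^sub>x\<close> is integration against \<open>N x\<close>.
\<close>

definition markov_chain ::
    "'v measure \<Rightarrow> 'a::topological_space measure \<Rightarrow> ('a \<Rightarrow> 'a measure) \<Rightarrow> (nat \<Rightarrow> 'v \<Rightarrow> 'a) \<Rightarrow> bool" where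
  "markov_chain N \<nu> Q Y \<longleftrightarrow>
     prob_space N \<and>
     (\<forall>n. Y n \<in> N \<rightarrow>\<^sub>M borel) \<and>
     distr N borel (Y 0) = \<nu> \<and>
     (\<forall>n. \<forall>h\<in>borel_measurable borel. bounded (range h) \<longrightarrow>
        (AE \<omega> in N. real_cond_exp N (generated_by N {..n} Y) (\<lambda>\<omega>. h (Y (Suc n) \<omega>)) \<omega> =
           (\<integral>y. h y \<partial>Q (Y n \<omega>))))"

definition converges_in_probability ::
    "'w measure \<Rightarrow> (nat \<Rightarrow> 'w \<Rightarrow> real) \<Rightarrow> ('w \<Rightarrow> real) \<Rightarrow> bool" where
  "converges_in_probability M Z L \<longleftrightarrow>
     (\<forall>\<epsilon>>0. (\<lambda>n. measure M {\<omega>\<in>space M. \<bar>Z n \<omega> - L \<omega>\<bar> > \<epsilon>}) \<longlonglongrightarrow> 0)"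

end

theory Submission
  imports Defs
begin

text \<open>
  Write \<open>Z\<^sub>q\<close> for the size of generation \<open>q\<close> and \<open>W\<^sub>q = Z\<^sub>q / m\<^sup>q\<close>. The increments of \<open>W\<^sub>q\<close> are orthogonal with
  geometrically decreasing variances, which gives the limit \<open>W\<close> almost surely and in \<open>L\<^sup>2\<close>.
  The offspring generating function is quadratic with fixed point \<open>1\<close>, so it has a single fixed
  point below \<open>1\<close>; both the extinction probability and \<open>P(W = 0)\<close> are such fixed points, hence
  \<open>{W = 0}\<close> is almost surely the event of extinction.

  For the sums \<open>N\<^sub>r(h)\<close> of \<open>h(X\<^sub>i)\<close> over the living individuals of generation \<open>r\<close>, conditioning on the
  previous generation gives
  \<open>E[(N\<^sub>r\<^sub>+\<^sub>1(h) / m\<^sup>r\<^sup>+\<^sup>1)\<^sup>2] \<le> E[(N\<^sub>r(Qh) / m\<^sup>r)\<^sup>2] + 4 \<parallel>h\<parallel>\<^sup>2 m\<^sup>-\<^sup>r\<close>. Iterating down to a fixed generation \<open>l\<close>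
  bounds the left-hand side at \<open>r\<close> by \<open>E[(N\<^sub>l(Q\<^sup>r\<^sup>-\<^sup>l h) / m\<^sup>l)\<^sup>2] + O(m\<^sup>-\<^sup>l)\<close>, which is small as soon as
  \<open>Q\<^sup>n h \<rightarrow> 0\<close> pointwise. Applied to \<open>h - \<langle>\<mu>, h\<rangle>\<close> this is the weak law; replacing \<open>f(\<Delta>\<^sub>i)\<close> by
  \<open>P\<^sup>* f(X\<^sub>i)\<close> costs a martingale increment of second moment \<open>O(m\<^sup>r)\<close>.

  For the fluctuations only the last \<open>l\<close> generations matter, up to an error of variance \<open>O(m\<^sup>-\<^sup>l)\<close>.
  The random norming may then be replaced by a bounded continuous function of \<open>W\<^sub>r\<^sub>-\<^sub>l\<close>, which is known
  before those generations are drawn. Integrating them out backwards, each one contributes a product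
  of conditionally independent characteristic functions; by the weak law applied to
  \<open>P\<^sup>*(f\<^sup>2) - (P\<^sup>* f)\<^sup>2\<close> it is asymptotically the characteristic function of a Gaussian whose variance
  is \<open>\<sigma>\<^sup>2\<close> times a function of \<open>W\<^sub>r\<^sub>-\<^sub>l\<close>.
\<close>

text \<open>The cemetery stays in the state space. Functions that vanish there turn a sum over the
  random living set into a sum over all 2^k words, and its mean is still of order m^k. The branching
  property is given for products of bounded real functions: constant factors 1 extract single
  individuals and pairs, while complex factors have to be expanded into real ones.

  The obstacle in the fluctuations is the norming, which is not known before the last generations
  are drawn and is unbounded near W = 0. A cut-off continuous function of W_n repairs both. As W_n
  takes finitely many values, a random argument of a characteristic function reduces to finitely
  many constant ones. Extinction must be identified with {W = 0} because the norming is switched off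
  by extinction, whereas its limit is switched off on {W = 0}. The Gaussian mixture is reached
  through its characteristic function E exp(- t^2 \<sigma>^2 1_{W \<noteq> 0} / 2), as the limit of
  the expectations themselves.\<close>

section \<open>Elementary limits and convergence in probability\<close>

lemma geometric_recursion_tendsto_0:
  fixes y e :: "nat \<Rightarrow> real"
  assumes \<rho>: "0 \<le> \<rho>" "\<rho> < 1" and y: "\<And>n. 0 \<le> y n"
    and rec: "\<And>n. y (Suc n) \<le> \<rho> * y n + e n" and e: "e \<longlonglongrightarrow> 0"
  shows "y \<longlonglongrightarrow> 0"
proof (rule LIMSEQ_I)
  fix r :: real assume r: "r > 0"
  \<comment> \<open>With this \<open>d\<close>, r / 2 is the fixed point of x -> \<rho> x + d, so
    the bound below reproduces itself.\<close>
  define d where "d = r * (1 - \<rho>) / 2"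
  have d: "d > 0" using r \<rho> by (simp add: d_def)
  obtain n0 where n0: "\<And>n. n \<ge> n0 \<Longrightarrow> \<bar>e n\<bar> < d"
    using LIMSEQ_D[OF e d] by auto
  have bound: "y (n0 + k) \<le> \<rho> ^ k * y n0 + r / 2" for k
  proof (induction k)
    case (Suc k)
    have "y (n0 + Suc k) \<le> \<rho> * y (n0 + k) + d"
      using rec[of "n0 + k"] n0[of "n0 + k"] by auto
    also have "\<dots> \<le> \<rho> * (\<rho> ^ k * y n0 + r / 2) + d"
      using Suc \<rho> by (intro add_right_mono mult_left_mono) auto
    also have "\<dots> = \<rho> ^ Suc k * y n0 + r / 2" by (simp add: d_def field_simps)
    finally show ?case .
  qed (use r in auto)
  have "(\<lambda>k. \<rho> ^ k * y n0) \<longlonglongrightarrow> 0 * y n0"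
    using \<rho> by (intro tendsto_mult LIMSEQ_power_zero) auto
  then obtain k0 where k0: "\<And>k. k \<ge> k0 \<Longrightarrow> \<bar>\<rho> ^ k * y n0\<bar> < r / 2"
    using LIMSEQ_D[of "\<lambda>k. \<rho> ^ k * y n0" 0 "r/2"] r by auto
  show "\<exists>no. \<forall>n\<ge>no. norm (y n - 0) < r"
  proof (intro exI allI impI)
    fix n assume n: "n \<ge> n0 + k0"
    then have "y n \<le> \<rho> ^ (n - n0) * y n0 + r / 2" using bound[of "n - n0"] by simp
    moreover have "\<bar>\<rho> ^ (n - n0) * y n0\<bar> < r / 2" using n by (intro k0) simp
    ultimately show "norm (y n - 0) < r" using y[of n] unfolding real_norm_def by linarith
  qed
qed

text \<open>Convergence in probability will come from almost sure convergence along subsequences;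
  this criterion returns to the full sequence.\<close>

lemma tendsto_if_subseq_tendsto:
  fixes a :: "nat \<Rightarrow> 'b::metric_space"
  assumes "\<And>s :: nat \<Rightarrow> nat. strict_mono s \<Longrightarrow> \<exists>t. strict_mono t \<and> (\<lambda>n. a (s (t n))) \<longlonglongrightarrow> l"
  shows "a \<longlonglongrightarrow> l"
proof (rule ccontr)
  assume "\<not> a \<longlonglongrightarrow> l"
  then obtain r where r: "r > 0" and "\<And>n0. \<exists>n\<ge>n0. \<not> dist (a n) l < r"
    by (auto simp: lim_sequentially)
  then have inf: "infinite {n. \<not> dist (a n) l < r}"
    by (auto simp: infinite_nat_iff_unbounded_le)
  obtain s where s: "strict_mono s" "\<And>n :: nat. s n \<in> {n. \<not> dist (a n) l < r}"
    using infinite_enumerate[OF inf] by auto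
  obtain t where "(\<lambda>n. a (s (t n))) \<longlonglongrightarrow> l" using assms[OF s(1)] by auto
  with r obtain n where "dist (a (s (t n))) l < r" by (auto simp: lim_sequentially)
  with s(2)[of "t n"] show False by simp
qed

context prob_space
begin

lemma integral_tendsto_bounded:
  fixes g :: "nat \<Rightarrow> 'a \<Rightarrow> 'b::{banach, second_countable_topology}"
  assumes "\<And>n. g n \<in> borel_measurable M" "h \<in> borel_measurable M"
    and "\<And>n \<omega>. \<omega> \<in> space M \<Longrightarrow> norm (g n \<omega>) \<le> C" and "AE \<omega> in M. (\<lambda>n. g n \<omega>) \<longlonglongrightarrow> h \<omega>"
  shows "(\<lambda>n. \<integral>\<omega>. g n \<omega> \<partial>M) \<longlonglongrightarrow> (\<integral>\<omega>. h \<omega> \<partial>M)"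
  using assms by (intro integral_dominated_convergence[where w="\<lambda>_. C"]) auto

lemma bounded_integrable:
  fixes g :: "'a \<Rightarrow> 'b::{banach, second_countable_topology}"
  assumes "g \<in> borel_measurable M" "\<And>\<omega>. \<omega> \<in> space M \<Longrightarrow> norm (g \<omega>) \<le> C"
  shows "integrable M g"
  using assms by (intro integrable_const_bound[where B=C]) auto

text \<open>Meant for D a centred sum divided by m^r, R the reciprocal of the scaled population and
  V the mean on survival. An L2-small D tends to 0 almost surely along a further subsequence of any
  subsequence, and this survives multiplication by R, which may be unbounded but converges almost
  surely.\<close>

lemma converges_in_probability_slutsky:
  assumes [measurable]: "\<And>n. R n \<in> borel_measurable M" "\<And>n. V n \<in> borel_measurable M"
      "\<And>n. D n \<in> borel_measurable M" "V' \<in> borel_measurable M"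
    and int: "\<And>n. integrable M (\<lambda>\<omega>. (D n \<omega>)\<^sup>2)" and D: "(\<lambda>n. \<integral>\<omega>. (D n \<omega>)\<^sup>2 \<partial>M) \<longlonglongrightarrow> 0"
    and R: "AE \<omega> in M. (\<lambda>n. R n \<omega>) \<longlonglongrightarrow> R' \<omega>" and V: "AE \<omega> in M. (\<lambda>n. V n \<omega>) \<longlonglongrightarrow> V' \<omega>"
  shows "converges_in_probability M (\<lambda>n \<omega>. R n \<omega> * D n \<omega> + V n \<omega>) V'"
  unfolding converges_in_probability_def
proof (intro allI impI tendsto_if_subseq_tendsto)
  fix \<epsilon> :: real and s :: "nat \<Rightarrow> nat" assume \<epsilon>: "\<epsilon> > 0" and s: "strict_mono s"
  have "(\<lambda>n. \<integral>\<omega>. norm ((D (s n) \<omega>)\<^sup>2) \<partial>M) \<longlonglongrightarrow> 0"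
    using LIMSEQ_subseq_LIMSEQ[OF D s] by (simp add: o_def)
  from tendsto_L1_AE_subseq[OF int this] obtain t where t: "strict_mono t"
    and AE0: "AE \<omega> in M. (\<lambda>n. (D (s (t n)) \<omega>)\<^sup>2) \<longlonglongrightarrow> 0" by auto
  have st: "strict_mono (s \<circ> t)" using s t by (rule strict_mono_o)
  let ?E = "\<lambda>n. {\<omega>\<in>space M. \<bar>R n \<omega> * D n \<omega> + V n \<omega> - V' \<omega>\<bar> > \<epsilon>}"
  \<comment> \<open>Along this subsequence the indicator of the exceptional event is almost surely
    eventually 0, so its integral, the probability, tends to 0.\<close>
  have "(\<lambda>n. \<integral>\<omega>. indicator (?E (s (t n))) \<omega> \<partial>M) \<longlonglongrightarrow> (\<integral>\<omega>. (0::real) \<partial>M)"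
  proof (rule integral_tendsto_bounded[where C=1])
    show "AE \<omega> in M. (\<lambda>n. indicator (?E (s (t n))) \<omega> :: real) \<longlonglongrightarrow> 0"
      using AE0 R V
    proof eventually_elim
      case (elim \<omega>)
      have "(\<lambda>n. sqrt ((D (s (t n)) \<omega>)\<^sup>2)) \<longlonglongrightarrow> sqrt 0" using elim(1) by (rule tendsto_real_sqrt)
      then have "(\<lambda>n. D (s (t n)) \<omega>) \<longlonglongrightarrow> 0" by (simp add: tendsto_rabs_zero_iff)
      moreover have "(\<lambda>n. R (s (t n)) \<omega>) \<longlonglongrightarrow> R' \<omega>" "(\<lambda>n. V (s (t n)) \<omega>) \<longlonglongrightarrow> V' \<omega>"
        using LIMSEQ_subseq_LIMSEQ[OF elim(2) st] LIMSEQ_subseq_LIMSEQ[OF elim(3) st] by (auto simp: o_def)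
      ultimately have "(\<lambda>n. R (s (t n)) \<omega> * D (s (t n)) \<omega> + V (s (t n)) \<omega> - V' \<omega>) \<longlonglongrightarrow> R' \<omega> * 0 + V' \<omega> - V' \<omega>"
        by (intro tendsto_intros)
      then have "(\<lambda>n. \<bar>R (s (t n)) \<omega> * D (s (t n)) \<omega> + V (s (t n)) \<omega> - V' \<omega>\<bar>) \<longlonglongrightarrow> 0"
        by (simp add: tendsto_rabs_zero_iff)
      from order_tendstoD(2)[OF this \<epsilon>]
      have "\<forall>\<^sub>F n in sequentially. indicator (?E (s (t n))) \<omega> = (0::real)"
        by eventually_elim (simp add: indicator_def)
      then show ?case by (rule tendsto_eventually)
    qed
  qed (auto simp: indicator_def)
  then have "(\<lambda>n. prob (?E (s (t n)))) \<longlonglongrightarrow> 0" by simp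
  with t show "\<exists>t. strict_mono t \<and> (\<lambda>n. prob (?E (s (t n)))) \<longlonglongrightarrow> 0" by blast
qed

end

section \<open>Moments of the chain over one generation\<close>

definition gen_sum :: "(bool list \<Rightarrow> 'w \<Rightarrow> 'a option) \<Rightarrow> nat \<Rightarrow> ('a option \<Rightarrow> real) \<Rightarrow> 'w \<Rightarrow> real" where
  "gen_sum X k h \<omega> = (\<Sum>i\<in>generation k. h (X i \<omega>))"

definition tri_sum ::
    "(bool list \<Rightarrow> 'w \<Rightarrow> 'a option) \<Rightarrow> nat \<Rightarrow> ('a option \<times> 'a option \<times> 'a option \<Rightarrow> real) \<Rightarrow> 'w \<Rightarrow> real" where
  "tri_sum X k g \<omega> = (\<Sum>i\<in>generation k. g (Delta X i \<omega>))"

text \<open>The class for which the branching property is stated. Its members are integrable on a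
  probability space, and the closure rules collected in \<open>bdd_intros\<close> discharge
  integrability for the expressions built from them.\<close>

definition bdd_measurable :: "'b measure \<Rightarrow> ('b \<Rightarrow> real) set" where
  "bdd_measurable E = {g \<in> borel_measurable E. bounded (range g)}"

text \<open>The conditional variance of \<open>g (Delta X i)\<close> given X_i = x.\<close>

definition kernel_var ::
    "('a option \<Rightarrow> ('a option \<times> 'a option) measure) \<Rightarrow>
     ('a option \<times> 'a option \<times> 'a option \<Rightarrow> real) \<Rightarrow> 'a option \<Rightarrow> real" where
  "kernel_var P g x = kernel_op P (\<lambda>t. (g t)\<^sup>2) x - (kernel_op P g x)\<^sup>2"

lemma finite_generation [simp]: "finite (generation k)"
  unfolding generation_def using finite_lists_length_eq[of "UNIV :: bool set" k] by simp

lemma card_generation: "card (generation k) = 2 ^ k"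
  unfolding generation_def using card_lists_length_eq[of "UNIV :: bool set" k] by simp

lemma generation_0: "generation 0 = {[]}"
  by (auto simp: generation_def)

lemma generation_Suc:
  "generation (Suc k) = (\<lambda>i. i @ [False]) ` generation k \<union> (\<lambda>i. i @ [True]) ` generation k"
proof (intro equalityI subsetI)
  fix i assume "i \<in> generation (Suc k)"
  then have "length i = Suc k" by (simp add: generation_def)
  then have "i = butlast i @ [last i]" "length (butlast i) = k"
    by (metis append_butlast_last_id length_0_conv nat.distinct(1), simp)
  then show "i \<in> (\<lambda>i. i @ [False]) ` generation k \<union> (\<lambda>i. i @ [True]) ` generation k"
    by (cases "last i") (auto simp: generation_def image_iff)
qed (auto simp: generation_def)

lemma sum_generation_Suc:
  "(\<Sum>i\<in>generation (Suc k). u i) = (\<Sum>i\<in>generation k. u (i @ [False]) + u (i @ [True]))"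
  unfolding generation_Suc
  by (subst sum.union_disjoint) (auto simp: sum.reindex inj_on_def sum.distrib)

lemma prod_generation_Suc:
  "(\<Prod>i\<in>generation (Suc k). u i) = (\<Prod>i\<in>generation k. u (i @ [False]) * u (i @ [True]))"
  unfolding generation_Suc
  by (subst prod.union_disjoint) (auto simp: prod.reindex inj_on_def prod.distrib)

lemma sum_tree: "(\<Sum>i\<in>tree r. u i) = (\<Sum>q\<le>r. \<Sum>i\<in>generation q. u i)"
  unfolding tree_def
  by (intro sum.UNION_disjoint finite_generation ballI) (auto simp: generation_def)

lemma finite_tree [simp]: "finite (tree r)"
  unfolding tree_def by (intro finite_UN_I) auto

lemma alive_sum:
  "finite J \<Longrightarrow> (\<Sum>i\<in>alive X J \<omega>. u i) = (\<Sum>i\<in>J. if X i \<omega> = None then 0 else u i)"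
  unfolding alive_def by (subst sum.inter_filter) (auto intro!: sum.cong)

section \<open>Calculus of bounded measurable functions\<close>

lemma bdd_measurable_bound:
  assumes "g \<in> bdd_measurable E"
  obtains C where "C > 0" "\<And>x. \<bar>g x\<bar> \<le> C"
  using assms by (auto simp: bdd_measurable_def bounded_pos)

lemma bdd_measurable_ex: "g \<in> bdd_measurable E \<Longrightarrow> \<exists>C. \<forall>x. \<bar>g x\<bar> \<le> C"
  by (meson bdd_measurable_bound)

lemma bdd_measurableI:
  "g \<in> borel_measurable E \<Longrightarrow> (\<And>x. \<bar>g x\<bar> \<le> C) \<Longrightarrow> g \<in> bdd_measurable E"
  by (auto simp: bdd_measurable_def bounded_iff)

lemma bdd_measurable_measurable: "g \<in> bdd_measurable E \<Longrightarrow> g \<in> borel_measurable E"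
  by (simp add: bdd_measurable_def)

lemma bdd_measurable_const [simp]: "(\<lambda>_. c) \<in> bdd_measurable E"
  by (rule bdd_measurableI[where C="\<bar>c\<bar>"]) auto

lemma bdd_measurable_add:
  assumes "g \<in> bdd_measurable E" "h \<in> bdd_measurable E"
  shows "(\<lambda>x. g x + h x) \<in> bdd_measurable E"
proof -
  obtain C D where "\<And>x. \<bar>g x\<bar> \<le> C" "\<And>x. \<bar>h x\<bar> \<le> D"
    using assms[THEN bdd_measurable_bound] by metis
  then have "\<And>x. \<bar>g x + h x\<bar> \<le> C + D" by (meson abs_triangle_ineq add_mono order_trans)
  then show ?thesis
    using assms[THEN bdd_measurable_measurable] by (intro bdd_measurableI) auto
qed

lemma bdd_measurable_mult:
  assumes "g \<in> bdd_measurable E" "h \<in> bdd_measurable E"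
  shows "(\<lambda>x. g x * h x) \<in> bdd_measurable E"
proof -
  obtain C D where "C > 0" "\<And>x. \<bar>g x\<bar> \<le> C" "\<And>x. \<bar>h x\<bar> \<le> D"
    using assms[THEN bdd_measurable_bound] by metis
  then have "\<And>x. \<bar>g x * h x\<bar> \<le> C * D"
    unfolding abs_mult by (intro mult_mono) auto
  then show ?thesis
    using assms[THEN bdd_measurable_measurable] by (intro bdd_measurableI) auto
qed

lemma bdd_measurable_diff:
  assumes "g \<in> bdd_measurable E" "h \<in> bdd_measurable E"
  shows "(\<lambda>x. g x - h x) \<in> bdd_measurable E"
  using bdd_measurable_add[OF assms(1) bdd_measurable_mult[OF bdd_measurable_const[of "-1"] assms(2)]]
  by simp

lemma bdd_measurable_power2:
  "g \<in> bdd_measurable E \<Longrightarrow> (\<lambda>x. (g x)\<^sup>2) \<in> bdd_measurable E"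
  unfolding power2_eq_square by (rule bdd_measurable_mult)

lemma bdd_measurable_comp:
  assumes "g \<in> bdd_measurable E" "u \<in> F \<rightarrow>\<^sub>M E"
  shows "(\<lambda>x. g (u x)) \<in> bdd_measurable F"
proof -
  obtain C where "\<And>x. \<bar>g x\<bar> \<le> C" using bdd_measurable_ex[OF assms(1)] by blast
  then show ?thesis
    using assms(2) bdd_measurable_measurable[OF assms(1)] by (intro bdd_measurableI[of _ _ C]) auto
qed

lemmas bdd_intros = bdd_measurable_const bdd_measurable_add bdd_measurable_mult bdd_measurable_diff
  bdd_measurable_power2

lemma bdd_measurable_sum:
  "(\<And>i. i \<in> I \<Longrightarrow> u i \<in> bdd_measurable E) \<Longrightarrow> (\<lambda>x. \<Sum>i\<in>I. u i x) \<in> bdd_measurable E"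
  by (induction I rule: infinite_finite_induct) (auto intro: bdd_measurable_add)

lemma bdd_measurable_prod:
  "(\<And>i. i \<in> I \<Longrightarrow> u i \<in> bdd_measurable E) \<Longrightarrow> (\<lambda>x. \<Prod>i\<in>I. u i x) \<in> bdd_measurable E"
  by (induction I rule: infinite_finite_induct) (auto intro: bdd_measurable_mult)

lemma None_in_borel [measurable]: "{None :: 'a::topological_space option} \<in> sets borel"
  using open_None by (rule borel_open)

lemma measurable_Some [measurable]: "Some \<in> borel \<rightarrow>\<^sub>M (borel :: 'a::topological_space option measure)"
  by (rule borel_measurable_continuous_onI) (auto simp: continuous_on_open_vimage open_option_def)

text \<open>One added point does not affect measurability: a preimage is a Borel subset of S, with
  or without the measurable point \<open>None\<close>.\<close>

lemma borel_measurable_option_iff: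
  fixes h :: "'a::topological_space option \<Rightarrow> 'b::topological_space"
  shows "h \<in> borel_measurable borel \<longleftrightarrow> (\<lambda>x. h (Some x)) \<in> borel_measurable borel"
proof
  assume m: "(\<lambda>x. h (Some x)) \<in> borel_measurable borel"
  show "h \<in> borel_measurable borel"
  proof (rule borel_measurableI)
    fix S :: "'b set" assume "open S"
    then have "(\<lambda>x. h (Some x)) -` S \<inter> space borel \<in> sets borel"
      by (intro measurable_sets[OF m]) auto
    then have "Some ` ((\<lambda>x. h (Some x)) -` S) \<in> sets borel" by (intro Some_image_borel) simp
    moreover have "(if h None \<in> S then {None :: 'a option} else {}) \<in> sets borel" by simp
    moreover have "h -` S \<inter> space borel = Some ` ((\<lambda>x. h (Some x)) -` S) \<union> (if h None \<in> S then {None} else {})"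
    proof (rule set_eqI)
      fix x show "x \<in> h -` S \<inter> space borel \<longleftrightarrow>
          x \<in> Some ` ((\<lambda>x. h (Some x)) -` S) \<union> (if h None \<in> S then {None} else {})"
        by (cases x) auto
    qed
    ultimately show "h -` S \<inter> space borel \<in> sets borel" by simp
  qed
qed (rule measurable_compose[OF measurable_Some])

section \<open>The branching property in integrated form\<close>

locale bifurcating_chain = prob_space M for M :: "'w measure" +
  fixes \<nu> :: "'a::topological_space option measure"
    and P :: "'a option \<Rightarrow> ('a option \<times> 'a option) measure"
    and X :: "bool list \<Rightarrow> 'w \<Rightarrow> 'a option"
  assumes P: "bmc_kernel P" and X: "bmc M \<nu> P X"
begin

abbreviation "F k \<equiv> generated_by M (tree k) X"

lemma P_prob_space: "prob_space (P x)" and sets_P: "sets (P x) = sets (borel \<Otimes>\<^sub>M borel)"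
  using P measurable_space[of P borel "prob_algebra (borel \<Otimes>\<^sub>M borel)" x]
  by (auto simp: bmc_kernel_def space_prob_algebra)

lemma P_measurable: "P \<in> borel \<rightarrow>\<^sub>M prob_algebra (borel \<Otimes>\<^sub>M borel)"
  using P by (simp add: bmc_kernel_def)

lemma P_measurable_iff: "measurable (P x) N = measurable (borel \<Otimes>\<^sub>M borel) N"
  by (intro measurable_cong_sets sets_P refl)

text \<open>Both the measure and the integrand depend on x. Pushing \<open>P x\<close> forward to
  triples along yz -> (x, yz) gives a kernel with a fixed integrand, and the integral against such a
  kernel is measurable in x.\<close>

lemma kernel_op_measurable:
  assumes g: "g \<in> borel_measurable triple_borel"
  shows "kernel_op P g \<in> borel_measurable borel"
proof -
  have "(\<lambda>x. distr (P x) triple_borel (\<lambda>yz. (x, yz))) \<in> borel \<rightarrow>\<^sub>M prob_algebra triple_borel"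
    by (rule measurable_distr_prob_space2[OF P_measurable]) simp
  then have "(\<lambda>x. distr (P x) triple_borel (\<lambda>yz. (x, yz))) \<in> borel \<rightarrow>\<^sub>M subprob_algebra triple_borel"
    by (rule measurable_prob_algebraD)
  from measurable_compose[OF this integral_measurable_subprob_algebra[OF g]]
  have "(\<lambda>x. \<integral>t. g t \<partial>distr (P x) triple_borel (\<lambda>yz. (x, yz))) \<in> borel_measurable borel" by simp
  also have "(\<lambda>x. \<integral>t. g t \<partial>distr (P x) triple_borel (\<lambda>yz. (x, yz))) = kernel_op P g"
    unfolding kernel_op_def
    by (rule ext, subst integral_distr) (auto simp: P_measurable_iff g case_prod_unfold)
  finally show ?thesis .
qed

lemma kernel_section_measurable:
  assumes "g \<in> borel_measurable triple_borel"
  shows "(\<lambda>yz. g (x, yz)) \<in> borel_measurable (P x)"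
  using assms by (simp add: P_measurable_iff)

lemma kernel_section_integrable:
  assumes g: "g \<in> bdd_measurable triple_borel"
  shows "integrable (P x) (\<lambda>yz. g (x, yz))"
proof -
  interpret Px: prob_space "P x" by (rule P_prob_space)
  obtain C where "\<And>x. \<bar>g x\<bar> \<le> C" using bdd_measurable_ex[OF g] by blast
  then show ?thesis
    using kernel_section_measurable[OF bdd_measurable_measurable[OF g]]
    by (intro Px.integrable_const_bound[where B=C]) auto
qed

lemma kernel_op_eq: "kernel_op P g x = (\<integral>yz. g (x, yz) \<partial>P x)"
  by (simp add: kernel_op_def case_prod_unfold)

lemma kernel_op_const [simp]: "kernel_op P (\<lambda>_. c) x = c"
  by (simp add: kernel_op_eq prob_space.prob_space[OF P_prob_space])

lemma kernel_op_add:
  assumes "g \<in> bdd_measurable triple_borel" "h \<in> bdd_measurable triple_borel"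
  shows "kernel_op P (\<lambda>t. g t + h t) x = kernel_op P g x + kernel_op P h x"
  unfolding kernel_op_eq using assms by (intro Bochner_Integration.integral_add kernel_section_integrable)

lemma kernel_op_cmult: "kernel_op P (\<lambda>t. c * g t) x = c * kernel_op P g x"
  unfolding kernel_op_eq by simp

lemma kernel_op_mono:
  assumes "g \<in> bdd_measurable triple_borel" "h \<in> bdd_measurable triple_borel" "\<And>yz. g (x, yz) \<le> h (x, yz)"
  shows "kernel_op P g x \<le> kernel_op P h x"
  unfolding kernel_op_eq using assms by (intro integral_mono kernel_section_integrable) auto

lemma kernel_op_abs_le:
  assumes g: "g \<in> bdd_measurable triple_borel" and C: "\<And>yz. \<bar>g (x, yz)\<bar> \<le> C"
  shows "\<bar>kernel_op P g x\<bar> \<le> C"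
proof -
  have "g (x, yz) \<le> C" "- C \<le> g (x, yz)" for yz using C[of yz] by auto
  then have "kernel_op P g x \<le> kernel_op P (\<lambda>_. C) x" "kernel_op P (\<lambda>_. - C) x \<le> kernel_op P g x"
    using g by (auto intro!: kernel_op_mono simp del: kernel_op_const)
  then show ?thesis by simp
qed

lemma kernel_op_bdd:
  assumes "g \<in> bdd_measurable triple_borel"
  shows "kernel_op P g \<in> bdd_measurable borel"
proof -
  obtain C where "\<And>x. \<bar>g x\<bar> \<le> C" using bdd_measurable_ex[OF assms] by blast
  then show ?thesis
    by (intro bdd_measurableI[OF kernel_op_measurable[OF bdd_measurable_measurable[OF assms]] kernel_op_abs_le[OF assms]])
qed

lemma kernel_var_bdd:
  "g \<in> bdd_measurable triple_borel \<Longrightarrow> kernel_var P g \<in> bdd_measurable borel"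
  unfolding kernel_var_def by (intro bdd_intros kernel_op_bdd)

lemma kernel_dead: "AE yz in P None. yz = (None, None)"
proof -
  interpret PN: prob_space "P None" by (rule P_prob_space)
  have "PN.prob {(None, None)} = 1" using P by (simp add: bmc_kernel_def)
  moreover have "{None} \<times> {None} \<in> sets (borel \<Otimes>\<^sub>M (borel :: 'a option measure))"
    by (intro pair_measureI None_in_borel)
  ultimately show ?thesis by (subst (asm) PN.prob_eq_1) (auto simp: sets_P)
qed

lemma kernel_op_dead:
  assumes "g \<in> borel_measurable triple_borel"
  shows "kernel_op P g None = g (None, None, None)"
proof -
  interpret PN: prob_space "P None" by (rule P_prob_space)
  have "kernel_op P g None = (\<integral>yz. g (None, None, None) \<partial>P None)"
    unfolding kernel_op_eq using kernel_dead kernel_section_measurable[OF assms, of None]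
    by (intro integral_cong_AE) auto
  then show ?thesis by (simp add: PN.prob_space)
qed

lemma X_measurable [measurable]: "X i \<in> M \<rightarrow>\<^sub>M borel"
  using X by (simp add: bmc_def)

lemma Delta_measurable [measurable]: "Delta X i \<in> M \<rightarrow>\<^sub>M triple_borel"
  unfolding Delta_def by measurable

lemma space_F [simp]: "space (F k) = space M"
  unfolding generated_by_def by (rule space_measure_of) auto

lemma sets_F: "sets (F k) = sigma_sets (space M) (\<Union>j\<in>tree k. {X j -` A \<inter> space M | A. A \<in> sets borel})"
  unfolding generated_by_def by (rule sets_measure_of) auto

lemma subalgebra_F: "subalgebra M (F k)"
  unfolding subalgebra_def sets_F space_F
  by (intro conjI refl sets.sigma_sets_subset) auto

lemma X_measurable_F: "length i \<le> k \<Longrightarrow> X i \<in> F k \<rightarrow>\<^sub>M borel"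
proof (rule measurableI)
  fix A :: "'a option set" assume "A \<in> sets borel" "length i \<le> k"
  then show "X i -` A \<inter> space (F k) \<in> sets (F k)"
    unfolding sets_F space_F by (intro sigma_sets.Basic) (auto simp: tree_def generation_def)
qed simp

lemma Delta_measurable_F: "length i < k \<Longrightarrow> Delta X i \<in> F k \<rightarrow>\<^sub>M triple_borel"
  unfolding Delta_def by (intro measurable_Pair X_measurable_F) auto

lemma gen_sum_measurable_F:
  "h \<in> borel_measurable borel \<Longrightarrow> n \<le> k \<Longrightarrow> gen_sum X n h \<in> borel_measurable (F k)"
  unfolding gen_sum_def [abs_def]
  by (intro borel_measurable_sum measurable_compose[OF X_measurable_F]) (auto simp: generation_def)

lemma gen_sum_measurable [measurable (raw)]:
  "h \<in> borel_measurable borel \<Longrightarrow> gen_sum X n h \<in> borel_measurable M"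
  by (rule measurable_from_subalg[OF subalgebra_F gen_sum_measurable_F[OF _ order_refl]])

lemma gen_sum_bdd: "h \<in> bdd_measurable borel \<Longrightarrow> gen_sum X k h \<in> bdd_measurable M"
  unfolding gen_sum_def [abs_def] by (rule bdd_measurable_sum, rule bdd_measurable_comp[of h borel]) auto

lemma gen_sum_bdd_F: "h \<in> bdd_measurable borel \<Longrightarrow> n \<le> k \<Longrightarrow> gen_sum X n h \<in> bdd_measurable (F k)"
  unfolding gen_sum_def [abs_def]
  by (rule bdd_measurable_sum, rule bdd_measurable_comp[of h borel]) (auto simp: generation_def intro!: X_measurable_F)

lemma tri_sum_bdd: "g \<in> bdd_measurable triple_borel \<Longrightarrow> tri_sum X k g \<in> bdd_measurable M"
  unfolding tri_sum_def [abs_def] by (rule bdd_measurable_sum, rule bdd_measurable_comp[of g triple_borel]) auto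

lemma tri_sum_bdd_F:
  "g \<in> bdd_measurable triple_borel \<Longrightarrow> n < k \<Longrightarrow> tri_sum X n g \<in> bdd_measurable (F k)"
  unfolding tri_sum_def [abs_def]
  by (rule bdd_measurable_sum, rule bdd_measurable_comp[of g triple_borel]) (auto simp: generation_def intro!: Delta_measurable_F)

lemma bdd_F_imp_bdd: "\<xi> \<in> bdd_measurable (F k) \<Longrightarrow> \<xi> \<in> bdd_measurable M"
  unfolding bdd_measurable_def using measurable_from_subalg[OF subalgebra_F] by auto

lemma bdd_imp_integrable: "\<xi> \<in> bdd_measurable M \<Longrightarrow> integrable M \<xi>"
  by (rule bdd_measurable_bound, assumption, rule bounded_integrable) (auto simp: bdd_measurable_def)

text \<open>The conditional expectation in \<open>bmc\<close> enters the proof only here. Tested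
  against a weight known at generation k, it becomes an identity of integrals, which is the form
  used for moments and characteristic functions alike.\<close>

lemma expectation_prod:
  assumes \<xi>: "\<xi> \<in> bdd_measurable (F k)" and g: "\<And>i. g i \<in> bdd_measurable triple_borel"
  shows "(\<integral>\<omega>. \<xi> \<omega> * (\<Prod>i\<in>generation k. g i (Delta X i \<omega>)) \<partial>M) =
    (\<integral>\<omega>. \<xi> \<omega> * (\<Prod>i\<in>generation k. kernel_op P (g i) (X i \<omega>)) \<partial>M)"
proof -
  let ?G = "\<lambda>\<omega>. \<Prod>i\<in>generation k. g i (Delta X i \<omega>)"
  let ?H = "\<lambda>\<omega>. \<Prod>i\<in>generation k. kernel_op P (g i) (X i \<omega>)"
  interpret finite_measure_subalgebra M "F k"
    by unfold_locales (rule subalgebra_F)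
  have G: "?G \<in> bdd_measurable M" "?H \<in> bdd_measurable M"
    by (auto intro!: bdd_measurable_prod bdd_measurable_comp[OF g] bdd_measurable_comp[OF kernel_op_bdd[OF g]])
  have "(\<integral>\<omega>. \<xi> \<omega> * ?G \<omega> \<partial>M) = (\<integral>\<omega>. \<xi> \<omega> * real_cond_exp M (F k) ?G \<omega> \<partial>M)"
    using bdd_imp_integrable[OF bdd_measurable_mult[OF bdd_F_imp_bdd[OF \<xi>] G(1)]]
      bdd_measurable_measurable[OF \<xi>] bdd_measurable_measurable[OF G(1)]
    by (intro real_cond_exp_intg(2)[symmetric])
  also have "\<dots> = (\<integral>\<omega>. \<xi> \<omega> * ?H \<omega> \<partial>M)"
  proof (rule integral_cong_AE)
    have "AE \<omega> in M. real_cond_exp M (F k) ?G \<omega> = ?H \<omega>"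
      using X g by (simp add: bmc_def bdd_measurable_def)
    then show "AE \<omega> in M. \<xi> \<omega> * real_cond_exp M (F k) ?G \<omega> = \<xi> \<omega> * ?H \<omega>"
      by eventually_elim simp
  qed (use G bdd_F_imp_bdd[OF \<xi>] in \<open>auto simp: bdd_measurable_def\<close>)
  finally show ?thesis .
qed

lemma expectation_single:
  assumes \<xi>: "\<xi> \<in> bdd_measurable (F k)" and g: "g \<in> bdd_measurable triple_borel" and i: "i \<in> generation k"
  shows "(\<integral>\<omega>. \<xi> \<omega> * g (Delta X i \<omega>) \<partial>M) = (\<integral>\<omega>. \<xi> \<omega> * kernel_op P g (X i \<omega>) \<partial>M)"
proof -
  \<comment> \<open>The kernel maps the constant 1 to 1, so all factors but one drop out on both
    sides.\<close>
  have *: "(\<Prod>l\<in>generation k. (if l = i then u l else 1)) = (u i :: real)" for u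
    using i by (simp add: prod.delta)
  have "(\<integral>\<omega>. \<xi> \<omega> * (\<Prod>l\<in>generation k. (if l = i then g else (\<lambda>_. 1)) (Delta X l \<omega>)) \<partial>M) =
    (\<integral>\<omega>. \<xi> \<omega> * (\<Prod>l\<in>generation k. kernel_op P (if l = i then g else (\<lambda>_. 1)) (X l \<omega>)) \<partial>M)"
    using g by (intro expectation_prod[OF \<xi>]) auto
  then show ?thesis
    by (simp add: * if_distrib[of "\<lambda>f. f _"] if_distrib[of "kernel_op P"] cong: if_cong)
qed

text \<open>Conditional independence of two different families of the same generation; the other
  individuals again receive the factor 1.\<close>

lemma expectation_pair:
  assumes g: "g \<in> bdd_measurable triple_borel" and i: "i \<in> generation k" "j \<in> generation k" "i \<noteq> j"
  shows "(\<integral>\<omega>. g (Delta X i \<omega>) * g (Delta X j \<omega>) \<partial>M) = (\<integral>\<omega>. kernel_op P g (X i \<omega>) * kernel_op P g (X j \<omega>) \<partial>M)"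
proof -
  have *: "(\<Prod>l\<in>generation k. (if l = i \<or> l = j then u l else 1)) = (u i * u j :: real)" for u
  proof -
    have "(\<Prod>l\<in>generation k. (if l = i \<or> l = j then u l else 1)) = (\<Prod>l\<in>{i, j}. u l)"
      using i by (intro prod.mono_neutral_cong_right) auto
    then show ?thesis using i by simp
  qed
  have "(\<integral>\<omega>. 1 * (\<Prod>l\<in>generation k. (if l = i \<or> l = j then g else (\<lambda>_. 1)) (Delta X l \<omega>)) \<partial>M) =
    (\<integral>\<omega>. 1 * (\<Prod>l\<in>generation k. kernel_op P (if l = i \<or> l = j then g else (\<lambda>_. 1)) (X l \<omega>)) \<partial>M)"
    using g by (intro expectation_prod) auto
  then show ?thesis
    by (simp add: * if_distrib[of "\<lambda>f. f _"] if_distrib[of "kernel_op P"] cong: if_cong)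
qed

lemma expectation_tri_sum:
  assumes \<xi>: "\<xi> \<in> bdd_measurable (F k)" and g: "g \<in> bdd_measurable triple_borel"
  shows "(\<integral>\<omega>. \<xi> \<omega> * tri_sum X k g \<omega> \<partial>M) = (\<integral>\<omega>. \<xi> \<omega> * gen_sum X k (kernel_op P g) \<omega> \<partial>M)"
proof -
  have "(\<integral>\<omega>. \<xi> \<omega> * tri_sum X k g \<omega> \<partial>M) = (\<Sum>i\<in>generation k. \<integral>\<omega>. \<xi> \<omega> * g (Delta X i \<omega>) \<partial>M)"
    unfolding tri_sum_def sum_distrib_left
    by (intro Bochner_Integration.integral_sum bdd_imp_integrable bdd_intros bdd_F_imp_bdd[OF \<xi>]
        bdd_measurable_comp[OF g]) auto
  also have "\<dots> = (\<Sum>i\<in>generation k. \<integral>\<omega>. \<xi> \<omega> * kernel_op P g (X i \<omega>) \<partial>M)"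
    using assms by (intro sum.cong refl expectation_single)
  also have "\<dots> = (\<integral>\<omega>. \<xi> \<omega> * gen_sum X k (kernel_op P g) \<omega> \<partial>M)"
    unfolding gen_sum_def sum_distrib_left
    by (intro Bochner_Integration.integral_sum[symmetric] bdd_imp_integrable bdd_intros bdd_F_imp_bdd[OF \<xi>]
        bdd_measurable_comp[OF kernel_op_bdd[OF g]]) auto
  finally show ?thesis .
qed

text \<open>Off the diagonal the conditional means multiply. On the diagonal the conditional second
  moment stands in place of the squared mean, and the excess is the conditional variance.\<close>

lemma second_moment_tri_sum:
  assumes g: "g \<in> bdd_measurable triple_borel"
  shows "(\<integral>\<omega>. (tri_sum X k g \<omega>)\<^sup>2 \<partial>M) =
    (\<integral>\<omega>. (gen_sum X k (kernel_op P g) \<omega>)\<^sup>2 \<partial>M) + (\<integral>\<omega>. gen_sum X k (kernel_var P g) \<omega> \<partial>M)"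
proof -
  let ?G = "generation k"
  have gX: "(\<lambda>\<omega>. g (Delta X i \<omega>)) \<in> bdd_measurable M" for i by (rule bdd_measurable_comp[OF g]) simp
  have pX: "(\<lambda>\<omega>. kernel_op P g (X i \<omega>)) \<in> bdd_measurable M" for i
    by (rule bdd_measurable_comp[OF kernel_op_bdd[OF g]]) simp
  have vX: "(\<lambda>\<omega>. kernel_var P g (X i \<omega>)) \<in> bdd_measurable M" for i
    by (rule bdd_measurable_comp[OF kernel_var_bdd[OF g]]) simp
  have p2X: "(\<lambda>\<omega>. kernel_op P (\<lambda>t. (g t)\<^sup>2) (X i \<omega>)) \<in> bdd_measurable M" for i
    by (rule bdd_measurable_comp[OF kernel_op_bdd[OF bdd_measurable_power2[OF g]]]) simp
  have ij: "(\<integral>\<omega>. g (Delta X i \<omega>) * g (Delta X j \<omega>) \<partial>M) =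
    (\<integral>\<omega>. kernel_op P g (X i \<omega>) * kernel_op P g (X j \<omega>) \<partial>M) + (if j = i then \<integral>\<omega>. kernel_var P g (X i \<omega>) \<partial>M else 0)"
    if "i \<in> ?G" "j \<in> ?G" for i j
  proof (cases "j = i")
    case True
    have "(\<integral>\<omega>. 1 * (g (Delta X i \<omega>))\<^sup>2 \<partial>M) = (\<integral>\<omega>. 1 * kernel_op P (\<lambda>t. (g t)\<^sup>2) (X i \<omega>) \<partial>M)"
      using that g by (intro expectation_single) (auto intro: bdd_intros)
    moreover have "(\<integral>\<omega>. kernel_var P g (X i \<omega>) \<partial>M) = (\<integral>\<omega>. kernel_op P (\<lambda>t. (g t)\<^sup>2) (X i \<omega>) \<partial>M)
        - (\<integral>\<omega>. (kernel_op P g (X i \<omega>))\<^sup>2 \<partial>M)"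
      unfolding kernel_var_def
      by (intro Bochner_Integration.integral_diff bdd_imp_integrable bdd_intros pX p2X)
    ultimately show ?thesis using True by (simp add: power2_eq_square)
  qed (use expectation_pair[OF g that] in simp)
  have "(\<integral>\<omega>. (tri_sum X k g \<omega>)\<^sup>2 \<partial>M) = (\<integral>\<omega>. (\<Sum>i\<in>?G. \<Sum>j\<in>?G. g (Delta X i \<omega>) * g (Delta X j \<omega>)) \<partial>M)"
    by (simp add: tri_sum_def power2_eq_square sum_product)
  also have "\<dots> = (\<Sum>i\<in>?G. \<Sum>j\<in>?G. \<integral>\<omega>. g (Delta X i \<omega>) * g (Delta X j \<omega>) \<partial>M)"
    by (simp add: bdd_imp_integrable gX bdd_intros)
  also have "\<dots> = (\<Sum>i\<in>?G. \<Sum>j\<in>?G. \<integral>\<omega>. kernel_op P g (X i \<omega>) * kernel_op P g (X j \<omega>) \<partial>M)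
      + (\<Sum>i\<in>?G. \<integral>\<omega>. kernel_var P g (X i \<omega>) \<partial>M)"
    by (simp add: ij sum.distrib sum.delta cong: sum.cong)
  also have "(\<Sum>i\<in>?G. \<integral>\<omega>. kernel_var P g (X i \<omega>) \<partial>M) = (\<integral>\<omega>. gen_sum X k (kernel_var P g) \<omega> \<partial>M)"
    unfolding gen_sum_def by (simp add: bdd_imp_integrable vX)
  also have "(\<Sum>i\<in>?G. \<Sum>j\<in>?G. \<integral>\<omega>. kernel_op P g (X i \<omega>) * kernel_op P g (X j \<omega>) \<partial>M) =
      (\<integral>\<omega>. (\<Sum>i\<in>?G. \<Sum>j\<in>?G. kernel_op P g (X i \<omega>) * kernel_op P g (X j \<omega>)) \<partial>M)"
    by (simp add: bdd_imp_integrable pX bdd_intros)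
  also have "\<dots> = (\<integral>\<omega>. (gen_sum X k (kernel_op P g) \<omega>)\<^sup>2 \<partial>M)"
    by (simp add: gen_sum_def power2_eq_square sum_product)
  finally show ?thesis .
qed

section \<open>Martingale increments and their orthogonality\<close>

definition mg_incr :: "('a option \<times> 'a option \<times> 'a option \<Rightarrow> real) \<Rightarrow> nat \<Rightarrow> 'w \<Rightarrow> real" where
  "mg_incr g k \<omega> = tri_sum X k g \<omega> - gen_sum X k (kernel_op P g) \<omega>"

lemma mg_incr_bdd: "g \<in> bdd_measurable triple_borel \<Longrightarrow> mg_incr g k \<in> bdd_measurable M"
  unfolding mg_incr_def by (intro bdd_intros tri_sum_bdd gen_sum_bdd kernel_op_bdd)

lemma mg_incr_bdd_F: "g \<in> bdd_measurable triple_borel \<Longrightarrow> n < k \<Longrightarrow> mg_incr g n \<in> bdd_measurable (F k)"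
  unfolding mg_incr_def by (intro bdd_intros tri_sum_bdd_F gen_sum_bdd_F kernel_op_bdd) auto

lemma expectation_mg_incr:
  assumes \<xi>: "\<xi> \<in> bdd_measurable (F k)" and g: "g \<in> bdd_measurable triple_borel"
  shows "(\<integral>\<omega>. \<xi> \<omega> * mg_incr g k \<omega> \<partial>M) = 0"
proof -
  have "(\<integral>\<omega>. \<xi> \<omega> * mg_incr g k \<omega> \<partial>M) = (\<integral>\<omega>. \<xi> \<omega> * tri_sum X k g \<omega> \<partial>M) - (\<integral>\<omega>. \<xi> \<omega> * gen_sum X k (kernel_op P g) \<omega> \<partial>M)"
    unfolding mg_incr_def right_diff_distrib
    by (intro Bochner_Integration.integral_diff bdd_imp_integrable bdd_intros bdd_F_imp_bdd[OF \<xi>] tri_sum_bdd[OF g]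
        gen_sum_bdd[OF kernel_op_bdd[OF g]])
  then show ?thesis by (simp add: expectation_tri_sum[OF assms])
qed

lemma second_moment_mg_incr:
  assumes g: "g \<in> bdd_measurable triple_borel"
  shows "(\<integral>\<omega>. (mg_incr g k \<omega>)\<^sup>2 \<partial>M) = (\<integral>\<omega>. gen_sum X k (kernel_var P g) \<omega> \<partial>M)"
proof -
  let ?A = "tri_sum X k g" and ?B = "gen_sum X k (kernel_op P g)"
  note bA = tri_sum_bdd[OF g, of k] and bB = gen_sum_bdd[OF kernel_op_bdd[OF g], of k]
  \<comment> \<open>(A - B)^2 is written as A^2 - B^2 - 2 B (A - B): the last product has mean 0
    because B is known at generation k, and A^2 - B^2 has just been computed.\<close>
  have "(\<integral>\<omega>. (mg_incr g k \<omega>)\<^sup>2 \<partial>M) = (\<integral>\<omega>. (?A \<omega>)\<^sup>2 - (?B \<omega>)\<^sup>2 - 2 * (?B \<omega> * mg_incr g k \<omega>) \<partial>M)"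
    by (simp add: mg_incr_def power2_eq_square algebra_simps)
  also have "\<dots> = (\<integral>\<omega>. (?A \<omega>)\<^sup>2 \<partial>M) - (\<integral>\<omega>. (?B \<omega>)\<^sup>2 \<partial>M) - 2 * (\<integral>\<omega>. ?B \<omega> * mg_incr g k \<omega> \<partial>M)"
    by (simp add: bdd_imp_integrable bdd_intros bA bB mg_incr_bdd[OF g])
  also have "\<dots> = (\<integral>\<omega>. gen_sum X k (kernel_var P g) \<omega> \<partial>M)"
    using second_moment_tri_sum[OF g, of k]
      expectation_mg_incr[OF gen_sum_bdd_F[OF kernel_op_bdd[OF g] order_refl] g, of k] by simp
  finally show ?thesis .
qed

text \<open>Pythagoras: the partial sum is known at generation b, hence orthogonal to the next
  increment. The weights allow two uses, with c j = 1 / m^(j+1) for the increments of W_q and c j =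
  1 for the fluctuation sum.\<close>

lemma second_moment_sum_mg_incr:
  assumes g: "g \<in> bdd_measurable triple_borel"
  shows "(\<integral>\<omega>. (\<Sum>j\<in>{a..<b}. c j * mg_incr g j \<omega>)\<^sup>2 \<partial>M) =
    (\<Sum>j\<in>{a..<b}. (c j)\<^sup>2 * (\<integral>\<omega>. (mg_incr g j \<omega>)\<^sup>2 \<partial>M))"
proof (induction b)
  case (Suc b)
  show ?case
  proof (cases "a \<le> b")
    case True
    let ?S = "\<lambda>\<omega>. \<Sum>j\<in>{a..<b}. c j * mg_incr g j \<omega>"
    have S: "?S \<in> bdd_measurable (F b)" by (intro bdd_measurable_sum bdd_intros mg_incr_bdd_F g) auto
    note S' = bdd_F_imp_bdd[OF S]
    have "(\<integral>\<omega>. (\<Sum>j\<in>{a..<Suc b}. c j * mg_incr g j \<omega>)\<^sup>2 \<partial>M) =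
      (\<integral>\<omega>. (?S \<omega>)\<^sup>2 + (c b)\<^sup>2 * (mg_incr g b \<omega>)\<^sup>2 + 2 * c b * (?S \<omega> * mg_incr g b \<omega>) \<partial>M)"
      using True by (simp add: power2_eq_square algebra_simps)
    also have "\<dots> = (\<integral>\<omega>. (?S \<omega>)\<^sup>2 \<partial>M) + (c b)\<^sup>2 * (\<integral>\<omega>. (mg_incr g b \<omega>)\<^sup>2 \<partial>M) + 2 * c b * (\<integral>\<omega>. ?S \<omega> * mg_incr g b \<omega> \<partial>M)"
      using S' by (simp add: bdd_imp_integrable bdd_intros mg_incr_bdd[OF g])
    finally show ?thesis using Suc True expectation_mg_incr[OF S g] by simp
  qed simp
qed simp

end

section \<open>Law of large numbers for functions with vanishing ergodic average\<close>

text \<open>Grouping generation k + 1 by mothers turns a function of individuals into a function of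
  triples one generation earlier.\<close>

definition daughters :: "('a option \<Rightarrow> real) \<Rightarrow> 'a option \<times> 'a option \<times> 'a option \<Rightarrow> real" where
  "daughters h = (\<lambda>(x, y, z). h y + h z)"

definition living :: "'a option \<Rightarrow> real" where
  "living x = (if x = None then 0 else 1)"

text \<open>Functions bounded by C that vanish at the cemetery. The factor \<open>living\<close> in
  the bound makes their generation sums at most C Z_k rather than C 2^k.\<close>

definition live_bdd :: "real \<Rightarrow> ('a::topological_space option \<Rightarrow> real) set" where
  "live_bdd C = {h \<in> borel_measurable borel. \<forall>x. \<bar>h x\<bar> \<le> C * living x}"

lemma living_simps [simp]: "living None = 0" "living (Some x) = 1"
  by (auto simp: living_def)

lemma living_nonneg: "0 \<le> living x" and living_le_1: "living x \<le> 1"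
  by (auto simp: living_def)

lemma living_measurable [measurable]: "living \<in> borel_measurable (borel :: 'a::topological_space option measure)"
  by (subst borel_measurable_option_iff) simp

lemma living_bdd: "living \<in> bdd_measurable (borel :: 'a::topological_space option measure)"
  by (rule bdd_measurableI[where C=1]) (auto simp: living_def)

lemma gen_sum_Suc: "gen_sum X (Suc k) h = tri_sum X k (daughters h)"
  by (auto simp: gen_sum_def tri_sum_def daughters_def Delta_def sum_generation_Suc)

lemma gen_sum_living: "gen_sum X k living \<omega> = real (card (alive X (generation k) \<omega>))"
proof -
  have "real (card (alive X (generation k) \<omega>)) = (\<Sum>i\<in>alive X (generation k) \<omega>. 1)" by simp
  also have "\<dots> = gen_sum X k living \<omega>"
    unfolding gen_sum_def by (subst alive_sum) (auto intro!: sum.cong simp: living_def)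
  finally show ?thesis by simp
qed

lemma daughters_bdd:
  assumes "h \<in> bdd_measurable (borel :: 'a::topological_space option measure)"
  shows "daughters h \<in> bdd_measurable triple_borel"
proof -
  have "(\<lambda>t. h (fst (snd t)) + h (snd (snd t))) \<in>
      bdd_measurable (triple_borel :: ('a option \<times> 'a option \<times> 'a option) measure)"
    using assms by (intro bdd_measurable_add bdd_measurable_comp[OF assms]) auto
  also have "(\<lambda>t. h (fst (snd t)) + h (snd (snd t))) = daughters h"
    by (auto simp: daughters_def)
  finally show ?thesis .
qed

lemma live_bdd_bdd: assumes "h \<in> live_bdd C" shows "h \<in> bdd_measurable borel"
proof (rule bdd_measurableI[where C="\<bar>C\<bar>"])
  fix x have "\<bar>h x\<bar> \<le> C * living x" using assms by (simp add: live_bdd_def)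
  then show "\<bar>h x\<bar> \<le> \<bar>C\<bar>" by (auto simp: living_def split: if_splits)
qed (use assms in \<open>simp add: live_bdd_def\<close>)

lemma live_bdd_le: "h \<in> live_bdd C \<Longrightarrow> \<bar>h x\<bar> \<le> C * living x"
  by (simp add: live_bdd_def)

lemma live_bdd_None: "h \<in> live_bdd C \<Longrightarrow> h None = 0"
  using live_bdd_le[of h C None] by simp

lemma live_bdd_nonneg: "h \<in> live_bdd C \<Longrightarrow> 0 \<le> C"
  using live_bdd_le[of h C "Some undefined"] by auto

lemma (in bifurcating_chain) kernel_var_nonneg:
  assumes g: "g \<in> bdd_measurable triple_borel"
  shows "0 \<le> kernel_var P g x"
proof -
  interpret Px: prob_space "P x" by (rule P_prob_space)
  have "kernel_var P g x = Px.variance (\<lambda>yz. g (x, yz))"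
    unfolding kernel_var_def kernel_op_eq
    using kernel_section_integrable[OF g] kernel_section_integrable[OF bdd_measurable_power2[OF g]]
    by (intro Px.variance_eq[symmetric])
  then show ?thesis by (simp add: Px.variance_positive)
qed

text \<open>At the cemetery the kernel is a point mass, so a dead individual contributes no
  variance. This is what keeps the second moments at order m^k.\<close>

lemma (in bifurcating_chain) kernel_var_le:
  assumes g: "g \<in> bdd_measurable triple_borel" and C: "\<And>x. \<bar>g x\<bar> \<le> C"
  shows "kernel_var P g x \<le> C\<^sup>2 * living x"
proof (cases x)
  case None
  then show ?thesis
    using kernel_op_dead[of g] kernel_op_dead[of "\<lambda>t. (g t)\<^sup>2"] bdd_measurable_measurable[OF g]
    by (simp add: kernel_var_def)
next
  case (Some s)
  have "\<bar>kernel_op P (\<lambda>t. (g t)\<^sup>2) x\<bar> \<le> C\<^sup>2"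
    using order_trans[OF C abs_ge_self]
    by (intro kernel_op_abs_le bdd_measurable_power2 g) (simp add: abs_le_square_iff[symmetric])
  moreover have "(kernel_op P g x)\<^sup>2 \<ge> 0" by simp
  ultimately have "kernel_var P g x \<le> C\<^sup>2" unfolding kernel_var_def by linarith
  then show ?thesis using Some by simp
qed

lemma (in bifurcating_chain) kernel_var_live_bdd:
  assumes g: "g \<in> bdd_measurable triple_borel" and C: "\<And>x. \<bar>g x\<bar> \<le> C"
  shows "kernel_var P g \<in> live_bdd (C\<^sup>2)"
  using kernel_var_le[OF assms] kernel_var_nonneg[OF g] bdd_measurable_measurable[OF kernel_var_bdd[OF g]]
  by (simp add: live_bdd_def)

locale supercritical_chain = bifurcating_chain M \<nu> P X
  for M :: "'w measure" and \<nu> :: "'a::topological_space option measure" and P X +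
  fixes p10 p0 p1 m :: real
  assumes \<nu>: "measure \<nu> (range Some) = 1"
    and homogeneous: "spatially_homogeneous P p10 p0 p1"
    and m: "m = 2 * p10 + p0 + p1"
    and super_critical: "m > 1"
begin

lemma m_pos [simp]: "m > 0" "m \<noteq> 0" "m \<ge> 0"
  using super_critical by auto

lemma range_Some_eq: "range Some = UNIV - {None}"
  using notin_range_Some by fastforce

lemma range_Some_borel [measurable]: "range Some \<in> sets (borel :: 'a option measure)"
  by (simp add: range_Some_eq)

text \<open>For functions of the survival pattern of the two daughters: three patterns have their
  indicators, and d is the value when both daughters are dead.\<close>

lemma kernel_op_offspring:
  assumes "\<And>y z. g (Some x, y, z) =
    a * indicator (range Some \<times> range Some) (y, z) + b * indicator (range Some \<times> {None}) (y, z)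
    + c * indicator ({None} \<times> range Some) (y, z) + d"
  shows "kernel_op P g (Some x) = a * p10 + b * p0 + c * p1 + d"
proof -
  interpret Px: prob_space "P (Some x)" by (rule P_prob_space)
  have [measurable]: "range Some \<times> range Some \<in> sets (P (Some x))" "range Some \<times> {None} \<in> sets (P (Some x))"
    "{None} \<times> range Some \<in> sets (P (Some x))" by (auto simp: sets_P)
  have "kernel_op P g (Some x) = (\<integral>yz. a * indicator (range Some \<times> range Some) yz + b * indicator (range Some \<times> {None}) yz
    + c * indicator ({None} \<times> range Some) yz + d \<partial>P (Some x))"
    unfolding kernel_op_eq using assms by (intro Bochner_Integration.integral_cong) auto
  also have "\<dots> = a * p10 + b * p0 + c * p1 + d"
    using homogeneous
    by (simp add: spatially_homogeneous_def Px.prob_space Px.emeasure_eq_measure Bochner_Integration.integral_add)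
  finally show ?thesis .
qed

section \<open>The operator Q and the second moments of generation sums\<close>

lemma kernel_op_daughters_living: "kernel_op P (daughters living) x = m * living x"
proof (cases x)
  case None
  then show ?thesis
    using kernel_op_dead[OF bdd_measurable_measurable[OF daughters_bdd[OF living_bdd]]]
    by (simp add: daughters_def)
next
  case (Some s)
  have "kernel_op P (daughters living) (Some s) = 2 * p10 + 1 * p0 + 1 * p1 + 0"
    by (rule kernel_op_offspring)
      (auto simp: daughters_def living_def indicator_def range_Some_eq)
  then show ?thesis using Some by (simp add: m)
qed

text \<open>The transition operator of the auxiliary chain, extended to the cemetery. It is read off
  from the kernel directly, since this is the form that conditioning on the previous generation
  produces; \<open>integral_Q_kernel\<close> identifies it with integration against
  \<open>Q_kernel\<close>.\<close>

definition Qop :: "('a option \<Rightarrow> real) \<Rightarrow> 'a option \<Rightarrow> real" where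
  "Qop h x = kernel_op P (daughters h) x / m"

text \<open>\<open>daughters h\<close> lies between -C and C times \<open>daughters living\<close>,
  whose kernel mean is m \<open>living\<close>. Division by m restores the same C, so the constant
  does not grow under iteration.\<close>

lemma Qop_live_bdd:
  assumes h: "h \<in> live_bdd C"
  shows "Qop h \<in> live_bdd C"
proof -
  note hb = live_bdd_bdd[OF h]
  have le: "\<bar>kernel_op P (daughters h) x\<bar> \<le> C * (m * living x)" for x
  proof -
    have b: "(\<lambda>t. c * daughters living t) \<in> bdd_measurable (triple_borel :: ('a option \<times> _) measure)" for c
      by (intro bdd_intros daughters_bdd living_bdd)
    have "h y + h z \<le> C * (living y + living z)" "- C * (living y + living z) \<le> h y + h z" for y z
      using live_bdd_le[OF h, of y] live_bdd_le[OF h, of z] by (auto simp: distrib_left)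
    then have "kernel_op P (daughters h) x \<le> kernel_op P (\<lambda>t. C * daughters living t) x"
      "kernel_op P (\<lambda>t. - C * daughters living t) x \<le> kernel_op P (daughters h) x"
      by (intro kernel_op_mono daughters_bdd hb b; auto simp: daughters_def)+
    then show ?thesis unfolding kernel_op_cmult kernel_op_daughters_living by auto
  qed
  have "\<bar>Qop h x\<bar> \<le> C * living x" for x
    using le[of x] by (simp add: Qop_def abs_divide divide_le_eq mult.commute mult.left_commute)
  moreover have "Qop h \<in> borel_measurable borel"
    unfolding Qop_def [abs_def]
    by (intro borel_measurable_divide kernel_op_measurable bdd_measurable_measurable daughters_bdd hb) auto
  ultimately show ?thesis by (simp add: live_bdd_def)
qed

lemma Qop_funpow_live_bdd: "h \<in> live_bdd C \<Longrightarrow> (Qop ^^ n) h \<in> live_bdd C"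
  by (induction n) (auto intro: Qop_live_bdd)

lemma expectation_gen_sum_Suc:
  assumes h: "h \<in> bdd_measurable borel"
  shows "(\<integral>\<omega>. gen_sum X (Suc k) h \<omega> \<partial>M) = (\<integral>\<omega>. gen_sum X k (kernel_op P (daughters h)) \<omega> \<partial>M)"
  using expectation_tri_sum[of "\<lambda>_. 1" k "daughters h"] h by (simp add: gen_sum_Suc daughters_bdd)

lemma gen_sum_cmult: "gen_sum X k (\<lambda>x. c * h x) \<omega> = c * gen_sum X k h \<omega>"
  by (simp add: gen_sum_def sum_distrib_left)

lemma root_alive: "AE \<omega> in M. X [] \<omega> \<noteq> None"
proof -
  have "prob (X [] -` range Some \<inter> space M) = measure (distr M borel (X [])) (range Some)"
    by (subst measure_distr) auto
  also have "\<dots> = 1" using X \<nu> by (simp add: bmc_def)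
  finally have "AE \<omega> in M. \<omega> \<in> X [] -` range Some \<inter> space M"
    by (subst (asm) prob_eq_1) auto
  then show ?thesis by eventually_elim auto
qed

lemma expectation_gen_sum_living: "(\<integral>\<omega>. gen_sum X k living \<omega> \<partial>M) = m ^ k"
proof (induction k)
  case 0
  have "(\<integral>\<omega>. gen_sum X 0 living \<omega> \<partial>M) = (\<integral>\<omega>. 1 \<partial>M)"
    using root_alive by (intro integral_cong_AE) (auto simp: gen_sum_def generation_0)
  then show ?case by (simp add: prob_space)
next
  case (Suc k)
  have "gen_sum X k (kernel_op P (daughters living)) = (\<lambda>\<omega>. m * gen_sum X k living \<omega>)"
    by (auto simp: kernel_op_daughters_living[abs_def] gen_sum_cmult)
  then show ?case using expectation_gen_sum_Suc[OF living_bdd, of k] Suc by simp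
qed

lemma gen_sum_live_le:
  assumes "h \<in> live_bdd C"
  shows "\<bar>gen_sum X k h \<omega>\<bar> \<le> C * gen_sum X k living \<omega>"
  unfolding gen_sum_def sum_distrib_left
  by (rule order_trans[OF sum_abs sum_mono]) (rule live_bdd_le[OF assms])

lemma gen_sum_living_nonneg: "0 \<le> gen_sum X k living \<omega>"
  unfolding gen_sum_def by (intro sum_nonneg living_nonneg)

lemma gen_sum_living_le: "gen_sum X k living \<omega> \<le> 2 ^ k"
  using sum_mono[of "generation k" "\<lambda>i. living (X i \<omega>)" "\<lambda>_. 1", OF living_le_1]
  by (simp add: gen_sum_def card_generation)

lemma expectation_gen_sum_le:
  assumes h: "h \<in> live_bdd C"
  shows "(\<integral>\<omega>. gen_sum X k h \<omega> \<partial>M) \<le> C * m ^ k"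
proof -
  have "(\<integral>\<omega>. gen_sum X k h \<omega> \<partial>M) \<le> (\<integral>\<omega>. C * gen_sum X k living \<omega> \<partial>M)"
    using gen_sum_live_le[OF h]
    by (intro integral_mono bdd_imp_integrable gen_sum_bdd live_bdd_bdd[OF h] bdd_intros living_bdd)
      (auto simp: abs_le_iff)
  then show ?thesis by (simp add: expectation_gen_sum_living)
qed

lemma second_moment_mg_incr_le:
  assumes "g \<in> bdd_measurable triple_borel" "\<And>x. \<bar>g x\<bar> \<le> C"
  shows "(\<integral>\<omega>. (mg_incr g k \<omega>)\<^sup>2 \<partial>M) \<le> C\<^sup>2 * m ^ k"
  unfolding second_moment_mg_incr[OF assms(1)]
  by (rule expectation_gen_sum_le[OF kernel_var_live_bdd[OF assms]])

definition scaled_moment :: "nat \<Rightarrow> ('a option \<Rightarrow> real) \<Rightarrow> real" where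
  "scaled_moment r h = (\<integral>\<omega>. (gen_sum X r h \<omega> / m ^ r)\<^sup>2 \<partial>M)"

lemma scaled_moment_Suc:
  assumes h: "h \<in> live_bdd C"
  shows "scaled_moment (Suc r) h \<le> scaled_moment r (Qop h) + 4 * C\<^sup>2 * (1 / m) ^ r"
proof -
  let ?g = "daughters h"
  have g: "?g \<in> bdd_measurable triple_borel" by (rule daughters_bdd[OF live_bdd_bdd[OF h]])
  have hC: "\<bar>h x\<bar> \<le> C" for x
    using live_bdd_le[OF h, of x] live_bdd_nonneg[OF h] by (auto simp: living_def split: if_splits)
  \<comment> \<open>Two daughters, each of absolute value at most C: the square of this bound is the
    4 C^2 of the statement.\<close>
  have gC: "\<bar>?g t\<bar> \<le> 2 * C" for t
    using hC[of "fst (snd t)"] hC[of "snd (snd t)"] by (auto simp: daughters_def case_prod_unfold)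
  have "gen_sum X r (kernel_op P ?g) \<omega> = m * gen_sum X r (Qop h) \<omega>" for \<omega>
    by (simp add: Qop_def gen_sum_def sum_distrib_left)
  then have "scaled_moment (Suc r) h =
      ((\<integral>\<omega>. (m * gen_sum X r (Qop h) \<omega>)\<^sup>2 \<partial>M) + (\<integral>\<omega>. gen_sum X r (kernel_var P ?g) \<omega> \<partial>M)) / (m ^ Suc r)\<^sup>2"
    using second_moment_tri_sum[OF g, of r] by (simp add: scaled_moment_def gen_sum_Suc power_divide)
  also have "\<dots> \<le> ((\<integral>\<omega>. (m * gen_sum X r (Qop h) \<omega>)\<^sup>2 \<partial>M) + (2 * C)\<^sup>2 * m ^ r) / (m ^ Suc r)\<^sup>2"
    by (intro divide_right_mono add_left_mono expectation_gen_sum_le kernel_var_live_bdd g gC) auto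
  also have "\<dots> = scaled_moment r (Qop h) + 4 * C\<^sup>2 * ((1 / m) ^ r / m\<^sup>2)"
    by (simp add: scaled_moment_def power_mult_distrib power_divide field_simps power2_eq_square)
  also have "(1 / m) ^ r / m\<^sup>2 \<le> (1 / m) ^ r"
    using super_critical by (simp add: divide_le_eq one_le_power)
  finally show ?thesis by (simp add: mult_left_mono)
qed

text \<open>At a fixed generation l the sum has 2^l terms, a bound independent of n, so pointwise
  convergence of the iterates suffices.\<close>

lemma scaled_moment_tendsto_fixed:
  assumes h: "h \<in> live_bdd C" and lim: "\<And>x. (\<lambda>n. (Qop ^^ n) h x) \<longlonglongrightarrow> 0"
  shows "(\<lambda>n. scaled_moment l ((Qop ^^ n) h)) \<longlonglongrightarrow> 0"
proof -
  note hn = Qop_funpow_live_bdd[OF h]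
  have "(\<lambda>n. scaled_moment l ((Qop ^^ n) h)) \<longlonglongrightarrow> (\<integral>\<omega>. 0 \<partial>M)"
    unfolding scaled_moment_def
  proof (rule integral_tendsto_bounded[where C="(C * 2 ^ l / m ^ l)\<^sup>2"])
    fix n \<omega>
    have "\<bar>gen_sum X l ((Qop ^^ n) h) \<omega>\<bar> \<le> C * 2 ^ l"
      using gen_sum_live_le[OF hn, of l n \<omega>] mult_left_mono[OF gen_sum_living_le live_bdd_nonneg[OF h], of l \<omega>]
      by linarith
    then have "\<bar>gen_sum X l ((Qop ^^ n) h) \<omega> / m ^ l\<bar> \<le> C * 2 ^ l / m ^ l"
      by (simp add: abs_divide divide_right_mono)
    then have "\<bar>gen_sum X l ((Qop ^^ n) h) \<omega> / m ^ l\<bar> \<le> \<bar>C * 2 ^ l / m ^ l\<bar>" by linarith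
    then show "norm ((gen_sum X l ((Qop ^^ n) h) \<omega> / m ^ l)\<^sup>2) \<le> (C * 2 ^ l / m ^ l)\<^sup>2"
      by (simp add: abs_le_square_iff[symmetric])
  next
    have "(\<lambda>n. (gen_sum X l ((Qop ^^ n) h) \<omega> / m ^ l)\<^sup>2) \<longlonglongrightarrow> ((\<Sum>i\<in>generation l. 0) / m ^ l)\<^sup>2" for \<omega>
      unfolding gen_sum_def by (intro tendsto_intros lim) simp
    then show "AE \<omega> in M. (\<lambda>n. (gen_sum X l ((Qop ^^ n) h) \<omega> / m ^ l)\<^sup>2) \<longlonglongrightarrow> 0" by simp
  qed (use bdd_measurable_measurable[OF live_bdd_bdd[OF hn]] in \<open>auto intro!: borel_measurable_power borel_measurable_divide gen_sum_measurable\<close>)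
  then show ?thesis by simp
qed

lemma scaled_moment_tendsto_0:
  assumes h: "h \<in> live_bdd C" and lim: "\<And>x. (\<lambda>n. (Qop ^^ n) h x) \<longlonglongrightarrow> 0"
  shows "(\<lambda>r. scaled_moment r h) \<longlonglongrightarrow> 0"
proof (rule LIMSEQ_I)
  fix \<epsilon> :: real assume \<epsilon>: "\<epsilon> > 0"
  \<comment> \<open>K sums the geometric series of the one-step errors. Keeping the difference
    (1/m)^l - (1/m)^(l+r) in the bound makes the induction close exactly.\<close>
  define K where "K = 4 * C\<^sup>2 / (1 - 1 / m)"
  have m1: "1 - 1 / m > 0" using super_critical by simp
  then have K: "K \<ge> 0" "K * (1 - 1 / m) = 4 * C\<^sup>2" by (auto simp: K_def)
  \<comment> \<open>The induction runs over all h with the same C, because each step replaces h by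
    \<open>Qop h\<close>.\<close>
  have bound: "scaled_moment (l + r) h \<le> scaled_moment l ((Qop ^^ r) h) + K * ((1 / m) ^ l - (1 / m) ^ (l + r))"
    if "h \<in> live_bdd C" for l r h
    using that
  proof (induction r arbitrary: h)
    case (Suc r)
    have "scaled_moment (l + Suc r) h \<le> scaled_moment (l + r) (Qop h) + 4 * C\<^sup>2 * (1 / m) ^ (l + r)"
      using scaled_moment_Suc[OF Suc.prems, of "l + r"] by simp
    also have "\<dots> \<le> scaled_moment l ((Qop ^^ r) (Qop h)) + K * ((1 / m) ^ l - (1 / m) ^ (l + r))
        + K * (1 - 1 / m) * (1 / m) ^ (l + r)"
      unfolding K(2) by (intro add_right_mono Suc.IH Qop_live_bdd Suc.prems)
    also have "\<dots> = scaled_moment l ((Qop ^^ Suc r) h) + K * ((1 / m) ^ l - (1 / m) ^ (l + Suc r))"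
      by (simp add: funpow_swap1 algebra_simps)
    finally show ?case .
  qed simp
  have "(\<lambda>l. K * (1 / m) ^ l) \<longlonglongrightarrow> K * 0"
    using super_critical by (intro tendsto_intros LIMSEQ_power_zero) simp
  then obtain l where "\<bar>K * (1 / m) ^ l\<bar> < \<epsilon> / 2"
    using LIMSEQ_D[of "\<lambda>l. K * (1 / m) ^ l" 0 "\<epsilon> / 2"] \<epsilon> by auto
  then have l: "K * (1 / m) ^ l < \<epsilon> / 2" by linarith
  obtain r0 where r0: "\<And>r. r \<ge> r0 \<Longrightarrow> \<bar>scaled_moment l ((Qop ^^ r) h)\<bar> < \<epsilon> / 2"
    using LIMSEQ_D[OF scaled_moment_tendsto_fixed[OF h lim], of "\<epsilon> / 2" l] \<epsilon> by auto
  show "\<exists>no. \<forall>n\<ge>no. norm (scaled_moment n h - 0) < \<epsilon>"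
  proof (intro exI allI impI)
    fix n assume n: "n \<ge> l + r0"
    have "scaled_moment n h \<le> scaled_moment l ((Qop ^^ (n - l)) h) + K * ((1 / m) ^ l - (1 / m) ^ n)"
      using bound[OF h, of l "n - l"] n by simp
    moreover have "K * (1 / m) ^ n \<ge> 0" using K by simp
    moreover have "scaled_moment l ((Qop ^^ (n - l)) h) < \<epsilon> / 2"
      using r0[of "n - l"] n by linarith
    moreover have "scaled_moment n h \<ge> 0"
      unfolding scaled_moment_def by (intro integral_nonneg_AE) auto
    ultimately show "norm (scaled_moment n h - 0) < \<epsilon>"
      using l by (simp add: right_diff_distrib)
  qed
qed

section \<open>The auxiliary chain as iteration of \<open>Qop\<close>\<close>

definition extend :: "('a \<Rightarrow> real) \<Rightarrow> 'a option \<Rightarrow> real" where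
  "extend h = case_option 0 h"

lemma extend_simps [simp]: "extend h None = 0" "extend h (Some x) = h x"
  by (auto simp: extend_def)

lemma extend_live_bdd:
  assumes "h \<in> borel_measurable borel" "\<And>x. \<bar>h x\<bar> \<le> C"
  shows "extend h \<in> live_bdd C"
proof -
  have "\<bar>extend h x\<bar> \<le> C * living x" for x using assms(2) by (cases x) auto
  moreover have "extend h \<in> borel_measurable borel" using assms(1) by (subst borel_measurable_option_iff) simp
  ultimately show ?thesis by (simp add: live_bdd_def)
qed

text \<open>\<open>measure_of\<close> returns the prescribed values only for a countably additive
  set function; that is the point to check.\<close>

lemma emeasure_Q_kernel:
  assumes A: "A \<in> sets borel"
  shows "emeasure (Q_kernel m P x) A = (emeasure (P0_star P x) A + emeasure (P1_star P x) A) / ennreal m"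
  unfolding Q_kernel_def
proof (rule emeasure_measure_of_sigma[OF _ _ _ A])
  show "sigma_algebra UNIV (sets (borel :: 'a measure))"
    by (metis sets.sigma_algebra_axioms space_borel)
  have s: "sets (P0_star P x) = sets borel" "sets (P1_star P x) = sets borel"
    unfolding P0_star_def P1_star_def by (metis sets.sets_measure_of_eq space_borel)+
  show "countably_additive (sets borel) (\<lambda>A. (emeasure (P0_star P x) A + emeasure (P1_star P x) A) / ennreal m)"
  proof (rule countably_additiveI)
    fix B :: "nat \<Rightarrow> 'a set" assume B: "range B \<subseteq> sets borel" "disjoint_family B"
    then show "(\<Sum>i. (emeasure (P0_star P x) (B i) + emeasure (P1_star P x) (B i)) / ennreal m) =
      (emeasure (P0_star P x) (\<Union>i. B i) + emeasure (P1_star P x) (\<Union>i. B i)) / ennreal m"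
      by (simp add: suminf_add[symmetric] suminf_emeasure s)
  qed
qed (simp add: positive_def)

lemma sets_Q_kernel [measurable_cong, simp]: "sets (Q_kernel m P x) = sets borel"
  unfolding Q_kernel_def by (metis sets.sets_measure_of_eq space_borel)

text \<open>\<open>Q_kernel\<close> is known by its values on sets, so the formula is built up from
  indicators by sums and monotone limits. Working with nonnegative extended values avoids
  integrability conditions along the way.\<close>

lemma nn_integral_Q_kernel:
  assumes h: "h \<in> borel_measurable (borel :: 'a measure)"
  shows "(\<integral>\<^sup>+y. h y \<partial>Q_kernel m P x) =
    (\<integral>\<^sup>+yz. case_option 0 h (fst yz) + case_option 0 h (snd yz) \<partial>P (Some x)) / ennreal m"
proof -
  let ?e = "\<lambda>h y. case_option (0::ennreal) h y :: ennreal"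
  let ?I = "\<lambda>h. \<integral>\<^sup>+yz. ?e h (fst yz) + ?e h (snd yz) \<partial>P (Some x)"
  have e: "?e h \<in> borel_measurable borel" if "h \<in> borel_measurable borel" for h :: "'a \<Rightarrow> ennreal"
    using that by (subst borel_measurable_option_iff) simp
  have [measurable]: "(\<lambda>yz. ?e h (fst yz)) \<in> borel_measurable (P (Some x))" "(\<lambda>yz. ?e h (snd yz)) \<in> borel_measurable (P (Some x))"
    if "h \<in> borel_measurable borel" for h :: "'a \<Rightarrow> ennreal"
    using measurable_compose[OF measurable_fst e[OF that]] measurable_compose[OF measurable_snd e[OF that]]
    by (auto simp: P_measurable_iff)
  have hm: "h \<in> borel_measurable (Q_kernel m P x)" if "h \<in> borel_measurable borel" for h :: "'a \<Rightarrow> ennreal"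
    using that by (simp cong: measurable_cong_sets)
  show ?thesis
    using h
  proof (induction rule: borel_measurable_induct)
    case (cong f g)
    then have "f = g" by auto
    with cong(4) show ?case by (simp only:)
  next
    case (set A)
    have [measurable]: "Some ` A \<times> UNIV \<in> sets (P (Some x))" "UNIV \<times> Some ` A \<in> sets (P (Some x))"
      using Some_image_borel[OF set] by (auto simp: sets_P)
    have "?e (indicator A) (fst yz) = indicator (Some ` A \<times> UNIV) yz"
      "?e (indicator A) (snd yz) = indicator (UNIV \<times> Some ` A) yz" for yz
      by (cases yz; auto simp: indicator_def split: option.split)+
    then show ?case
      using set by (simp add: emeasure_Q_kernel emeasure_P0_star[OF P] emeasure_P1_star[OF P] nn_integral_add)
  next
    case (mult u c)
    have "?e (\<lambda>y. c * u y) y = c * ?e u y" for y by (auto split: option.split)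
    then show ?case
      using mult by (simp add: hm nn_integral_cmult distrib_left[symmetric] ennreal_times_divide)
  next
    case (add u v)
    have "?e (\<lambda>y. v y + u y) y = ?e v y + ?e u y" for y by (auto split: option.split)
    then have "?I (\<lambda>y. v y + u y) = (\<integral>\<^sup>+yz. (?e v (fst yz) + ?e v (snd yz)) + (?e u (fst yz) + ?e u (snd yz)) \<partial>P (Some x))"
      by (simp add: ac_simps)
    also have "\<dots> = ?I v + ?I u" using add by (intro nn_integral_add) auto
    finally have I: "?I (\<lambda>y. v y + u y) = ?I v + ?I u" .
    have "(\<integral>\<^sup>+y. v y + u y \<partial>Q_kernel m P x) = (\<integral>\<^sup>+y. v y \<partial>Q_kernel m P x) + (\<integral>\<^sup>+y. u y \<partial>Q_kernel m P x)"
      using add by (intro nn_integral_add hm)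
    also have "\<dots> = (?I v + ?I u) / ennreal m"
      unfolding add.IH by (rule add_divide_distrib_ennreal[symmetric])
    finally show ?case unfolding I .
  next
    case (seq U)
    have inc: "incseq (\<lambda>i. ?e (U i) y)" for y
      using seq(3) by (auto simp: incseq_def le_fun_def split: option.split)
    have "?e (\<lambda>y. SUP i. U i y) y = (SUP i. ?e (U i) y)" for y by (auto split: option.split)
    then have "?e (\<lambda>y. SUP i. U i y) (fst yz) + ?e (\<lambda>y. SUP i. U i y) (snd yz) = (SUP i. ?e (U i) (fst yz) + ?e (U i) (snd yz))" for yz
      by (simp add: ennreal_SUP_add inc)
    then have "?I (\<lambda>y. SUP i. U i y) = (\<integral>\<^sup>+yz. (SUP i. ?e (U i) (fst yz) + ?e (U i) (snd yz)) \<partial>P (Some x))" by simp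
    also have "\<dots> = (SUP i. ?I (U i))"
    proof (rule nn_integral_monotone_convergence_SUP)
      show "incseq (\<lambda>i yz. ?e (U i) (fst yz) + ?e (U i) (snd yz))"
        using inc by (auto simp: incseq_def le_fun_def intro!: add_mono)
    qed (use seq in auto)
    finally have "?I (\<lambda>y. SUP i. U i y) = (SUP i. ?I (U i))" .
    moreover have "(\<integral>\<^sup>+y. (SUP i. U i y) \<partial>Q_kernel m P x) = (SUP i. \<integral>\<^sup>+y. U i y \<partial>Q_kernel m P x)"
      using seq by (intro nn_integral_monotone_convergence_SUP) (auto intro: hm)
    moreover have sup: "(SUP i. U i) = (\<lambda>y. SUP i. U i y)" by (rule ext) (simp add: image_comp)
    ultimately show ?case unfolding sup by (simp only: SUP_divide_ennreal seq.IH)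
  qed
qed

lemma nn_integral_Q_kernel_bounded:
  assumes h: "h \<in> bdd_measurable (borel :: 'a measure)" and pos: "\<And>x. 0 \<le> h x"
  shows "(\<integral>\<^sup>+y. ennreal (h y) \<partial>Q_kernel m P x) = ennreal (Qop (extend h) (Some x))"
proof -
  obtain C where "\<And>x. \<bar>h x\<bar> \<le> C" using bdd_measurable_ex[OF h] by blast
  then have e: "extend h \<in> live_bdd C" by (intro extend_live_bdd bdd_measurable_measurable[OF h])
  have epos: "0 \<le> extend h y" for y using pos by (cases y) auto
  have "(\<integral>\<^sup>+y. ennreal (h y) \<partial>Q_kernel m P x) =
    (\<integral>\<^sup>+yz. case_option 0 (\<lambda>y. ennreal (h y)) (fst yz) + case_option 0 (\<lambda>y. ennreal (h y)) (snd yz) \<partial>P (Some x)) / ennreal m"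
    using bdd_measurable_measurable[OF h] by (intro nn_integral_Q_kernel) simp
  also have "(\<lambda>yz. case_option 0 (\<lambda>y. ennreal (h y)) (fst yz) + case_option 0 (\<lambda>y. ennreal (h y)) (snd yz)) =
    (\<lambda>yz. ennreal (daughters (extend h) (Some x, yz)))"
  proof
    fix yz
    have "case_option 0 (\<lambda>y. ennreal (h y)) y = ennreal (extend h y)" for y by (cases y) auto
    then show "case_option 0 (\<lambda>y. ennreal (h y)) (fst yz) + case_option 0 (\<lambda>y. ennreal (h y)) (snd yz) =
        ennreal (daughters (extend h) (Some x, yz))"
      using epos by (cases yz) (simp add: daughters_def)
  qed
  also have "(\<integral>\<^sup>+yz. ennreal (daughters (extend h) (Some x, yz)) \<partial>P (Some x)) = ennreal (kernel_op P (daughters (extend h)) (Some x))"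
    unfolding kernel_op_eq using epos
    by (intro nn_integral_eq_integral kernel_section_integrable daughters_bdd live_bdd_bdd[OF e]) (auto simp: daughters_def)
  also have "\<dots> / ennreal m = ennreal (Qop (extend h) (Some x))"
  proof -
    have "0 \<le> kernel_op P (daughters (extend h)) (Some x)"
      unfolding kernel_op_eq using epos by (intro integral_nonneg_AE) (auto simp: daughters_def)
    then show ?thesis by (simp add: Qop_def divide_ennreal)
  qed
  finally show ?thesis .
qed

lemma extend_const: "extend (\<lambda>_. c) x = c * living x"
  by (cases x) auto

lemma Qop_living [simp]: "Qop living x = living x"
  by (simp add: Qop_def kernel_op_daughters_living)

lemma prob_space_Q_kernel: "prob_space (Q_kernel m P x)"
proof
  have "emeasure (Q_kernel m P x) (space (Q_kernel m P x)) = (\<integral>\<^sup>+y. ennreal 1 \<partial>Q_kernel m P x)" by simp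
  also have "\<dots> = ennreal (Qop (extend (\<lambda>_. 1)) (Some x))" by (rule nn_integral_Q_kernel_bounded) auto
  also have "\<dots> = 1" by (simp add: extend_const[abs_def])
  finally show "emeasure (Q_kernel m P x) (space (Q_kernel m P x)) = 1" .
qed

lemma Qop_add:
  assumes "h \<in> bdd_measurable borel" "k \<in> bdd_measurable borel"
  shows "Qop (\<lambda>x. h x + k x) x = Qop h x + Qop k x"
proof -
  have "daughters (\<lambda>x. h x + k x) = (\<lambda>t. daughters h t + daughters k t)" by (auto simp: daughters_def)
  then show ?thesis by (simp add: Qop_def kernel_op_add daughters_bdd assms add_divide_distrib)
qed

lemma Qop_cmult: "Qop (\<lambda>x. c * h x) x = c * Qop h x"
proof -
  have "daughters (\<lambda>x. c * h x) = (\<lambda>t. c * daughters h t)" by (auto simp: daughters_def algebra_simps)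
  then show ?thesis by (simp add: Qop_def kernel_op_cmult)
qed

text \<open>The nonnegative case is applied to h + C. The added constant extends to C
  \<open>living\<close>, which \<open>Qop\<close> fixes, and it cancels against the total mass 1 of
  \<open>Q_kernel\<close>.\<close>

lemma integral_Q_kernel:
  assumes h: "h \<in> bdd_measurable (borel :: 'a measure)"
  shows "(\<integral>y. h y \<partial>Q_kernel m P x) = Qop (extend h) (Some x)"
proof -
  interpret Q: prob_space "Q_kernel m P x" by (rule prob_space_Q_kernel)
  obtain C where C: "\<And>x. \<bar>h x\<bar> \<le> C" using bdd_measurable_ex[OF h] by blast
  have hm: "h \<in> borel_measurable (Q_kernel m P x)"
    using bdd_measurable_measurable[OF h] by (simp cong: measurable_cong_sets)
  have pos: "0 \<le> h y + C" for y using C[of y] by linarith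
  have hC: "(\<lambda>y. h y + C) \<in> bdd_measurable borel" by (intro bdd_intros h)
  have eh: "extend h \<in> live_bdd C" by (intro extend_live_bdd bdd_measurable_measurable[OF h] C)
  have int: "integrable (Q_kernel m P x) h" using C hm by (intro Q.integrable_const_bound[where B=C]) auto
  have ext: "extend (\<lambda>y. h y + C) = (\<lambda>x. extend h x + C * living x)"
    by (auto simp: fun_eq_iff extend_def split: option.split)
  have "ennreal (\<integral>y. h y + C \<partial>Q_kernel m P x) = ennreal (Qop (extend (\<lambda>y. h y + C)) (Some x))"
    using nn_integral_Q_kernel_bounded[OF hC pos, of x] nn_integral_eq_integral[of "Q_kernel m P x" "\<lambda>y. h y + C"] int pos
    by simp
  moreover have "0 \<le> Qop (extend (\<lambda>y. h y + C)) (Some x)"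
  proof -
    have "0 \<le> extend (\<lambda>y. h y + C) y" for y using pos by (cases y) auto
    then show ?thesis
      unfolding Qop_def kernel_op_eq by (intro divide_nonneg_nonneg integral_nonneg_AE) (auto simp: daughters_def)
  qed
  moreover have "0 \<le> (\<integral>y. h y + C \<partial>Q_kernel m P x)" using pos by (intro integral_nonneg_AE) auto
  ultimately have "(\<integral>y. h y + C \<partial>Q_kernel m P x) = Qop (extend (\<lambda>y. h y + C)) (Some x)" by simp
  also have "\<dots> = Qop (extend h) (Some x) + C"
    unfolding ext by (subst Qop_add) (auto simp: Qop_cmult intro!: bdd_intros live_bdd_bdd[OF eh] living_bdd)
  finally show ?thesis using int by (simp add: Q.prob_space)
qed

lemma Qop_extend_measurable:
  assumes "h \<in> bdd_measurable (borel :: 'a measure)"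
  shows "(\<lambda>x. Qop (extend h) (Some x)) \<in> bdd_measurable borel"
    and "extend (\<lambda>x. Qop (extend h) (Some x)) = Qop (extend h)"
proof -
  obtain C where "\<And>x. \<bar>h x\<bar> \<le> C" using bdd_measurable_ex[OF assms] by blast
  then have "Qop (extend h) \<in> live_bdd C"
    by (intro Qop_live_bdd extend_live_bdd bdd_measurable_measurable[OF assms])
  then show "(\<lambda>x. Qop (extend h) (Some x)) \<in> bdd_measurable borel"
    "extend (\<lambda>x. Qop (extend h) (Some x)) = Qop (extend h)"
    by (auto intro!: bdd_measurable_comp[OF live_bdd_bdd] simp: fun_eq_iff extend_def live_bdd_None split: option.split)
qed

text \<open>Conditioning on the past removes the last step and replaces h by its Q-mean at time n.
  Hence the induction is over all h, and the Q-mean must again be a bounded measurable function on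
  S.\<close>

lemma markov_chain_expectation:
  assumes Y: "markov_chain N (return borel x) (Q_kernel m P) Y" and h: "h \<in> bdd_measurable (borel :: 'a measure)"
  shows "(\<integral>\<omega>. h (Y n \<omega>) \<partial>N) = (Qop ^^ n) (extend h) (Some x)"
proof -
  interpret N: prob_space N using Y by (simp add: markov_chain_def)
  have Ym [measurable]: "Y n \<in> N \<rightarrow>\<^sub>M borel" for n using Y by (simp add: markov_chain_def)
  show ?thesis
    using h
  proof (induction n arbitrary: h)
    case 0
    have "(\<integral>\<omega>. h (Y 0 \<omega>) \<partial>N) = (\<integral>y. h y \<partial>distr N borel (Y 0))"
      using bdd_measurable_measurable[OF 0] by (subst integral_distr) auto
    also have "\<dots> = h x"
      using Y bdd_measurable_measurable[OF 0] by (simp add: markov_chain_def integral_return)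
    finally show ?case by simp
  next
    case (Suc n)
    let ?G = "generated_by N {..n} Y"
    have sets_G: "sets ?G = sigma_sets (space N) (\<Union>j\<in>{..n}. {Y j -` A \<inter> space N |A. A \<in> sets borel})"
      unfolding generated_by_def by (rule sets_measure_of) auto
    have space_G: "space ?G = space N"
      unfolding generated_by_def by (rule space_measure_of) auto
    have sub: "subalgebra N ?G"
      unfolding subalgebra_def sets_G space_G
      by (intro conjI refl sets.sigma_sets_subset) auto
    interpret finite_measure_subalgebra N ?G by unfold_locales (rule sub)
    have hY: "(\<lambda>\<omega>. h (Y k \<omega>)) \<in> bdd_measurable N" for k by (rule bdd_measurable_comp[OF Suc.prems]) simp
    obtain C where "\<And>x. \<bar>h x\<bar> \<le> C" using bdd_measurable_ex[OF Suc.prems] by blast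
    then have int: "integrable N (\<lambda>\<omega>. h (Y (Suc n) \<omega>))"
      using bdd_measurable_measurable[OF hY[of "Suc n"]]
      by (intro N.integrable_const_bound[where B=C]) auto
    have "(\<integral>\<omega>. h (Y (Suc n) \<omega>) \<partial>N) = (\<integral>\<omega>. real_cond_exp N ?G (\<lambda>\<omega>. h (Y (Suc n) \<omega>)) \<omega> \<partial>N)"
      by (rule real_cond_exp_int(2)[OF int, symmetric])
    also have "\<dots> = (\<integral>\<omega>. Qop (extend h) (Some (Y n \<omega>)) \<partial>N)"
    proof (rule integral_cong_AE)
      have "AE \<omega> in N. real_cond_exp N ?G (\<lambda>\<omega>. h (Y (Suc n) \<omega>)) \<omega> = (\<integral>y. h y \<partial>Q_kernel m P (Y n \<omega>))"
        using Y Suc.prems by (simp add: markov_chain_def bdd_measurable_def)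
      then show "AE \<omega> in N. real_cond_exp N ?G (\<lambda>\<omega>. h (Y (Suc n) \<omega>)) \<omega> = Qop (extend h) (Some (Y n \<omega>))"
        by (simp add: integral_Q_kernel[OF Suc.prems])
    next
      show "(\<lambda>\<omega>. Qop (extend h) (Some (Y n \<omega>))) \<in> borel_measurable N"
        by (rule measurable_compose[OF Ym bdd_measurable_measurable[OF Qop_extend_measurable(1)[OF Suc.prems]]])
    qed simp
    also have "\<dots> = (Qop ^^ n) (extend (\<lambda>x. Qop (extend h) (Some x))) (Some x)"
      by (rule Suc.IH[OF Qop_extend_measurable(1)[OF Suc.prems]])
    also have "\<dots> = (Qop ^^ Suc n) (extend h) (Some x)"
      by (simp add: Qop_extend_measurable(2)[OF Suc.prems] funpow_swap1)
    finally show ?case .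
  qed
qed

lemma Qop_funpow_None: "h \<in> live_bdd C \<Longrightarrow> (Qop ^^ n) h None = 0"
  by (rule live_bdd_None[OF Qop_funpow_live_bdd])

end

section \<open>The limit of the normalised population and extinction\<close>

text \<open>Meant for t the size of the tree and w that of the generation, both divided by m^r: it
  produces the limiting ratio m / (m - 1).\<close>

lemma tendsto_geometric_average:
  fixes t w :: "nat \<Rightarrow> real"
  assumes m: "m > 1" and w: "w \<longlonglongrightarrow> l" and rec: "\<And>r. t (Suc r) = t r / m + w (Suc r)"
  shows "t \<longlonglongrightarrow> m / (m - 1) * l"
proof -
  \<comment> \<open>c is the fixed point of x -> x / m + l, so t - c obeys a contracting recursion
    with vanishing error.\<close>
  define c where "c = m / (m - 1) * l"
  have "c * (m - 1) = m * l" using m by (simp add: c_def)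
  then have fix_c: "c = c / m + l" using m by (simp add: field_simps)
  have "(\<lambda>r. \<bar>t r - c\<bar>) \<longlonglongrightarrow> 0"
  proof (rule geometric_recursion_tendsto_0[where \<rho>="1 / m"])
    show "\<bar>t (Suc r) - c\<bar> \<le> 1 / m * \<bar>t r - c\<bar> + \<bar>w (Suc r) - l\<bar>" for r
    proof -
      have "t (Suc r) - c = (t r - c) / m + (w (Suc r) - l)"
        unfolding diff_divide_distrib using fix_c rec[of r] by linarith
      then show ?thesis using m abs_triangle_ineq[of "(t r - c) / m" "w (Suc r) - l"] by (simp add: abs_divide)
    qed
    have "(\<lambda>r. w (Suc r) - l) \<longlonglongrightarrow> l - l" using w by (intro tendsto_intros LIMSEQ_Suc)
    then show "(\<lambda>r. \<bar>w (Suc r) - l\<bar>) \<longlonglongrightarrow> 0" by (simp add: tendsto_rabs_zero_iff)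
  qed (use m in auto)
  then have "(\<lambda>r. t r - c) \<longlonglongrightarrow> 0" by (simp add: tendsto_rabs_zero_iff)
  then show ?thesis unfolding c_def by (simp add: LIM_zero_iff)
qed

context supercritical_chain
begin

lemma gen_sum_living_measurable [measurable]: "gen_sum X k living \<in> borel_measurable M"
  by (rule gen_sum_measurable) simp

definition scaled_size :: "nat \<Rightarrow> 'w \<Rightarrow> real" where
  "scaled_size k \<omega> = gen_sum X k living \<omega> / m ^ k"

text \<open>Off the event of convergence \<open>lim\<close> is an unspecified number, so even the
  sign of this variable is controlled only almost surely.\<close>

definition limit_size :: "'w \<Rightarrow> real" where
  "limit_size \<omega> = lim (\<lambda>k. scaled_size k \<omega>)"

lemma scaled_size_bdd: "scaled_size k \<in> bdd_measurable M"
  unfolding scaled_size_def[abs_def] divide_inverse by (intro bdd_intros gen_sum_bdd living_bdd)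

lemma scaled_size_measurable [measurable]: "scaled_size k \<in> borel_measurable M"
  by (rule bdd_measurable_measurable[OF scaled_size_bdd])

lemma scaled_size_nonneg: "0 \<le> scaled_size k \<omega>"
  by (simp add: scaled_size_def gen_sum_living_nonneg)

lemma expectation_scaled_size: "(\<integral>\<omega>. scaled_size k \<omega> \<partial>M) = 1"
  by (simp add: scaled_size_def expectation_gen_sum_living)

lemma limit_size_measurable [measurable]: "limit_size \<in> borel_measurable M"
  unfolding limit_size_def[abs_def] by (rule borel_measurable_lim_metric) simp

lemma scaled_size_Suc:
  "scaled_size (Suc k) \<omega> - scaled_size k \<omega> = (1 / m ^ Suc k) * mg_incr (daughters living) k \<omega>"
proof -
  have "gen_sum X k (kernel_op P (daughters living)) \<omega> = m * gen_sum X k living \<omega>"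
    by (simp add: kernel_op_daughters_living[abs_def] gen_sum_cmult)
  then show ?thesis
    by (simp add: scaled_size_def mg_incr_def gen_sum_Suc diff_divide_distrib)
qed

lemma scaled_size_diff:
  "scaled_size (n + p) \<omega> - scaled_size n \<omega> = (\<Sum>j\<in>{n..<n + p}. (1 / m ^ Suc j) * mg_incr (daughters living) j \<omega>)"
proof (induction p)
  case (Suc p)
  then show ?case using scaled_size_Suc[of "n + p" \<omega>] by simp
qed simp

lemma daughters_living_le: "\<bar>daughters living t\<bar> \<le> 2"
  using living_nonneg[of "fst (snd t)"] living_nonneg[of "snd (snd t)"]
    living_le_1[of "fst (snd t)"] living_le_1[of "snd (snd t)"]
  by (simp add: daughters_def case_prod_unfold)

lemma scaled_size_L2:
  "(\<integral>\<omega>. (scaled_size (n + p) \<omega> - scaled_size n \<omega>)\<^sup>2 \<partial>M) \<le> 4 * m / (m - 1) * (1 / m) ^ n"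
proof -
  \<comment> \<open>The 4 is the square of the largest number of daughters, and m / (m - 1) sums the
    geometric series.\<close>
  define K where "K = 4 * m / (m - 1)"
  have K: "K * (1 - 1 / m) = 4" "K \<ge> 0" using super_critical by (auto simp: K_def field_simps)
  have "(\<integral>\<omega>. (scaled_size (n + p) \<omega> - scaled_size n \<omega>)\<^sup>2 \<partial>M) =
      (\<Sum>j\<in>{n..<n + p}. (1 / m ^ Suc j)\<^sup>2 * (\<integral>\<omega>. (mg_incr (daughters living) j \<omega>)\<^sup>2 \<partial>M))"
    unfolding scaled_size_diff by (rule second_moment_sum_mg_incr[OF daughters_bdd[OF living_bdd]])
  also have "\<dots> \<le> (\<Sum>j\<in>{n..<n + p}. 4 * (1 / m) ^ j)"
  proof (rule sum_mono)
    fix j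
    have "(1 / m ^ Suc j)\<^sup>2 * (\<integral>\<omega>. (mg_incr (daughters living) j \<omega>)\<^sup>2 \<partial>M) \<le> (1 / m ^ Suc j)\<^sup>2 * (2\<^sup>2 * m ^ j)"
      by (intro mult_left_mono second_moment_mg_incr_le daughters_bdd living_bdd daughters_living_le) auto
    also have "\<dots> = 4 * ((1 / m) ^ j / m\<^sup>2)"
      by (simp add: power_divide field_simps power2_eq_square)
    also have "(1 / m) ^ j / m\<^sup>2 \<le> (1 / m) ^ j"
      using super_critical by (simp add: divide_le_eq one_le_power)
    finally show "(1 / m ^ Suc j)\<^sup>2 * (\<integral>\<omega>. (mg_incr (daughters living) j \<omega>)\<^sup>2 \<partial>M) \<le> 4 * (1 / m) ^ j" by simp
  qed
  also have "(\<Sum>j\<in>{n..<n + p}. 4 * (1 / m) ^ j) = K * ((1 / m) ^ n - (1 / m) ^ (n + p))"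
  proof (induction p)
    case (Suc p)
    have "(\<Sum>j\<in>{n..<n + Suc p}. 4 * (1 / m) ^ j) = K * ((1 / m) ^ n - (1 / m) ^ (n + p)) + K * (1 - 1 / m) * (1 / m) ^ (n + p)"
      unfolding K Suc[symmetric] by simp
    also have "\<dots> = K * ((1 / m) ^ n - (1 / m) ^ (n + Suc p))" by (simp add: algebra_simps)
    finally show ?case .
  qed simp
  also have "\<dots> \<le> K * (1 / m) ^ n"
    using K by (intro mult_left_mono) auto
  finally show ?thesis unfolding K_def .
qed

text \<open>The expected absolute increments are summable. The series of absolute increments
  therefore has finite mean, is almost surely finite, and W_q converges as a telescoping
  sum.\<close>

lemma AE_scaled_size_tendsto: "AE \<omega> in M. (\<lambda>k. scaled_size k \<omega>) \<longlonglongrightarrow> limit_size \<omega>"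
proof -
  let ?D = "\<lambda>k \<omega>. scaled_size (Suc k) \<omega> - scaled_size k \<omega>"
  let ?K = "4 * m / (m - 1)"
  \<comment> \<open>The squared increments have mean O(\<rho>^(2k)), so \<bar>x\<bar> \<le> \<rho>^k
    + x^2 / \<rho>^k balances the two terms and gives first moments O(\<rho>^k).\<close>
  define \<rho> where "\<rho> = sqrt (1 / m)"
  have \<rho>: "0 < \<rho>" "\<rho> < 1" "\<rho>\<^sup>2 = 1 / m"
    using super_critical by (auto simp: \<rho>_def)
  have K: "?K \<ge> 0" using super_critical by simp
  have Dint: "integrable M (?D k)" "integrable M (\<lambda>\<omega>. (?D k \<omega>)\<^sup>2)" for k
    by (intro bdd_imp_integrable bdd_intros scaled_size_bdd)+
  have L1: "(\<integral>\<omega>. \<bar>?D k \<omega>\<bar> \<partial>M) \<le> (1 + ?K) * \<rho> ^ k" for k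
  proof -
    have le: "\<bar>x\<bar> \<le> \<rho> ^ k + x\<^sup>2 / \<rho> ^ k" for x :: real
    proof -
      have "\<bar>x\<bar> * \<rho> ^ k \<le> \<rho> ^ k * \<rho> ^ k + \<bar>x\<bar>\<^sup>2"
      proof -
        have "0 \<le> \<bar>x\<bar> * \<rho> ^ k" using \<rho> by simp
        then show ?thesis
          using sum_squares_bound[of "\<bar>x\<bar>" "\<rho> ^ k"] by (simp only: power2_eq_square)
      qed
      then show ?thesis using \<rho> by (simp add: field_simps)
    qed
    have "(\<integral>\<omega>. \<bar>?D k \<omega>\<bar> \<partial>M) \<le> (\<integral>\<omega>. \<rho> ^ k + (?D k \<omega>)\<^sup>2 / \<rho> ^ k \<partial>M)"
      using Dint by (intro integral_mono le) auto
    also have "\<dots> = \<rho> ^ k + (\<integral>\<omega>. (?D k \<omega>)\<^sup>2 \<partial>M) / \<rho> ^ k"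
      using Dint by (simp add: prob_space)
    also have "\<dots> \<le> \<rho> ^ k + ?K * (\<rho> ^ k * \<rho> ^ k) / \<rho> ^ k"
    proof -
      have "\<rho> ^ k * \<rho> ^ k = (1 / m) ^ k"
        unfolding \<rho>(3)[symmetric] power2_eq_square power_mult_distrib by (rule refl)
      then show ?thesis
        using scaled_size_L2[of k 1] \<rho>(1) by (intro add_left_mono divide_right_mono) auto
    qed
    also have "\<dots> = (1 + ?K) * \<rho> ^ k"
      using \<rho>(1) by (simp add: distrib_right)
    finally show ?thesis .
  qed
  have "(\<integral>\<^sup>+\<omega>. (\<Sum>k. ennreal \<bar>?D k \<omega>\<bar>) \<partial>M) = (\<Sum>k. \<integral>\<^sup>+\<omega>. ennreal \<bar>?D k \<omega>\<bar> \<partial>M)"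
    by (rule nn_integral_suminf) simp
  also have "\<dots> = (\<Sum>k. ennreal (\<integral>\<omega>. \<bar>?D k \<omega>\<bar> \<partial>M))"
    using Dint by (subst nn_integral_eq_integral) auto
  also have "\<dots> \<le> (\<Sum>k. ennreal ((1 + ?K) * \<rho> ^ k))"
    using L1 by (intro suminf_le ennreal_leI) auto
  also have "\<dots> < \<infinity>"
  proof -
    have "summable (\<lambda>k. (1 + ?K) * \<rho> ^ k)" using \<rho> by (intro summable_mult summable_geometric) auto
    then have "(\<Sum>k. ennreal ((1 + ?K) * \<rho> ^ k)) = ennreal (\<Sum>k. (1 + ?K) * \<rho> ^ k)"
      using \<rho> K by (intro suminf_ennreal2) auto
    then show ?thesis by simp
  qed
  finally have fin: "(\<integral>\<^sup>+\<omega>. (\<Sum>k. ennreal \<bar>?D k \<omega>\<bar>) \<partial>M) \<noteq> \<infinity>" by simp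
  have "AE \<omega> in M. (\<Sum>k. ennreal \<bar>?D k \<omega>\<bar>) \<noteq> \<infinity>"
    by (rule nn_integral_PInf_AE[OF _ fin]) measurable
  then show ?thesis
  proof eventually_elim
    case (elim \<omega>)
    then have "summable (\<lambda>k. \<bar>?D k \<omega>\<bar>)" by (intro summable_suminf_not_top) auto
    then have "summable (\<lambda>k. ?D k \<omega>)" by (rule summable_rabs_cancel)
    then have "convergent (\<lambda>n. scaled_size n \<omega> - scaled_size 0 \<omega>)"
      unfolding summable_iff_convergent sum_lessThan_telescope[of "\<lambda>n. scaled_size n \<omega>"] .
    from convergent_add[OF this convergent_const[of "scaled_size 0 \<omega>"]]
    have "convergent (\<lambda>k. scaled_size k \<omega>)" by simp
    then show ?case unfolding limit_size_def by (simp add: convergent_LIMSEQ_iff)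
  qed
qed

text \<open>Fatou's lemma as p tends to infinity in the bound for W_(n+p) - W_n, which is uniform in
  p. The nonnegative integral makes sense before square integrability of the limit is known.\<close>

lemma limit_size_L2:
  "(\<integral>\<^sup>+\<omega>. ennreal ((scaled_size n \<omega> - limit_size \<omega>)\<^sup>2) \<partial>M) \<le> ennreal (4 * m / (m - 1) * (1 / m) ^ n)"
proof -
  have "(\<integral>\<^sup>+\<omega>. ennreal ((scaled_size n \<omega> - limit_size \<omega>)\<^sup>2) \<partial>M) =
    (\<integral>\<^sup>+\<omega>. liminf (\<lambda>p. ennreal ((scaled_size (n + p) \<omega> - scaled_size n \<omega>)\<^sup>2)) \<partial>M)"
  proof (rule nn_integral_cong_AE)
    show "AE \<omega> in M. ennreal ((scaled_size n \<omega> - limit_size \<omega>)\<^sup>2) = liminf (\<lambda>p. ennreal ((scaled_size (n + p) \<omega> - scaled_size n \<omega>)\<^sup>2))"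
      using AE_scaled_size_tendsto
    proof eventually_elim
      case (elim \<omega>)
      have "(\<lambda>p. scaled_size (n + p) \<omega>) \<longlonglongrightarrow> limit_size \<omega>"
        using LIMSEQ_ignore_initial_segment[OF elim, of n] by (simp add: add.commute)
      then have "(\<lambda>p. ennreal ((scaled_size (n + p) \<omega> - scaled_size n \<omega>)\<^sup>2)) \<longlonglongrightarrow> ennreal ((limit_size \<omega> - scaled_size n \<omega>)\<^sup>2)"
        by (intro tendsto_ennrealI tendsto_intros)
      from lim_imp_Liminf[OF sequentially_bot this] show ?case
        by (simp add: power2_commute[of "limit_size \<omega>"])
    qed
  qed
  also have "\<dots> \<le> liminf (\<lambda>p. \<integral>\<^sup>+\<omega>. ennreal ((scaled_size (n + p) \<omega> - scaled_size n \<omega>)\<^sup>2) \<partial>M)"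
    by (rule nn_integral_liminf) simp
  also have "\<dots> \<le> ennreal (4 * m / (m - 1) * (1 / m) ^ n)"
  proof (rule Liminf_le[OF sequentially_bot always_eventually], rule allI)
    fix p
    have "integrable M (\<lambda>\<omega>. (scaled_size (n + p) \<omega> - scaled_size n \<omega>)\<^sup>2)"
      by (intro bdd_imp_integrable bdd_intros scaled_size_bdd)
    then show "(\<integral>\<^sup>+\<omega>. ennreal ((scaled_size (n + p) \<omega> - scaled_size n \<omega>)\<^sup>2) \<partial>M) \<le> ennreal (4 * m / (m - 1) * (1 / m) ^ n)"
      using scaled_size_L2[of n p] by (subst nn_integral_eq_integral) (auto intro: ennreal_leI)
  qed
  finally show ?thesis .
qed

lemma limit_size_L2_tendsto:
  "(\<lambda>n. \<integral>\<^sup>+\<omega>. ennreal ((scaled_size n \<omega> - limit_size \<omega>)\<^sup>2) \<partial>M) \<longlonglongrightarrow> 0"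
proof (rule tendsto_sandwich[OF _ _ tendsto_const])
  have "(\<lambda>n. 4 * m / (m - 1) * (1 / m) ^ n) \<longlonglongrightarrow> 4 * m / (m - 1) * 0"
    using super_critical by (intro tendsto_intros LIMSEQ_power_zero) simp
  then have "(\<lambda>n. ennreal (4 * m / (m - 1) * (1 / m) ^ n)) \<longlonglongrightarrow> ennreal 0" by (intro tendsto_ennrealI) simp
  then show "(\<lambda>n. ennreal (4 * m / (m - 1) * (1 / m) ^ n)) \<longlonglongrightarrow> 0" by simp
qed (use limit_size_L2 in auto)

text \<open>If W were almost surely 0, L2 convergence would force E W_n^2 to 0; but the nonnegative
  variance and E W_n = 1 keep it at least 1.\<close>

lemma limit_size_not_AE_0: "prob {\<omega>\<in>space M. limit_size \<omega> = 0} < 1"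
proof (rule ccontr)
  assume "\<not> ?thesis"
  then have "prob {\<omega>\<in>space M. limit_size \<omega> = 0} = 1" by (simp add: antisym)
  then have AE0: "AE \<omega> in M. limit_size \<omega> = 0" by (subst (asm) prob_eq_1) auto
  have "1 \<le> (\<integral>\<^sup>+\<omega>. ennreal ((scaled_size n \<omega> - limit_size \<omega>)\<^sup>2) \<partial>M)" for n
  proof -
    have int: "integrable M (\<lambda>\<omega>. (scaled_size n \<omega>)\<^sup>2)" "integrable M (scaled_size n)"
      by (intro bdd_imp_integrable bdd_intros scaled_size_bdd)+
    have "0 \<le> variance (scaled_size n)" by (rule variance_positive)
    also have "\<dots> = (\<integral>\<omega>. (scaled_size n \<omega>)\<^sup>2 \<partial>M) - 1"
      using variance_eq[OF int(2,1)] by (simp add: expectation_scaled_size)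
    finally have "ennreal 1 \<le> ennreal (\<integral>\<omega>. (scaled_size n \<omega>)\<^sup>2 \<partial>M)" by (intro ennreal_leI) simp
    also have "\<dots> = (\<integral>\<^sup>+\<omega>. ennreal ((scaled_size n \<omega>)\<^sup>2) \<partial>M)"
      using int by (intro nn_integral_eq_integral[symmetric]) auto
    also have "\<dots> = (\<integral>\<^sup>+\<omega>. ennreal ((scaled_size n \<omega> - limit_size \<omega>)\<^sup>2) \<partial>M)"
      using AE0 by (intro nn_integral_cong_AE) auto
    finally show ?thesis by simp
  qed
  then have "(1::ennreal) \<le> 0"
    by (intro LIMSEQ_le_const[OF limit_size_L2_tendsto]) auto
  then show False by simp
qed

definition tree_size :: "nat \<Rightarrow> 'w \<Rightarrow> real" where
  "tree_size r \<omega> = (\<Sum>q\<le>r. gen_sum X q living \<omega>)"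

lemma card_alive_tree: "real (card (alive X (tree r) \<omega>)) = tree_size r \<omega>"
proof -
  have "real (card (alive X (tree r) \<omega>)) = (\<Sum>i\<in>alive X (tree r) \<omega>. 1)" by simp
  also have "\<dots> = (\<Sum>i\<in>tree r. living (X i \<omega>))"
    by (subst alive_sum) (auto intro!: sum.cong simp: living_def)
  finally show ?thesis by (simp add: tree_size_def gen_sum_def sum_tree)
qed

lemma tree_size_measurable [measurable]: "tree_size r \<in> borel_measurable M"
  unfolding tree_size_def[abs_def] by (intro borel_measurable_sum gen_sum_measurable) simp

lemma AE_tree_size_tendsto:
  "AE \<omega> in M. (\<lambda>r. tree_size r \<omega> / m ^ r) \<longlonglongrightarrow> m / (m - 1) * limit_size \<omega>"
  using AE_scaled_size_tendsto
proof eventually_elim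
  case (elim \<omega>)
  show ?case
    by (rule tendsto_geometric_average[OF super_critical elim])
      (simp add: tree_size_def scaled_size_def add_divide_distrib)
qed

section \<open>Extinction and the offspring generating function\<close>

text \<open>With the indicator of Z_k = 0 as weight, the branching identity gives
  E[1_{Z_k = 0} Z_(k+1)] = m E[1_{Z_k = 0} Z_k] = 0. The cemetery is absorbing through the kernel,
  hence only almost surely for the process.\<close>

lemma AE_extinct_Suc:
  "AE \<omega> in M. gen_sum X k living \<omega> = 0 \<longrightarrow> gen_sum X (Suc k) living \<omega> = 0"
proof -
  let ?\<xi> = "\<lambda>\<omega>. if gen_sum X k living \<omega> = 0 then 1 else 0 :: real"
  have [measurable]: "gen_sum X k living \<in> borel_measurable (F k)"
    by (rule gen_sum_measurable_F) auto
  have \<xi>: "?\<xi> \<in> bdd_measurable (F k)"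
    by (rule bdd_measurableI[where C=1]) auto
  have "(\<integral>\<omega>. ?\<xi> \<omega> * gen_sum X (Suc k) living \<omega> \<partial>M) = (\<integral>\<omega>. ?\<xi> \<omega> * (m * gen_sum X k living \<omega>) \<partial>M)"
    using expectation_tri_sum[OF \<xi> daughters_bdd[OF living_bdd]]
    by (simp add: gen_sum_Suc kernel_op_daughters_living[abs_def] gen_sum_cmult)
  also have "\<dots> = 0" by (intro integral_eq_zero_AE) auto
  finally have "(\<integral>\<omega>. ?\<xi> \<omega> * gen_sum X (Suc k) living \<omega> \<partial>M) = 0" .
  then have "AE \<omega> in M. ?\<xi> \<omega> * gen_sum X (Suc k) living \<omega> = 0"
    by (subst (asm) integral_nonneg_eq_0_iff_AE)
      (auto intro!: bdd_imp_integrable bdd_intros bdd_F_imp_bdd[OF \<xi>] gen_sum_bdd living_bdd mult_nonneg_nonneg gen_sum_living_nonneg)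
  then show ?thesis by eventually_elim auto
qed

lemma AE_extinct_stays:
  "AE \<omega> in M. \<forall>k. gen_sum X k living \<omega> = 0 \<longrightarrow> (\<forall>j\<ge>k. gen_sum X j living \<omega> = 0)"
proof -
  have "AE \<omega> in M. \<forall>k. gen_sum X k living \<omega> = 0 \<longrightarrow> gen_sum X (Suc k) living \<omega> = 0"
    unfolding AE_all_countable by (intro allI AE_extinct_Suc)
  then show ?thesis
  proof eventually_elim
    case (elim \<omega>)
    show ?case
    proof (intro allI impI)
      fix k j :: nat assume "gen_sum X k living \<omega> = 0" "k \<le> j"
      from this(2,1) show "gen_sum X j living \<omega> = 0" by (induction rule: dec_induct) (use elim in auto)
    qed
  qed
qed

text \<open>The generating function p_00 + (p0 + p1) s + p10 s^2 of the number of living daughters,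
  with p_00 eliminated by total mass 1.\<close>

definition offspring_pgf :: "real \<Rightarrow> real" where
  "offspring_pgf s = 1 + (s\<^sup>2 - 1) * p10 + (s - 1) * (p0 + p1)"

text \<open>The power of s with exponent \<open>living x\<close>, written affinely since the
  exponent is 0 or 1. The kernel mean of the product of this weight over both daughters is the same
  weight with \<open>offspring_pgf s\<close>.\<close>

definition pgf_weight :: "real \<Rightarrow> 'a option \<Rightarrow> real" where
  "pgf_weight s x = 1 + (s - 1) * living x"

lemma pgf_weight_bdd: "pgf_weight s \<in> bdd_measurable borel"
  unfolding pgf_weight_def[abs_def] by (intro bdd_intros living_bdd)

lemma prod_pgf_weight: "(\<Prod>i\<in>generation k. pgf_weight s (X i \<omega>)) = s ^ card (alive X (generation k) \<omega>)"
proof -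
  have "(\<Prod>i\<in>generation k. pgf_weight s (X i \<omega>)) = (\<Prod>i\<in>generation k. s ^ (if X i \<omega> = None then 0 else 1))"
    by (intro prod.cong) (auto simp: pgf_weight_def living_def)
  also have "\<dots> = s ^ (\<Sum>i\<in>generation k. if X i \<omega> = None then 0 else 1)" by (simp add: power_sum)
  also have "(\<Sum>i\<in>generation k. if X i \<omega> = None then 0 else 1 :: nat) = (\<Sum>i\<in>alive X (generation k) \<omega>. 1)"
    by (rule alive_sum[symmetric]) simp
  finally show ?thesis by simp
qed

text \<open>Integrating out the last generation changes s into its image under
  \<open>offspring_pgf\<close>; the induction is therefore over all s and starts from a root that is
  almost surely alive.\<close>

lemma generation_pgf:
  "(\<integral>\<omega>. s ^ card (alive X (generation k) \<omega>) \<partial>M) = (offspring_pgf ^^ k) s"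
proof (induction k arbitrary: s)
  case 0
  have "(\<integral>\<omega>. s ^ card (alive X (generation 0) \<omega>) \<partial>M) = (\<integral>\<omega>. s \<partial>M)"
  proof (rule integral_cong_AE)
    show "AE \<omega> in M. s ^ card (alive X (generation 0) \<omega>) = s"
      using root_alive
      by eventually_elim (subst prod_pgf_weight[symmetric], auto simp: generation_0 pgf_weight_def)
  qed (auto simp: prod_pgf_weight[symmetric] intro!: borel_measurable_prod measurable_compose[OF X_measurable bdd_measurable_measurable[OF pgf_weight_bdd]])
  then show ?case by (simp add: prob_space)
next
  case (Suc k)
  let ?g = "\<lambda>(x, y, z). pgf_weight s y * pgf_weight s z"
  have g: "?g \<in> bdd_measurable triple_borel"
  proof -
    have "(\<lambda>t. pgf_weight s (fst (snd t)) * pgf_weight s (snd (snd t))) \<in>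
        bdd_measurable (triple_borel :: ('a option \<times> _) measure)"
      by (intro bdd_measurable_mult bdd_measurable_comp[OF pgf_weight_bdd]) auto
    then show ?thesis by (simp add: case_prod_unfold)
  qed
  have Pg: "kernel_op P ?g x = pgf_weight (offspring_pgf s) x" for x
  proof (cases x)
    case None
    then show ?thesis using kernel_op_dead[OF bdd_measurable_measurable[OF g]] by (simp add: pgf_weight_def)
  next
    case (Some y)
    have "kernel_op P ?g (Some y) = (s\<^sup>2 - 1) * p10 + (s - 1) * p0 + (s - 1) * p1 + 1"
      by (rule kernel_op_offspring)
        (auto simp: pgf_weight_def living_def indicator_def range_Some_eq power2_eq_square)
    then show ?thesis using Some by (simp add: pgf_weight_def offspring_pgf_def algebra_simps)
  qed
  have "(\<integral>\<omega>. s ^ card (alive X (generation (Suc k)) \<omega>) \<partial>M) =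
      (\<integral>\<omega>. 1 * (\<Prod>i\<in>generation k. ?g (Delta X i \<omega>)) \<partial>M)"
    by (simp add: prod_pgf_weight[symmetric] prod_generation_Suc Delta_def)
  also have "\<dots> = (\<integral>\<omega>. 1 * (\<Prod>i\<in>generation k. kernel_op P ?g (X i \<omega>)) \<partial>M)"
    using g by (intro expectation_prod) auto
  also have "\<dots> = (offspring_pgf ^^ k) (offspring_pgf s)" by (simp add: Pg prod_pgf_weight Suc.IH)
  finally show ?case by (simp add: funpow_swap1)
qed

lemma limit_size_nonneg_AE: "AE \<omega> in M. 0 \<le> limit_size \<omega>"
  using AE_scaled_size_tendsto
  by eventually_elim (rule LIMSEQ_le_const, assumption, auto simp: scaled_size_nonneg)

lemma offspring_pgf_continuous: "(\<lambda>n. a n) \<longlonglongrightarrow> b \<Longrightarrow> (\<lambda>n. offspring_pgf (a n)) \<longlonglongrightarrow> offspring_pgf b"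
  unfolding offspring_pgf_def by (intro tendsto_intros)

text \<open>
  The Laplace transform \<open>\<Psi>\<close> of \<open>W\<close> satisfies \<open>\<Psi> (m \<lambda>) = \<phi> (\<Psi> \<lambda>)\<close> for the offspring generating
  function \<open>\<phi>\<close>, so its limit at infinity is a fixed point of \<open>\<phi>\<close>.
\<close>

lemma prob_limit_size_0_fixpoint:
  "offspring_pgf (prob {\<omega>\<in>space M. limit_size \<omega> = 0}) = prob {\<omega>\<in>space M. limit_size \<omega> = 0}"
proof -
  let ?\<Psi> = "\<lambda>l. \<integral>\<omega>. exp (- l * limit_size \<omega>) \<partial>M"
  let ?u = "prob {\<omega>\<in>space M. limit_size \<omega> = 0}"
  \<comment> \<open>The transform of W_k is the k-fold iterate at exp(- l / m^k). Passing to m l and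
    k + 1 keeps the inner argument and adds one outer application, which is the functional equation
    in the limit.\<close>
  have \<Psi>n: "(\<integral>\<omega>. exp (- l * scaled_size k \<omega>) \<partial>M) = (offspring_pgf ^^ k) (exp (- l / m ^ k))" for l k
    unfolding generation_pgf[symmetric]
    by (simp add: scaled_size_def gen_sum_living exp_of_nat_mult[symmetric] mult.commute)
  have conv: "(\<lambda>k. \<integral>\<omega>. exp (- l * scaled_size k \<omega>) \<partial>M) \<longlonglongrightarrow> ?\<Psi> l" if "l \<ge> 0" for l
  proof (rule integral_tendsto_bounded[where C=1])
    show "AE \<omega> in M. (\<lambda>k. exp (- l * scaled_size k \<omega>)) \<longlonglongrightarrow> exp (- l * limit_size \<omega>)"
      using AE_scaled_size_tendsto by eventually_elim (intro tendsto_intros)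
    show "norm (exp (- l * scaled_size k \<omega>)) \<le> 1" for k \<omega>
      using that scaled_size_nonneg[of k \<omega>] by simp
  qed auto
  have func: "?\<Psi> (m * l) = offspring_pgf (?\<Psi> l)" if "l \<ge> 0" for l
  proof (rule LIMSEQ_unique)
    show "(\<lambda>k. \<integral>\<omega>. exp (- (m * l) * scaled_size (Suc k) \<omega>) \<partial>M) \<longlonglongrightarrow> ?\<Psi> (m * l)"
      using that by (intro LIMSEQ_Suc conv) simp
    have "(\<integral>\<omega>. exp (- (m * l) * scaled_size (Suc k) \<omega>) \<partial>M) = offspring_pgf (\<integral>\<omega>. exp (- l * scaled_size k \<omega>) \<partial>M)" for k
      unfolding \<Psi>n by simp
    then show "(\<lambda>k. \<integral>\<omega>. exp (- (m * l) * scaled_size (Suc k) \<omega>) \<partial>M) \<longlonglongrightarrow> offspring_pgf (?\<Psi> l)"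
      using offspring_pgf_continuous[OF conv[OF that]] by simp
  qed
  have lim: "(\<lambda>j. ?\<Psi> (m ^ j)) \<longlonglongrightarrow> ?u"
  proof -
    \<comment> \<open>W is nonnegative only almost surely; the minimum with 1 provides the
      everywhere valid bound for dominated convergence without changing the integral.\<close>
    have "(\<lambda>j. \<integral>\<omega>. min 1 (exp (- (m ^ j) * limit_size \<omega>)) \<partial>M) \<longlonglongrightarrow> (\<integral>\<omega>. indicator {\<omega>\<in>space M. limit_size \<omega> = 0} \<omega> \<partial>M)"
    proof (rule integral_tendsto_bounded[where C=1])
      show "AE \<omega> in M. (\<lambda>j. min 1 (exp (- (m ^ j) * limit_size \<omega>))) \<longlonglongrightarrow> indicator {\<omega>\<in>space M. limit_size \<omega> = 0} \<omega>"
        using limit_size_nonneg_AE AE_space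
      proof eventually_elim
        case (elim \<omega>)
        show ?case
        proof (cases "limit_size \<omega> = 0")
          case False
          with elim have pos: "limit_size \<omega> > 0" by simp
          have "filterlim (\<lambda>j. m ^ j) at_top sequentially"
            using super_critical
            by (intro filterlim_at_infinity_imp_filterlim_at_top filterlim_realpow_sequentially_gt1) auto
          then have "filterlim (\<lambda>j. m ^ j * limit_size \<omega>) at_top sequentially"
            using pos by (intro filterlim_at_top_mult_tendsto_pos[OF tendsto_const]) (auto simp: mult.commute)
          then have "filterlim (\<lambda>j. - (m ^ j * limit_size \<omega>)) at_bot sequentially"
            by (simp add: filterlim_uminus_at_top)
          then have "(\<lambda>j. exp (- (m ^ j * limit_size \<omega>))) \<longlonglongrightarrow> 0"
            by (rule filterlim_compose[OF exp_at_bot])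
          from tendsto_min[OF tendsto_const[of 1] this] show ?thesis using False by simp
        qed (use elim in simp)
      qed
    qed (auto simp: min_def)
    moreover have "(\<integral>\<omega>. min 1 (exp (- (m ^ j) * limit_size \<omega>)) \<partial>M) = ?\<Psi> (m ^ j)" for j
      using limit_size_nonneg_AE by (intro integral_cong_AE) (auto elim!: eventually_mono)
    ultimately show ?thesis by simp
  qed
  have "(\<lambda>j. ?\<Psi> (m ^ Suc j)) \<longlonglongrightarrow> ?u" by (rule LIMSEQ_Suc[OF lim])
  moreover have "(\<lambda>j. ?\<Psi> (m ^ Suc j)) \<longlonglongrightarrow> offspring_pgf ?u"
  proof -
    have "?\<Psi> (m ^ Suc j) = offspring_pgf (?\<Psi> (m ^ j))" for j using func[of "m ^ j"] by simp
    then show ?thesis using offspring_pgf_continuous[OF lim] by (simp only:)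
  qed
  ultimately show ?thesis by (rule LIMSEQ_unique[symmetric])
qed

text \<open>Positivity of p10: it equals m - (p10 + p0 + p1), which is at least m - 1. Hence the
  generating function is truly quadratic.\<close>

lemma offspring_probs: "0 \<le> p10" "0 \<le> p0" "0 \<le> p1" "p10 + p0 + p1 \<le> 1" "0 < p10"
proof -
  let ?x = "Some undefined :: 'a option"
  interpret Px: prob_space "P ?x" by (rule P_prob_space)
  have mass: "Px.prob (range Some \<times> range Some) = p10" "Px.prob (range Some \<times> {None}) = p0" "Px.prob ({None} \<times> range Some) = p1"
    using homogeneous by (auto simp: spatially_homogeneous_def)
  show nonneg: "0 \<le> p10" "0 \<le> p0" "0 \<le> p1" unfolding mass[symmetric] by simp_all
  have [simp]: "range Some \<times> range Some \<in> sets (P ?x)" "range Some \<times> {None} \<in> sets (P ?x)" "{None} \<times> range Some \<in> sets (P ?x)"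
    by (auto simp: sets_P)
  have "p10 + p0 + p1 = Px.prob (range Some \<times> range Some \<union> range Some \<times> {None} \<union> {None} \<times> range Some)"
    unfolding mass[symmetric] by (subst Px.finite_measure_Union; (subst Px.finite_measure_Union)?; auto)
  then show "p10 + p0 + p1 \<le> 1" by simp
  then show "0 < p10" using super_critical nonneg by (simp add: m)
qed

text \<open>
  As \<open>\<phi>\<close> is quadratic and fixes \<open>1\<close>, it has only one fixed point below \<open>1\<close>; hence the extinction
  probability, which is also a fixed point, coincides with the probability of \<open>W = 0\<close>.
\<close>

lemma offspring_pgf_fixpoint_unique:
  assumes "offspring_pgf s = s" "s < 1" "offspring_pgf t = t" "t < 1"
  shows "s = t"
proof -
  have *: "(s + 1) * p10 + p0 + p1 = 1" if "offspring_pgf s = s" "s < 1" for s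
  proof -
    \<comment> \<open>Dividing out the root 1 leaves a linear equation with leading coefficient
      p10.\<close>
    have "(s - 1) * ((s + 1) * p10 + p0 + p1 - 1) = offspring_pgf s - s"
      by (simp add: offspring_pgf_def power2_eq_square algebra_simps)
    with that show ?thesis by simp
  qed
  have "(s + 1) * p10 = (t + 1) * p10" using *[OF assms(1,2)] *[OF assms(3,4)] by linarith
  then show ?thesis using offspring_probs by simp
qed

text \<open>Extinction is almost surely contained in {W = 0}, so equality of the two probabilities
  makes the difference null. The extinction probability is the limit of the iterates at 0; it is
  below 1 because P(W = 0) is, and thus falls under the uniqueness of the fixed point.\<close>

lemma AE_survival: "AE \<omega> in M. limit_size \<omega> = 0 \<longrightarrow> (\<exists>k. \<forall>j\<ge>k. gen_sum X j living \<omega> = 0)"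
proof -
  let ?E = "\<lambda>k. {\<omega>\<in>space M. gen_sum X k living \<omega> = 0}"
  let ?U = "{\<omega>\<in>space M. limit_size \<omega> = 0}"
  have q: "prob (?E k) = (offspring_pgf ^^ k) 0" for k
  proof -
    \<comment> \<open>The convention 0^0 = 1 makes the generating function at 0 the probability of
      extinction by generation k.\<close>
    have "(0::real) ^ card (alive X (generation k) \<omega>) = indicator (?E k) \<omega>" if "\<omega> \<in> space M" for \<omega>
      using that gen_sum_living[of X k \<omega>] by (auto simp: indicator_def power_0_left)
    then have "(\<integral>\<omega>. 0 ^ card (alive X (generation k) \<omega>) \<partial>M) = (\<integral>\<omega>. indicat_real (?E k) \<omega> \<partial>M)"
      by (intro Bochner_Integration.integral_cong) auto
    then show ?thesis by (simp add: generation_pgf)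
  qed
  have mono: "prob (?E k) \<le> prob (?E (Suc k))" for k
    using AE_extinct_Suc[of k] by (intro finite_measure_mono_AE) auto
  have sub: "AE \<omega> in M. \<omega> \<in> ?E k \<longrightarrow> \<omega> \<in> ?U" for k
    using AE_extinct_stays AE_scaled_size_tendsto
  proof eventually_elim
    case (elim \<omega>)
    show ?case
    proof
      assume "\<omega> \<in> ?E k"
      with elim(1) have "\<forall>j\<ge>k. scaled_size j \<omega> = 0" "\<omega> \<in> space M" by (auto simp: scaled_size_def)
      then have "(\<lambda>j. scaled_size j \<omega>) \<longlonglongrightarrow> 0"
        by (intro tendsto_eventually) (auto simp: eventually_sequentially)
      with elim(2) \<open>\<omega> \<in> space M\<close> show "\<omega> \<in> ?U" using LIMSEQ_unique by auto
    qed
  qed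
  then have le: "prob (?E k) \<le> prob ?U" for k by (intro finite_measure_mono_AE) auto
  have "incseq (\<lambda>k. prob (?E k))" using mono by (rule incseq_SucI)
  then obtain p where p: "(\<lambda>k. prob (?E k)) \<longlonglongrightarrow> p"
    using incseq_convergent[of "\<lambda>k. prob (?E k)" 1] by auto
  have "(\<lambda>k. prob (?E (Suc k))) \<longlonglongrightarrow> offspring_pgf p"
    using offspring_pgf_continuous[OF p] by (simp add: q)
  with LIMSEQ_Suc[OF p] have "offspring_pgf p = p" by (rule LIMSEQ_unique[symmetric])
  moreover have "p < 1" using LIMSEQ_le_const2[OF p, of "prob ?U"] le limit_size_not_AE_0 by force
  ultimately have "p = prob ?U"
    by (rule offspring_pgf_fixpoint_unique[OF _ _ prob_limit_size_0_fixpoint limit_size_not_AE_0])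
  let ?B = "{\<omega>\<in>space M. limit_size \<omega> = 0 \<and> (\<forall>k. gen_sum X k living \<omega> \<noteq> 0)}"
  have "prob ?B \<le> prob ?U - prob (?E k)" for k
  proof -
    have "prob ?B \<le> prob (?U - ?E k)" by (intro finite_measure_mono) auto
    also have "\<dots> = prob ?U - prob (?U \<inter> ?E k)" by (simp add: finite_measure_Diff')
    also have "prob (?U \<inter> ?E k) = prob (?E k)"
      using sub[of k] by (intro finite_measure_eq_AE) auto
    finally show ?thesis .
  qed
  moreover have "(\<lambda>k. prob ?U - prob (?E k)) \<longlonglongrightarrow> prob ?U - p" by (intro tendsto_intros p)
  ultimately have "prob ?B \<le> 0" using \<open>p = prob ?U\<close> by (intro LIMSEQ_le_const[of _ 0]) auto
  then have "prob ?B = 0" by (simp add: antisym)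
  then have "AE \<omega> in M. \<omega> \<notin> ?B" by (subst (asm) prob_eq_0) auto
  then show ?thesis using AE_extinct_stays AE_space
    by eventually_elim blast
qed

end

section \<open>Conditional characteristic functions\<close>

text \<open>The branching property speaks of real factors only. A product of complex factors is a
  sum, over the sets B of individuals that contribute their real part, of powers of \<i> times real
  products.\<close>

lemma prod_complex_expand:
  fixes a b :: "'i \<Rightarrow> real"
  assumes "finite A"
  shows "(\<Prod>i\<in>A. complex_of_real (a i) + \<i> * complex_of_real (b i)) =
    (\<Sum>B\<in>Pow A. \<i> ^ card (A - B) * complex_of_real (\<Prod>i\<in>A. if i \<in> B then a i else b i))"
  unfolding prod_add[OF assms]
proof (rule sum.cong[OF refl])
  fix B assume "B \<in> Pow A"
  then have B: "A \<inter> B = B" "A \<inter> - B = A - B" by auto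
  show "(\<Prod>i\<in>B. complex_of_real (a i)) * (\<Prod>i\<in>A - B. \<i> * complex_of_real (b i)) =
      \<i> ^ card (A - B) * complex_of_real (\<Prod>i\<in>A. if i \<in> B then a i else b i)"
    using assms by (simp add: prod.If_cases B prod.distrib)
qed

lemma exp_minus_linear_bound:
  fixes u :: real
  assumes "u \<ge> 0"
  shows "\<bar>exp (- u) - (1 - u)\<bar> \<le> u\<^sup>2"
proof -
  have "1 - u \<le> exp (- u)" using exp_ge_add_one_self[of "- u"] by simp
  moreover have "exp (- u) \<le> 1 / (1 + u)"
    using exp_ge_add_one_self[of u] assms by (simp add: exp_minus field_simps)
  moreover have "1 / (1 + u) \<le> 1 - u + u\<^sup>2"
  proof -
    have "1 \<le> (1 - u + u\<^sup>2) * (1 + u)" using assms by (simp add: power2_eq_square algebra_simps)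
    then show ?thesis using assms by (simp add: divide_le_eq)
  qed
  ultimately show ?thesis by simp
qed

lemma exp_minus_lipschitz:
  fixes a b :: real
  assumes "a \<ge> 0" "b \<ge> 0"
  shows "\<bar>exp (- a) - exp (- b)\<bar> \<le> \<bar>a - b\<bar>"
proof -
  have le: "\<bar>exp (- a) - exp (- b)\<bar> \<le> b - a" if "0 \<le> a" "a \<le> b" for a b :: real
  proof -
    have "exp (- a) - exp (- b) = exp (- a) * (1 - exp (- (b - a)))"
      by (simp add: algebra_simps exp_add[symmetric])
    also have "\<dots> \<le> 1 * (b - a)"
    proof (rule mult_mono)
      show "1 - exp (- (b - a)) \<le> b - a" using exp_ge_add_one_self[of "- (b - a)"] by linarith
    qed (use that in auto)
    finally show ?thesis using that by simp
  qed
  show ?thesis using le[of a b] le[of b a] assms by (cases "a \<le> b") auto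
qed

lemma norm_integral_le:
  fixes f :: "'b \<Rightarrow> 'c::{banach, second_countable_topology}"
  assumes "integrable N f" "integrable N g" "\<And>x. x \<in> space N \<Longrightarrow> norm (f x) \<le> g x"
  shows "norm (\<integral>x. f x \<partial>N) \<le> (\<integral>x. g x \<partial>N)"
  using assms by (intro order_trans[OF integral_norm_bound] integral_mono integrable_norm)

lemma (in prob_space) abs_expectation_le_sqrt:
  assumes "integrable M g" "integrable M (\<lambda>\<omega>. (g \<omega>)\<^sup>2)"
  shows "(\<integral>\<omega>. \<bar>g \<omega>\<bar> \<partial>M) \<le> sqrt (\<integral>\<omega>. (g \<omega>)\<^sup>2 \<partial>M)"
proof -
  have "0 \<le> variance (\<lambda>\<omega>. \<bar>g \<omega>\<bar>)" by (rule variance_positive)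
  also have "\<dots> = (\<integral>\<omega>. (g \<omega>)\<^sup>2 \<partial>M) - (\<integral>\<omega>. \<bar>g \<omega>\<bar> \<partial>M)\<^sup>2"
    using assms by (subst variance_eq) auto
  finally show ?thesis by (intro real_le_rsqrt) simp
qed

context bifurcating_chain
begin

definition deviation :: "('a option \<times> 'a option \<times> 'a option \<Rightarrow> real) \<Rightarrow> 'a option \<times> 'a option \<times> 'a option \<Rightarrow> real" where
  "deviation g t = g t - kernel_op P g (fst t)"

text \<open>The conditional characteristic function at \<theta> of the centred value given X_i = x,
  split into two real integrals because \<open>kernel_op\<close> acts on real functions.\<close>

definition dev_char :: "('a option \<times> 'a option \<times> 'a option \<Rightarrow> real) \<Rightarrow> real \<Rightarrow> 'a option \<Rightarrow> complex" where
  "dev_char g \<theta> x = complex_of_real (kernel_op P (\<lambda>t. cos (\<theta> * deviation g t)) x) +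
    \<i> * complex_of_real (kernel_op P (\<lambda>t. sin (\<theta> * deviation g t)) x)"

lemma deviation_bdd: "g \<in> bdd_measurable triple_borel \<Longrightarrow> deviation g \<in> bdd_measurable triple_borel"
  unfolding deviation_def[abs_def]
  by (intro bdd_intros bdd_measurable_comp[OF kernel_op_bdd]) auto

lemma cos_deviation_bdd:
  assumes "g \<in> bdd_measurable triple_borel"
  shows "(\<lambda>t. cos (\<theta> * deviation g t)) \<in> bdd_measurable triple_borel"
proof -
  have [measurable]: "deviation g \<in> borel_measurable triple_borel"
    by (rule bdd_measurable_measurable[OF deviation_bdd[OF assms]])
  show ?thesis by (rule bdd_measurableI[where C=1]) auto
qed

lemma sin_deviation_bdd:
  assumes "g \<in> bdd_measurable triple_borel"
  shows "(\<lambda>t. sin (\<theta> * deviation g t)) \<in> bdd_measurable triple_borel"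
proof -
  have [measurable]: "deviation g \<in> borel_measurable triple_borel"
    by (rule bdd_measurable_measurable[OF deviation_bdd[OF assms]])
  show ?thesis by (rule bdd_measurableI[where C=1]) auto
qed

lemma mg_incr_deviation: "mg_incr g k \<omega> = (\<Sum>i\<in>generation k. deviation g (Delta X i \<omega>))"
  by (simp add: mg_incr_def tri_sum_def gen_sum_def deviation_def Delta_def sum_subtractf)

lemma iexp_mg_incr:
  "iexp (\<theta> * mg_incr g k \<omega>) = (\<Prod>i\<in>generation k. complex_of_real (cos (\<theta> * deviation g (Delta X i \<omega>))) +
      \<i> * complex_of_real (sin (\<theta> * deviation g (Delta X i \<omega>))))"
proof -
  have "iexp (\<theta> * mg_incr g k \<omega>) = (\<Prod>i\<in>generation k. iexp (\<theta> * deviation g (Delta X i \<omega>)))"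
    by (simp add: mg_incr_deviation sum_distrib_left exp_sum)
  also have "\<dots> = (\<Prod>i\<in>generation k. complex_of_real (cos (\<theta> * deviation g (Delta X i \<omega>))) +
      \<i> * complex_of_real (sin (\<theta> * deviation g (Delta X i \<omega>))))"
    unfolding exp_Euler cos_of_real sin_of_real by (rule refl)
  finally show ?thesis .
qed

lemma dev_char_eq:
  assumes g: "g \<in> bdd_measurable triple_borel"
  shows "dev_char g \<theta> x = (\<integral>yz. iexp (\<theta> * deviation g (x, yz)) \<partial>P x)"
proof -
  interpret Px: prob_space "P x" by (rule P_prob_space)
  have [measurable]: "(\<lambda>yz. deviation g (x, yz)) \<in> borel_measurable (P x)"
    by (rule kernel_section_measurable[OF bdd_measurable_measurable[OF deviation_bdd[OF g]]])
  have int: "integrable (P x) (\<lambda>yz. iexp (\<theta> * deviation g (x, yz)))"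
    by (rule Px.integrable_const_bound[where B=1]) auto
  show ?thesis
    unfolding complex_eq_iff using int
    by (simp add: dev_char_def kernel_op_eq Re_exp Im_exp integral_Re[symmetric] integral_Im[symmetric])
qed

lemma norm_dev_char_le: 
  assumes g: "g \<in> bdd_measurable triple_borel"
  shows "cmod (dev_char g \<theta> x) \<le> 1"
proof -
  interpret Px: prob_space "P x" by (rule P_prob_space)
  have "cmod (dev_char g \<theta> x) \<le> (\<integral>yz. cmod (iexp (\<theta> * deviation g (x, yz))) \<partial>P x)"
    unfolding dev_char_eq[OF g] by (rule integral_norm_bound)
  then show ?thesis by (simp add: Px.prob_space)
qed

lemma dev_char_measurable:
  assumes g: "g \<in> bdd_measurable triple_borel"
  shows "(\<lambda>x. dev_char g \<theta> x) \<in> borel_measurable borel"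
proof -
  have [measurable]: "kernel_op P (\<lambda>t. cos (\<theta> * deviation g t)) \<in> borel_measurable borel"
    "kernel_op P (\<lambda>t. sin (\<theta> * deviation g t)) \<in> borel_measurable borel"
    by (intro bdd_measurable_measurable[OF kernel_op_bdd] cos_deviation_bdd sin_deviation_bdd g)+
  show ?thesis unfolding dev_char_def by measurable
qed

lemma kernel_op_deviation:
  assumes g: "g \<in> bdd_measurable triple_borel"
  shows "(\<integral>yz. deviation g (x, yz) \<partial>P x) = 0" "(\<integral>yz. (deviation g (x, yz))\<^sup>2 \<partial>P x) = kernel_var P g x"
proof -
  interpret Px: prob_space "P x" by (rule P_prob_space)
  note i = kernel_section_integrable[OF g, of x] kernel_section_integrable[OF bdd_measurable_power2[OF g], of x]
  show "(\<integral>yz. deviation g (x, yz) \<partial>P x) = 0"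
    using i by (simp add: deviation_def kernel_op_eq Px.prob_space)
  show "(\<integral>yz. (deviation g (x, yz))\<^sup>2 \<partial>P x) = kernel_var P g x"
    unfolding kernel_var_def kernel_op_eq deviation_def
    using Px.variance_eq[OF i] by simp
qed

lemma dev_char_dead:
  assumes g: "g \<in> bdd_measurable triple_borel"
  shows "dev_char g \<theta> None = 1" "kernel_var P g None = 0"
proof -
  have d: "deviation g (None, None, None) = 0"
    using kernel_op_dead[OF bdd_measurable_measurable[OF g]] by (simp add: deviation_def)
  show "dev_char g \<theta> None = 1"
    using kernel_op_dead[OF bdd_measurable_measurable[OF cos_deviation_bdd[OF g]]]
      kernel_op_dead[OF bdd_measurable_measurable[OF sin_deviation_bdd[OF g]]]
    by (simp add: dev_char_def d)
  show "kernel_var P g None = 0"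
    using kernel_op_dead[OF bdd_measurable_measurable[OF g]]
      kernel_op_dead[OF bdd_measurable_measurable[OF bdd_measurable_power2[OF g]]]
    by (simp add: kernel_var_def)
qed

text \<open>Taylor expansion: centring removes the linear term and the quadratic one is the
  conditional variance. The cubic remainder (2 C)^3 / 6 is rounded up to 2 C^3, and the fourth-order
  term comes from replacing 1 - u by exp(- u). Dead individuals make no error at all.\<close>

lemma dev_char_approx:
  assumes g: "g \<in> bdd_measurable triple_borel" and C: "\<And>t. \<bar>g t\<bar> \<le> C"
  shows "cmod (dev_char g \<theta> x - exp (- (\<theta>\<^sup>2 * kernel_var P g x / 2))) \<le> (2 * C ^ 3 * \<bar>\<theta>\<bar> ^ 3 + C ^ 4 * \<theta> ^ 4) * living x"
proof (cases "x = None")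
  case True
  then show ?thesis by (simp add: dev_char_dead[OF g])
next
  case False
  interpret Px: prob_space "P x" by (rule P_prob_space)
  let ?d = "\<lambda>yz. deviation g (x, yz)" and ?v = "kernel_var P g x"
  have C0: "C \<ge> 0" using C[of undefined] by linarith
  have [measurable]: "?d \<in> borel_measurable (P x)"
    by (rule kernel_section_measurable[OF bdd_measurable_measurable[OF deviation_bdd[OF g]]])
  have d: "\<bar>?d yz\<bar> \<le> 2 * C" for yz
    using C[of "(x, yz)"] kernel_op_abs_le[OF g C, of x] by (simp add: deviation_def)
  have intd: "integrable (P x) ?d" "integrable (P x) (\<lambda>yz. (?d yz)\<^sup>2)"
    using kernel_section_integrable[OF deviation_bdd[OF g]]
      kernel_section_integrable[OF bdd_measurable_power2[OF deviation_bdd[OF g]]] by auto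
  have inte: "integrable (P x) (\<lambda>yz. iexp (\<theta> * ?d yz))"
    by (rule Px.integrable_const_bound[where B=1]) auto
  have intc: "integrable (P x) (\<lambda>yz. (complex_of_real (?d yz))\<^sup>2)"
    using integrable_of_real[OF intd(2)] by simp
  have "dev_char g \<theta> x - (1 - \<theta>\<^sup>2 * ?v / 2) =
    (\<integral>yz. iexp (\<theta> * ?d yz) - (1 + \<i> * \<theta> * ?d yz - \<theta>\<^sup>2 * (?d yz)\<^sup>2 / 2) \<partial>P x)"
    unfolding dev_char_eq[OF g] using intd inte kernel_op_deviation[OF g, of x]
    by (simp add: Px.prob_space integral_complex_of_real flip: of_real_power)
  also have "cmod \<dots> \<le> (\<integral>yz. 2 * C ^ 3 * \<bar>\<theta>\<bar> ^ 3 \<partial>P x)"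
  proof (rule norm_integral_le)
    fix yz
    have "(\<Sum>k\<le>2. (\<i> * complex_of_real (\<theta> * ?d yz)) ^ k / fact k) = 1 + \<i> * \<theta> * ?d yz - \<theta>\<^sup>2 * (?d yz)\<^sup>2 / 2"
    proof -
      have "{..2 :: nat} = {0, 1, 2}" by auto
      then show ?thesis by (simp add: power_mult_distrib fact_numeral)
    qed
    then have "cmod (iexp (\<theta> * ?d yz) - (1 + \<i> * \<theta> * ?d yz - \<theta>\<^sup>2 * (?d yz)\<^sup>2 / 2)) \<le> \<bar>\<theta> * ?d yz\<bar> ^ 3 / 6"
      using iexp_approx1[of "\<theta> * ?d yz" 2] by (simp add: fact_numeral numeral_3_eq_3[symmetric])
    also have "\<bar>\<theta> * ?d yz\<bar> ^ 3 \<le> (\<bar>\<theta>\<bar> * (2 * C)) ^ 3"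
      using d[of yz] by (intro power_mono) (auto simp: abs_mult intro: mult_left_mono)
    also have "(\<bar>\<theta>\<bar> * (2 * C)) ^ 3 / 6 \<le> 2 * C ^ 3 * \<bar>\<theta>\<bar> ^ 3"
      using C0 by (simp add: power_mult_distrib mult_left_mono)
    finally show "cmod (iexp (\<theta> * ?d yz) - (1 + \<i> * \<theta> * ?d yz - \<theta>\<^sup>2 * (?d yz)\<^sup>2 / 2)) \<le> 2 * C ^ 3 * \<bar>\<theta>\<bar> ^ 3"
      by (simp add: divide_right_mono)
  qed (use intd inte intc in auto)
  also have "\<dots> = 2 * C ^ 3 * \<bar>\<theta>\<bar> ^ 3" by (simp add: Px.prob_space)
  finally have 1: "cmod (dev_char g \<theta> x - (1 - \<theta>\<^sup>2 * ?v / 2)) \<le> 2 * C ^ 3 * \<bar>\<theta>\<bar> ^ 3" .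
  have v: "0 \<le> ?v" "?v \<le> C\<^sup>2"
    using kernel_var_nonneg[OF g, of x] kernel_var_le[OF g C, of x] False by (auto simp: living_def)
  have "\<bar>exp (- (\<theta>\<^sup>2 * ?v / 2)) - (1 - \<theta>\<^sup>2 * ?v / 2)\<bar> \<le> (\<theta>\<^sup>2 * ?v / 2)\<^sup>2"
    using v by (intro exp_minus_linear_bound) simp
  also have "\<dots> \<le> (\<theta>\<^sup>2 * C\<^sup>2)\<^sup>2"
  proof (rule power_mono)
    have "\<theta>\<^sup>2 * ?v / 2 \<le> \<theta>\<^sup>2 * ?v" using v by simp
    also have "\<dots> \<le> \<theta>\<^sup>2 * C\<^sup>2" using v by (intro mult_left_mono) auto
    finally show "\<theta>\<^sup>2 * ?v / 2 \<le> \<theta>\<^sup>2 * C\<^sup>2" .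
  qed (use v in simp)
  also have "\<dots> = C ^ 4 * \<theta> ^ 4" by (simp add: power_mult_distrib flip: power_mult)
  finally have "cmod (complex_of_real (exp (- (\<theta>\<^sup>2 * ?v / 2)) - (1 - \<theta>\<^sup>2 * ?v / 2))) \<le> C ^ 4 * \<theta> ^ 4"
    by (simp only: norm_of_real)
  with 1 have "cmod (dev_char g \<theta> x - (1 - \<theta>\<^sup>2 * ?v / 2)) + cmod (complex_of_real (exp (- (\<theta>\<^sup>2 * ?v / 2)) - (1 - \<theta>\<^sup>2 * ?v / 2)))
      \<le> 2 * C ^ 3 * \<bar>\<theta>\<bar> ^ 3 + C ^ 4 * \<theta> ^ 4" by (rule add_mono)
  moreover have "dev_char g \<theta> x - exp (- (\<theta>\<^sup>2 * ?v / 2)) =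
      (dev_char g \<theta> x - (1 - \<theta>\<^sup>2 * ?v / 2)) - complex_of_real (exp (- (\<theta>\<^sup>2 * ?v / 2)) - (1 - \<theta>\<^sup>2 * ?v / 2))"
    by simp
  moreover have "living x = 1" using False by (simp add: living_def)
  ultimately show ?thesis
    using norm_triangle_ineq4[of "dev_char g \<theta> x - (1 - \<theta>\<^sup>2 * ?v / 2)"
        "complex_of_real (exp (- (\<theta>\<^sup>2 * ?v / 2)) - (1 - \<theta>\<^sup>2 * ?v / 2))"]
    by (simp only: mult_1_right)
qed

text \<open>Products of numbers of modulus at most 1 differ by at most the sum of the differences of
  their factors. The error is of order \<bar>\<theta>\<bar>^3 Z_k, which is small in mean when
  \<theta> is of order m^(-k/2).\<close>

lemma prod_dev_char_approx:
  assumes g: "g \<in> bdd_measurable triple_borel" and C: "\<And>t. \<bar>g t\<bar> \<le> C"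
  shows "cmod ((\<Prod>i\<in>generation k. dev_char g \<theta> (X i \<omega>)) - exp (- (\<theta>\<^sup>2 * gen_sum X k (kernel_var P g) \<omega> / 2)))
    \<le> (2 * C ^ 3 * \<bar>\<theta>\<bar> ^ 3 + C ^ 4 * \<theta> ^ 4) * gen_sum X k living \<omega>"
proof -
  have "exp (- (\<theta>\<^sup>2 * gen_sum X k (kernel_var P g) \<omega> / 2)) =
      (\<Prod>i\<in>generation k. exp (- (\<theta>\<^sup>2 * kernel_var P g (X i \<omega>) / 2)))"
    by (simp add: gen_sum_def exp_sum[symmetric] sum_distrib_left sum_divide_distrib sum_negf)
  then have "cmod ((\<Prod>i\<in>generation k. dev_char g \<theta> (X i \<omega>)) - exp (- (\<theta>\<^sup>2 * gen_sum X k (kernel_var P g) \<omega> / 2))) =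
      cmod ((\<Prod>i\<in>generation k. dev_char g \<theta> (X i \<omega>)) - (\<Prod>i\<in>generation k. complex_of_real (exp (- (\<theta>\<^sup>2 * kernel_var P g (X i \<omega>) / 2)))))"
    by (simp only: of_real_prod)
  also have "\<dots> \<le> (\<Sum>i\<in>generation k. cmod (dev_char g \<theta> (X i \<omega>) - complex_of_real (exp (- (\<theta>\<^sup>2 * kernel_var P g (X i \<omega>) / 2)))))"
    using norm_dev_char_le[OF g] kernel_var_nonneg[OF g] by (intro norm_prod_diff) auto
  also have "\<dots> \<le> (\<Sum>i\<in>generation k. (2 * C ^ 3 * \<bar>\<theta>\<bar> ^ 3 + C ^ 4 * \<theta> ^ 4) * living (X i \<omega>))"
    by (intro sum_mono dev_char_approx g C)
  finally show ?thesis by (simp add: gen_sum_def sum_distrib_left)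
qed

lemma expectation_iexp_mg_incr_real:
  assumes \<xi>: "\<xi> \<in> bdd_measurable (F k)" and g: "g \<in> bdd_measurable triple_borel"
  shows "(\<integral>\<omega>. complex_of_real (\<xi> \<omega>) * iexp (\<theta> * mg_incr g k \<omega>) \<partial>M) =
    (\<integral>\<omega>. complex_of_real (\<xi> \<omega>) * (\<Prod>i\<in>generation k. dev_char g \<theta> (X i \<omega>)) \<partial>M)"
proof -
  let ?G = "generation k"
  \<comment> \<open>B is the set of individuals taking the cosine; the others take the sine.\<close>
  define u where "u B i = (if i \<in> B then (\<lambda>t. cos (\<theta> * deviation g t)) else (\<lambda>t. sin (\<theta> * deviation g t)))"
    for B :: "bool list set" and i
  have u: "u B i \<in> bdd_measurable triple_borel" for B i
    using cos_deviation_bdd[OF g] sin_deviation_bdd[OF g] by (simp add: u_def)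
  have bdd: "(\<lambda>\<omega>. \<xi> \<omega> * (\<Prod>i\<in>?G. u B i (Delta X i \<omega>))) \<in> bdd_measurable M"
    "(\<lambda>\<omega>. \<xi> \<omega> * (\<Prod>i\<in>?G. kernel_op P (u B i) (X i \<omega>))) \<in> bdd_measurable M" for B
    by (intro bdd_measurable_mult bdd_F_imp_bdd[OF \<xi>] bdd_measurable_prod bdd_measurable_comp[OF u]
        bdd_measurable_comp[OF kernel_op_bdd[OF u]]; simp)+
  have expand1: "complex_of_real (\<xi> \<omega>) * iexp (\<theta> * mg_incr g k \<omega>) =
    (\<Sum>B\<in>Pow ?G. \<i> ^ card (?G - B) * complex_of_real (\<xi> \<omega> * (\<Prod>i\<in>?G. u B i (Delta X i \<omega>))))" for \<omega>
    unfolding iexp_mg_incr prod_complex_expand[OF finite_generation] sum_distrib_left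
    by (intro sum.cong refl) (auto simp: u_def intro!: prod.cong)
  have expand2: "complex_of_real (\<xi> \<omega>) * (\<Prod>i\<in>?G. dev_char g \<theta> (X i \<omega>)) =
    (\<Sum>B\<in>Pow ?G. \<i> ^ card (?G - B) * complex_of_real (\<xi> \<omega> * (\<Prod>i\<in>?G. kernel_op P (u B i) (X i \<omega>))))" for \<omega>
    unfolding dev_char_def prod_complex_expand[OF finite_generation] sum_distrib_left
    by (intro sum.cong refl) (auto simp: u_def intro!: prod.cong)
  have "(\<integral>\<omega>. complex_of_real (\<xi> \<omega>) * iexp (\<theta> * mg_incr g k \<omega>) \<partial>M) =
    (\<Sum>B\<in>Pow ?G. \<i> ^ card (?G - B) * complex_of_real (\<integral>\<omega>. \<xi> \<omega> * (\<Prod>i\<in>?G. u B i (Delta X i \<omega>)) \<partial>M))"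
    unfolding expand1 using bdd_imp_integrable[OF bdd(1)]
    by (subst Bochner_Integration.integral_sum) (auto simp del: of_real_mult simp: integral_complex_of_real)
  also have "\<dots> = (\<Sum>B\<in>Pow ?G. \<i> ^ card (?G - B) * complex_of_real (\<integral>\<omega>. \<xi> \<omega> * (\<Prod>i\<in>?G. kernel_op P (u B i) (X i \<omega>)) \<partial>M))"
    by (simp add: expectation_prod[OF \<xi> u])
  also have "\<dots> = (\<integral>\<omega>. complex_of_real (\<xi> \<omega>) * (\<Prod>i\<in>?G. dev_char g \<theta> (X i \<omega>)) \<partial>M)"
    unfolding expand2 using bdd_imp_integrable[OF bdd(2)]
    by (subst Bochner_Integration.integral_sum) (auto simp del: of_real_mult simp: integral_complex_of_real)
  finally show ?thesis .
qed

lemma iexp_mg_incr_measurable: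
  assumes "g \<in> bdd_measurable triple_borel"
  shows "(\<lambda>\<omega>. iexp (\<theta> * mg_incr g k \<omega>)) \<in> borel_measurable M"
proof -
  have [measurable]: "mg_incr g k \<in> borel_measurable M"
    by (rule bdd_measurable_measurable[OF mg_incr_bdd[OF assms]])
  show ?thesis by measurable
qed

lemma prod_dev_char_measurable:
  assumes "g \<in> bdd_measurable triple_borel"
  shows "(\<lambda>\<omega>. \<Prod>i\<in>generation k. dev_char g \<theta> (X i \<omega>)) \<in> borel_measurable M"
  by (intro borel_measurable_prod measurable_compose[OF X_measurable dev_char_measurable[OF assms]])

lemma norm_prod_dev_char_le:
  assumes "g \<in> bdd_measurable triple_borel"
  shows "cmod (\<Prod>i\<in>generation k. dev_char g \<theta> (X i \<omega>)) \<le> 1"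
  unfolding prod_norm[symmetric] using norm_dev_char_le[OF assms] by (intro prod_le_1) auto

text \<open>The weight is complex because it will contain the exponentials of earlier increments;
  its real and imaginary parts are treated separately.\<close>

lemma expectation_iexp_mg_incr:
  assumes \<zeta>: "\<zeta> \<in> borel_measurable (F k)" "\<And>\<omega>. cmod (\<zeta> \<omega>) \<le> 1"
    and g: "g \<in> bdd_measurable triple_borel"
  shows "(\<integral>\<omega>. \<zeta> \<omega> * iexp (\<theta> * mg_incr g k \<omega>) \<partial>M) =
    (\<integral>\<omega>. \<zeta> \<omega> * (\<Prod>i\<in>generation k. dev_char g \<theta> (X i \<omega>)) \<partial>M)"
proof -
  note [measurable] = \<zeta>(1)
  have re: "(\<lambda>\<omega>. Re (\<zeta> \<omega>)) \<in> bdd_measurable (F k)" and im: "(\<lambda>\<omega>. Im (\<zeta> \<omega>)) \<in> bdd_measurable (F k)"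
    using abs_Re_le_cmod abs_Im_le_cmod \<zeta>(2)
    by (intro bdd_measurableI[where C=1]; auto intro: order_trans)+
  have split: "(\<integral>\<omega>. \<zeta> \<omega> * E \<omega> \<partial>M) = (\<integral>\<omega>. complex_of_real (Re (\<zeta> \<omega>)) * E \<omega> \<partial>M) + \<i> * (\<integral>\<omega>. complex_of_real (Im (\<zeta> \<omega>)) * E \<omega> \<partial>M)"
    if [measurable]: "E \<in> borel_measurable M" and E: "\<And>\<omega>. cmod (E \<omega>) \<le> 1" for E
  proof -
    have int: "integrable M (\<lambda>\<omega>. complex_of_real (\<xi> \<omega>) * E \<omega>)" if \<xi>: "\<xi> \<in> bdd_measurable (F k)" for \<xi>
    proof -
      obtain C where C: "\<And>x. \<bar>\<xi> x\<bar> \<le> C" using bdd_measurable_ex[OF \<xi>] by blast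
      have [measurable]: "\<xi> \<in> borel_measurable M" by (rule bdd_measurable_measurable[OF bdd_F_imp_bdd[OF \<xi>]])
      have "\<bar>\<xi> \<omega>\<bar> * cmod (E \<omega>) \<le> C * 1" for \<omega>
        using C[of \<omega>] E[of \<omega>] by (intro mult_mono) auto
      then show ?thesis by (intro bounded_integrable[where C=C]) (auto simp: norm_mult)
    qed
    have "(\<integral>\<omega>. \<zeta> \<omega> * E \<omega> \<partial>M) =
        (\<integral>\<omega>. complex_of_real (Re (\<zeta> \<omega>)) * E \<omega> + \<i> * (complex_of_real (Im (\<zeta> \<omega>)) * E \<omega>) \<partial>M)"
      by (intro Bochner_Integration.integral_cong refl) (subst complex_eq, simp add: algebra_simps)
    then show ?thesis using int[OF re] int[OF im] by simp
  qed
  have "(\<integral>\<omega>. \<zeta> \<omega> * iexp (\<theta> * mg_incr g k \<omega>) \<partial>M) =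
      (\<integral>\<omega>. complex_of_real (Re (\<zeta> \<omega>)) * iexp (\<theta> * mg_incr g k \<omega>) \<partial>M) +
      \<i> * (\<integral>\<omega>. complex_of_real (Im (\<zeta> \<omega>)) * iexp (\<theta> * mg_incr g k \<omega>) \<partial>M)"
    by (rule split[OF iexp_mg_incr_measurable[OF g]]) simp
  then show ?thesis
    unfolding expectation_iexp_mg_incr_real[OF re g] expectation_iexp_mg_incr_real[OF im g]
      split[OF prod_dev_char_measurable[OF g] norm_prod_dev_char_le[OF g]] .
qed

lemma finite_range_decomp:
  fixes \<Psi> :: "real \<Rightarrow> 'w \<Rightarrow> complex"
  assumes "finite (range \<theta>)"
  shows "\<Psi> (\<theta> \<omega>) \<omega> = (\<Sum>z\<in>range \<theta>. (if \<theta> \<omega> = z then 1 else 0) * \<Psi> z \<omega>)"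
proof -
  have "(\<Sum>z\<in>range \<theta>. (if \<theta> \<omega> = z then 1 else 0) * \<Psi> z \<omega>) = (\<Sum>z\<in>range \<theta>. if \<theta> \<omega> = z then \<Psi> z \<omega> else 0)"
    by (intro sum.cong) auto
  then show ?thesis using assms by simp
qed

lemma finite_range_measurable:
  fixes \<Psi> :: "real \<Rightarrow> 'w \<Rightarrow> complex"
  assumes "finite (range \<theta>)" and [measurable]: "\<theta> \<in> borel_measurable M" "\<And>z. \<Psi> z \<in> borel_measurable M"
  shows "(\<lambda>\<omega>. \<Psi> (\<theta> \<omega>) \<omega>) \<in> borel_measurable M"
  unfolding finite_range_decomp[OF assms(1), of \<Psi>] by measurable

text \<open>The conditional characteristic function may be evaluated at a random argument that is known
  at generation \<open>k\<close>; taking finitely many values suffices here.\<close>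

lemma expectation_iexp_mg_incr_random:
  assumes \<zeta>: "\<zeta> \<in> borel_measurable (F k)" "\<And>\<omega>. cmod (\<zeta> \<omega>) \<le> 1"
    and \<theta>: "\<theta> \<in> borel_measurable (F k)" "finite (range \<theta>)"
    and g: "g \<in> bdd_measurable triple_borel"
  shows "(\<integral>\<omega>. \<zeta> \<omega> * iexp (\<theta> \<omega> * mg_incr g k \<omega>) \<partial>M) =
    (\<integral>\<omega>. \<zeta> \<omega> * (\<Prod>i\<in>generation k. dev_char g (\<theta> \<omega>) (X i \<omega>)) \<partial>M)"
proof -
  note [measurable] = \<zeta>(1) \<theta>(1)
  define \<zeta>' where "\<zeta>' z \<omega> = \<zeta> \<omega> * (if \<theta> \<omega> = z then 1 else 0)" for z \<omega>
  have z: "\<zeta>' z \<in> borel_measurable (F k)" "\<And>\<omega>. cmod (\<zeta>' z \<omega>) \<le> 1" for z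
    unfolding \<zeta>'_def[abs_def] using \<zeta>(2) by auto
  have zM: "\<zeta>' z \<in> borel_measurable M" for z by (rule measurable_from_subalg[OF subalgebra_F z(1)])
  have eq: "(\<integral>\<omega>. \<zeta> \<omega> * \<Psi> (\<theta> \<omega>) \<omega> \<partial>M) = (\<Sum>z\<in>range \<theta>. \<integral>\<omega>. \<zeta>' z \<omega> * \<Psi> z \<omega> \<partial>M)"
    if m: "\<And>z. \<Psi> z \<in> borel_measurable M" and b: "\<And>z \<omega>. cmod (\<Psi> z \<omega>) \<le> 1" for \<Psi>
  proof -
    have "integrable M (\<lambda>\<omega>. \<zeta>' z \<omega> * \<Psi> z \<omega>)" for z
    proof (rule bounded_integrable[where C=1])
      have "cmod (\<zeta>' z \<omega>) * cmod (\<Psi> z \<omega>) \<le> 1 * 1" for \<omega> using z(2) b by (intro mult_mono) auto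
      then show "norm (\<zeta>' z \<omega> * \<Psi> z \<omega>) \<le> 1" for \<omega> by (simp add: norm_mult)
    qed (use m zM in auto)
    moreover have "\<zeta> \<omega> * \<Psi> (\<theta> \<omega>) \<omega> = (\<Sum>z\<in>range \<theta>. \<zeta>' z \<omega> * \<Psi> z \<omega>)" for \<omega>
      by (subst finite_range_decomp[OF \<theta>(2), of \<Psi>]) (simp add: sum_distrib_left \<zeta>'_def mult.assoc)
    ultimately show ?thesis by simp
  qed
  have "(\<integral>\<omega>. \<zeta> \<omega> * iexp (\<theta> \<omega> * mg_incr g k \<omega>) \<partial>M) =
      (\<Sum>z\<in>range \<theta>. \<integral>\<omega>. \<zeta>' z \<omega> * iexp (z * mg_incr g k \<omega>) \<partial>M)"
    by (rule eq[OF iexp_mg_incr_measurable[OF g]]) simp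
  also have "\<dots> = (\<Sum>z\<in>range \<theta>. \<integral>\<omega>. \<zeta>' z \<omega> * (\<Prod>i\<in>generation k. dev_char g z (X i \<omega>)) \<partial>M)"
    by (intro sum.cong refl expectation_iexp_mg_incr[OF z g])
  also have "\<dots> = (\<integral>\<omega>. \<zeta> \<omega> * (\<Prod>i\<in>generation k. dev_char g (\<theta> \<omega>) (X i \<omega>)) \<partial>M)"
    by (rule eq[OF prod_dev_char_measurable[OF g] norm_prod_dev_char_le[OF g], symmetric])
  finally show ?thesis .
qed

end

section \<open>Gaussian approximation of the last generations\<close>

context supercritical_chain
begin

definition rate :: real where "rate = sqrt (1 / m)"

lemma rate: "0 < rate" "rate < 1" "rate\<^sup>2 = 1 / m" "0 \<le> rate"
  using super_critical by (auto simp: rate_def)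

lemma rate_power: "rate ^ n * rate ^ n * m ^ n = 1"
proof -
  have "rate ^ n * rate ^ n * m ^ n = (rate\<^sup>2 * m) ^ n" by (simp add: power_mult_distrib power2_eq_square)
  then show ?thesis by (simp add: rate)
qed

lemma rate_tendsto: "(\<lambda>n. rate ^ n) \<longlonglongrightarrow> 0"
  using rate by (intro LIMSEQ_power_zero) simp

text \<open>Z_n is an integer between 0 and 2^n, so functions of W_n are admissible random arguments
  in \<open>expectation_iexp_mg_incr_random\<close>.\<close>

lemma finite_range_scaled_size: "finite (range (scaled_size n))"
proof (rule finite_subset)
  show "range (scaled_size n) \<subseteq> (\<lambda>z. real z / m ^ n) ` {..2 ^ n}"
  proof
    fix y assume "y \<in> range (scaled_size n)"
    then obtain \<omega> where \<omega>: "y = real (card (alive X (generation n) \<omega>)) / m ^ n"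
      by (auto simp: scaled_size_def gen_sum_living)
    have "real (card (alive X (generation n) \<omega>)) \<le> 2 ^ n"
      using gen_sum_living_le[of n \<omega>] by (simp add: gen_sum_living)
    then have "card (alive X (generation n) \<omega>) \<le> 2 ^ n" by (metis of_nat_le_iff of_nat_numeral of_nat_power)
    then show "y \<in> (\<lambda>z. real z / m ^ n) ` {..2 ^ n}" using \<omega> by blast
  qed
qed simp

lemma scaled_size_measurable_F: "n \<le> k \<Longrightarrow> scaled_size n \<in> borel_measurable (F k)"
  unfolding scaled_size_def[abs_def]
  by (intro borel_measurable_divide gen_sum_measurable_F) auto

end

text \<open>Here s stands for \<sigma>^2. Ergodicity enters the fluctuations only through
  \<open>lln\<close>, the law of large numbers for the conditional variances.\<close>

locale clt_setup = supercritical_chain M \<nu> P X p10 p0 p1 m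
  for M :: "'w measure" and \<nu> :: "'a::topological_space option measure" and P X p10 p0 p1 m +
  fixes g :: "'a option \<times> 'a option \<times> 'a option \<Rightarrow> real" and C s :: real
  assumes g: "g \<in> bdd_measurable triple_borel" and C: "\<And>t. \<bar>g t\<bar> \<le> C" and s: "0 \<le> s"
    and lln: "(\<lambda>k. \<integral>\<omega>. (gen_sum X k (kernel_var P g) \<omega> / m ^ k - s * scaled_size k \<omega>)\<^sup>2 \<partial>M) \<longlonglongrightarrow> 0"
begin

lemma C_nonneg: "0 \<le> C"
  using C[of undefined] by linarith

text \<open>The variance carried by generation n + l is forecast from W_n alone. The error is that
  of the law of large numbers at n + l plus the L2 distance of W_(n+l) from W_n.\<close>

lemma expectation_var_deviation:
  "(\<lambda>n. \<integral>\<omega>. \<bar>gen_sum X (n + l) (kernel_var P g) \<omega> / m ^ (n + l) - s * scaled_size n \<omega>\<bar> \<partial>M) \<longlonglongrightarrow> 0"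
proof (rule tendsto_sandwich[OF _ _ tendsto_const])
  define e where "e k = (\<integral>\<omega>. (gen_sum X k (kernel_var P g) \<omega> / m ^ k - s * scaled_size k \<omega>)\<^sup>2 \<partial>M)" for k
  define K where "K = 4 * m / (m - 1)"
  let ?A = "\<lambda>k \<omega>. gen_sum X k (kernel_var P g) \<omega> / m ^ k - s * scaled_size k \<omega>"
  have A: "?A k \<in> bdd_measurable M" for k
    unfolding divide_inverse by (intro bdd_intros gen_sum_bdd kernel_var_bdd g scaled_size_bdd)
  have D: "(\<lambda>\<omega>. scaled_size (n + l) \<omega> - scaled_size n \<omega>) \<in> bdd_measurable M" for n
    by (intro bdd_intros scaled_size_bdd)
  show "\<forall>\<^sub>F n in sequentially. (\<integral>\<omega>. \<bar>gen_sum X (n + l) (kernel_var P g) \<omega> / m ^ (n + l) - s * scaled_size n \<omega>\<bar> \<partial>M)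
      \<le> sqrt (e (n + l)) + s * sqrt (K * (1 / m) ^ n)"
  proof (rule always_eventually, rule allI)
    fix n
    have "(\<integral>\<omega>. \<bar>gen_sum X (n + l) (kernel_var P g) \<omega> / m ^ (n + l) - s * scaled_size n \<omega>\<bar> \<partial>M) \<le>
      (\<integral>\<omega>. \<bar>?A (n + l) \<omega>\<bar> + s * \<bar>scaled_size (n + l) \<omega> - scaled_size n \<omega>\<bar> \<partial>M)"
    proof (rule integral_mono)
      show "integrable M (\<lambda>\<omega>. \<bar>gen_sum X (n + l) (kernel_var P g) \<omega> / m ^ (n + l) - s * scaled_size n \<omega>\<bar>)"
        unfolding divide_inverse
        by (intro integrable_abs bdd_imp_integrable bdd_intros gen_sum_bdd kernel_var_bdd g scaled_size_bdd)
      show "integrable M (\<lambda>\<omega>. \<bar>?A (n + l) \<omega>\<bar> + s * \<bar>scaled_size (n + l) \<omega> - scaled_size n \<omega>\<bar>)"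
        using bdd_imp_integrable[OF A] bdd_imp_integrable[OF D] by auto
      fix \<omega>
      have "gen_sum X (n + l) (kernel_var P g) \<omega> / m ^ (n + l) - s * scaled_size n \<omega> =
          ?A (n + l) \<omega> + s * (scaled_size (n + l) \<omega> - scaled_size n \<omega>)" by (simp add: algebra_simps)
      also have "\<bar>\<dots>\<bar> \<le> \<bar>?A (n + l) \<omega>\<bar> + \<bar>s * (scaled_size (n + l) \<omega> - scaled_size n \<omega>)\<bar>" by (rule abs_triangle_ineq)
      finally show "\<bar>gen_sum X (n + l) (kernel_var P g) \<omega> / m ^ (n + l) - s * scaled_size n \<omega>\<bar> \<le>
          \<bar>?A (n + l) \<omega>\<bar> + s * \<bar>scaled_size (n + l) \<omega> - scaled_size n \<omega>\<bar>" using s by (simp add: abs_mult)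
    qed
    also have "\<dots> = (\<integral>\<omega>. \<bar>?A (n + l) \<omega>\<bar> \<partial>M) + s * (\<integral>\<omega>. \<bar>scaled_size (n + l) \<omega> - scaled_size n \<omega>\<bar> \<partial>M)"
      using bdd_imp_integrable[OF A, of "n + l"] bdd_imp_integrable[OF D, of n] by simp
    also have "\<dots> \<le> sqrt (e (n + l)) + s * sqrt (K * (1 / m) ^ n)"
    proof (intro add_mono mult_left_mono s)
      show "(\<integral>\<omega>. \<bar>?A (n + l) \<omega>\<bar> \<partial>M) \<le> sqrt (e (n + l))"
        unfolding e_def by (intro abs_expectation_le_sqrt bdd_imp_integrable bdd_measurable_power2 A)
      have "(\<integral>\<omega>. \<bar>scaled_size (n + l) \<omega> - scaled_size n \<omega>\<bar> \<partial>M) \<le> sqrt (\<integral>\<omega>. (scaled_size (n + l) \<omega> - scaled_size n \<omega>)\<^sup>2 \<partial>M)"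
        by (intro abs_expectation_le_sqrt bdd_imp_integrable bdd_measurable_power2 D)
      also have "\<dots> \<le> sqrt (K * (1 / m) ^ n)" unfolding K_def by (intro real_sqrt_le_mono scaled_size_L2)
      finally show "(\<integral>\<omega>. \<bar>scaled_size (n + l) \<omega> - scaled_size n \<omega>\<bar> \<partial>M) \<le> sqrt (K * (1 / m) ^ n)" .
    qed
    finally show "(\<integral>\<omega>. \<bar>gen_sum X (n + l) (kernel_var P g) \<omega> / m ^ (n + l) - s * scaled_size n \<omega>\<bar> \<partial>M)
      \<le> sqrt (e (n + l)) + s * sqrt (K * (1 / m) ^ n)" .
  qed
  have "e \<longlonglongrightarrow> 0" using lln by (simp add: e_def[abs_def])
  then have "(\<lambda>n. e (n + l)) \<longlonglongrightarrow> 0" by (rule LIMSEQ_ignore_initial_segment)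
  moreover have "(\<lambda>n. (1 / m) ^ n) \<longlonglongrightarrow> 0" using super_critical by (intro LIMSEQ_power_zero) simp
  ultimately have "(\<lambda>n. sqrt (e (n + l)) + s * sqrt (K * (1 / m) ^ n)) \<longlonglongrightarrow> sqrt 0 + s * sqrt (K * 0)"
    by (intro tendsto_intros) (use super_critical in auto)
  then show "(\<lambda>n. sqrt (e (n + l)) + s * sqrt (K * (1 / m) ^ n)) \<longlonglongrightarrow> 0" by simp
qed auto

context
  fixes \<beta> :: "real \<Rightarrow> real" and B :: real
  assumes \<beta>_measurable [measurable]: "\<beta> \<in> borel_measurable borel" and \<beta>: "\<And>w. \<bar>\<beta> w\<bar> \<le> B"
begin

definition "arg n \<omega> = \<beta> (scaled_size n \<omega>) * rate ^ n"

lemma arg_le: "\<bar>arg n \<omega>\<bar> \<le> B * rate ^ n"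
  unfolding arg_def using \<beta>[of "scaled_size n \<omega>"] rate by (simp add: abs_mult mult_right_mono)

lemma arg_measurable_F: "n \<le> k \<Longrightarrow> arg n \<in> borel_measurable (F k)"
  unfolding arg_def[abs_def]
  by (intro borel_measurable_times borel_measurable_const measurable_compose[OF scaled_size_measurable_F \<beta>_measurable])

lemma arg_measurable [measurable]: "arg n \<in> borel_measurable M"
  by (rule measurable_from_subalg[OF subalgebra_F arg_measurable_F[OF order_refl]])

lemma finite_range_arg: "finite (range (arg n))"
  using finite_imageI[OF finite_range_scaled_size[of n], of "\<lambda>w. \<beta> w * rate ^ n"]
  by (simp add: arg_def[abs_def] image_image)

text \<open>The Gaussian characteristic function expected from generation n + l, its variance s
  m^(n+l) W_n being a forecast known at generation n.\<close>

definition "gauss n l \<omega> = exp (- ((arg n \<omega>)\<^sup>2 * (s * (m ^ (n + l) * scaled_size n \<omega>)) / 2))"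

lemma gauss_measurable_F: "n \<le> k \<Longrightarrow> gauss n l \<in> borel_measurable (F k)"
proof -
  assume n: "n \<le> k"
  note [measurable] = arg_measurable_F[OF n] scaled_size_measurable_F[OF n]
  show ?thesis unfolding gauss_def[abs_def] by measurable
qed

lemma gauss_measurable [measurable]: "gauss n l \<in> borel_measurable M"
  by (rule measurable_from_subalg[OF subalgebra_F gauss_measurable_F[OF order_refl]])

lemma gauss_bounds: "0 \<le> gauss n l \<omega>" "gauss n l \<omega> \<le> 1"
  using s scaled_size_nonneg[of n \<omega>] by (auto simp: gauss_def)

text \<open>About m^(n+l) living individuals each make a Taylor error of order m^(-3n/2), and l is
  fixed. The forecast of the variance is wrong by o(m^n) in mean, which the squared argument of
  order m^(-n) compensates.\<close>

lemma char_step_error: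
  "(\<lambda>n. \<integral>\<omega>. cmod ((\<Prod>i\<in>generation (n + l). dev_char g (arg n \<omega>) (X i \<omega>)) - gauss n l \<omega>) \<partial>M) \<longlonglongrightarrow> 0"
proof (rule tendsto_sandwich[OF _ _ tendsto_const])
  define a where "a n = (\<integral>\<omega>. \<bar>gen_sum X (n + l) (kernel_var P g) \<omega> / m ^ (n + l) - s * scaled_size n \<omega>\<bar> \<partial>M)" for n
  \<comment> \<open>The first summand is the Taylor error and the second the forecast error, both
    simplified by m^n rate^(2n) = 1.\<close>
  let ?u = "\<lambda>n. m ^ l * (2 * C ^ 3 * B ^ 3 * rate ^ n + C ^ 4 * B ^ 4 * (rate ^ n)\<^sup>2) + B\<^sup>2 * m ^ l * a n"
  let ?A = "\<lambda>n \<omega>. gen_sum X (n + l) (kernel_var P g) \<omega> / m ^ (n + l) - s * scaled_size n \<omega>"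
  have Abdd: "?A n \<in> bdd_measurable M" for n
    unfolding divide_inverse by (intro bdd_intros gen_sum_bdd kernel_var_bdd g scaled_size_bdd)
  have pm: "(\<lambda>\<omega>. \<Prod>i\<in>generation (n + l). dev_char g (arg n \<omega>) (X i \<omega>)) \<in> borel_measurable M" for n
    by (rule finite_range_measurable[OF finite_range_arg arg_measurable prod_dev_char_measurable[OF g]])
  show "\<forall>\<^sub>F n in sequentially. (\<integral>\<omega>. cmod ((\<Prod>i\<in>generation (n + l). dev_char g (arg n \<omega>) (X i \<omega>)) - gauss n l \<omega>) \<partial>M) \<le> ?u n"
  proof (rule always_eventually, rule allI)
    fix n
    let ?r = "rate ^ n"
    let ?c = "2 * C ^ 3 * (B * ?r) ^ 3 + C ^ 4 * (B * ?r) ^ 4"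
    have r: "0 < ?r" "?r * ?r * m ^ n = 1" using rate rate_power by auto
    have pt: "cmod ((\<Prod>i\<in>generation (n + l). dev_char g (arg n \<omega>) (X i \<omega>)) - gauss n l \<omega>) \<le>
        ?c * gen_sum X (n + l) living \<omega> + B\<^sup>2 * m ^ l * \<bar>?A n \<omega>\<bar>" for \<omega>
    proof -
      let ?t = "arg n \<omega>" and ?V = "gen_sum X (n + l) (kernel_var P g) \<omega>"
      have V: "0 \<le> ?V" unfolding gen_sum_def using kernel_var_nonneg[OF g] by (intro sum_nonneg)
      have "cmod ((\<Prod>i\<in>generation (n + l). dev_char g ?t (X i \<omega>)) - exp (- (?t\<^sup>2 * ?V / 2)))
          \<le> (2 * C ^ 3 * \<bar>?t\<bar> ^ 3 + C ^ 4 * ?t ^ 4) * gen_sum X (n + l) living \<omega>"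
        by (rule prod_dev_char_approx[OF g C])
      also have "\<dots> \<le> ?c * gen_sum X (n + l) living \<omega>"
      proof (intro mult_right_mono gen_sum_living_nonneg add_mono mult_left_mono)
        show "\<bar>?t\<bar> ^ 3 \<le> (B * ?r) ^ 3" using arg_le by (intro power_mono) auto
        have "\<bar>?t\<bar> ^ 4 \<le> (B * ?r) ^ 4" using arg_le by (intro power_mono) auto
        then show "?t ^ 4 \<le> (B * ?r) ^ 4" by simp
      qed (use C_nonneg in auto)
      finally have 1: "cmod ((\<Prod>i\<in>generation (n + l). dev_char g ?t (X i \<omega>)) - exp (- (?t\<^sup>2 * ?V / 2))) \<le> ?c * gen_sum X (n + l) living \<omega>" .
      have "\<bar>exp (- (?t\<^sup>2 * ?V / 2)) - gauss n l \<omega>\<bar> \<le> \<bar>?t\<^sup>2 * ?V / 2 - ?t\<^sup>2 * (s * (m ^ (n + l) * scaled_size n \<omega>)) / 2\<bar>"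
        unfolding gauss_def using s V scaled_size_nonneg[of n \<omega>] by (intro exp_minus_lipschitz) auto
      also have "?t\<^sup>2 * ?V / 2 - ?t\<^sup>2 * (s * (m ^ (n + l) * scaled_size n \<omega>)) / 2 = ?t\<^sup>2 * m ^ (n + l) / 2 * ?A n \<omega>"
        by (simp add: right_diff_distrib diff_divide_distrib)
      also have "\<bar>\<dots>\<bar> = ?t\<^sup>2 * m ^ (n + l) / 2 * \<bar>?A n \<omega>\<bar>" by (simp add: abs_mult)
      also have "\<dots> \<le> B\<^sup>2 * m ^ l * \<bar>?A n \<omega>\<bar>"
      proof (rule mult_right_mono)
        have "?t\<^sup>2 \<le> (B * ?r)\<^sup>2" using arg_le[of n \<omega>] by (metis abs_ge_zero power2_abs power_mono)
        then have "?t\<^sup>2 * m ^ (n + l) \<le> (B * ?r)\<^sup>2 * m ^ (n + l)" by (intro mult_right_mono) auto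
        also have "\<dots> = B\<^sup>2 * m ^ l * (?r * ?r * m ^ n)" by (simp add: power2_eq_square power_add)
        also have "\<dots> = B\<^sup>2 * m ^ l" by (simp only: r mult_1_right)
        finally have "?t\<^sup>2 * m ^ (n + l) \<le> B\<^sup>2 * m ^ l" .
        moreover have "0 \<le> ?t\<^sup>2 * m ^ (n + l)" by simp
        ultimately show "?t\<^sup>2 * m ^ (n + l) / 2 \<le> B\<^sup>2 * m ^ l" by linarith
      qed simp
      finally have 2: "cmod (complex_of_real (exp (- (?t\<^sup>2 * ?V / 2)) - gauss n l \<omega>)) \<le> B\<^sup>2 * m ^ l * \<bar>?A n \<omega>\<bar>"
        by (simp only: norm_of_real)
      have "(\<Prod>i\<in>generation (n + l). dev_char g ?t (X i \<omega>)) - gauss n l \<omega> =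
          ((\<Prod>i\<in>generation (n + l). dev_char g ?t (X i \<omega>)) - exp (- (?t\<^sup>2 * ?V / 2))) + complex_of_real (exp (- (?t\<^sup>2 * ?V / 2)) - gauss n l \<omega>)"
        by simp
      then show ?thesis using norm_triangle_le[OF add_mono[OF 1 2]] by simp
    qed
    have "(\<integral>\<omega>. cmod ((\<Prod>i\<in>generation (n + l). dev_char g (arg n \<omega>) (X i \<omega>)) - gauss n l \<omega>) \<partial>M) \<le>
        (\<integral>\<omega>. ?c * gen_sum X (n + l) living \<omega> + B\<^sup>2 * m ^ l * \<bar>?A n \<omega>\<bar> \<partial>M)"
    proof (rule integral_mono)
      show "integrable M (\<lambda>\<omega>. cmod ((\<Prod>i\<in>generation (n + l). dev_char g (arg n \<omega>) (X i \<omega>)) - gauss n l \<omega>))"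
      proof (rule bounded_integrable[where C=2])
        show "norm (cmod ((\<Prod>i\<in>generation (n + l). dev_char g (arg n \<omega>) (X i \<omega>)) - gauss n l \<omega>)) \<le> 2" for \<omega>
          using norm_triangle_ineq4[of "\<Prod>i\<in>generation (n + l). dev_char g (arg n \<omega>) (X i \<omega>)" "complex_of_real (gauss n l \<omega>)"]
            norm_prod_dev_char_le[OF g, of "arg n \<omega>" \<omega> "n + l"] gauss_bounds[of n l \<omega>]
          by simp
      qed (use pm in measurable)
      show "integrable M (\<lambda>\<omega>. ?c * gen_sum X (n + l) living \<omega> + B\<^sup>2 * m ^ l * \<bar>?A n \<omega>\<bar>)"
        using bdd_imp_integrable[OF Abdd, of n] bdd_imp_integrable[OF gen_sum_bdd[OF living_bdd], of "n + l"] by auto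
    qed (rule pt)
    also have "\<dots> = ?c * m ^ (n + l) + B\<^sup>2 * m ^ l * a n"
      using bdd_imp_integrable[OF Abdd, of n] bdd_imp_integrable[OF gen_sum_bdd[OF living_bdd], of "n + l"]
      by (simp add: expectation_gen_sum_living a_def)
    also have "?c * m ^ (n + l) = m ^ l * (?r * ?r * m ^ n) * (2 * C ^ 3 * B ^ 3 * ?r + C ^ 4 * B ^ 4 * ?r\<^sup>2)"
      by (simp add: power_mult_distrib power_add power2_eq_square power3_eq_cube power4_eq_xxxx algebra_simps)
    also have "\<dots> = m ^ l * (2 * C ^ 3 * B ^ 3 * ?r + C ^ 4 * B ^ 4 * ?r\<^sup>2)" by (simp only: r mult_1_right)
    finally show "(\<integral>\<omega>. cmod ((\<Prod>i\<in>generation (n + l). dev_char g (arg n \<omega>) (X i \<omega>)) - gauss n l \<omega>) \<partial>M) \<le> ?u n" .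
  qed
  have "a \<longlonglongrightarrow> 0" using expectation_var_deviation[of l] by (simp add: a_def[abs_def])
  then have "?u \<longlonglongrightarrow> m ^ l * (2 * C ^ 3 * B ^ 3 * 0 + C ^ 4 * B ^ 4 * 0\<^sup>2) + B\<^sup>2 * m ^ l * 0"
    by (intro tendsto_intros rate_tendsto)
  then show "?u \<longlonglongrightarrow> 0" by simp
qed auto

lemma mg_sum_measurable_F:
  "(\<lambda>\<omega>. \<Sum>q\<in>{n..<k}. mg_incr g q \<omega>) \<in> borel_measurable (F k)"
  by (intro borel_measurable_sum bdd_measurable_measurable[OF mg_incr_bdd_F[OF g]]) auto

text \<open>Generations are integrated out one at a time, the last one first.\<close>

lemma char_product_approx:
  assumes "\<And>n k. n \<le> k \<Longrightarrow> \<zeta> n \<in> borel_measurable (F k)" "\<And>n \<omega>. cmod (\<zeta> n \<omega>) \<le> 1"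
  shows "(\<lambda>n. (\<integral>\<omega>. \<zeta> n \<omega> * iexp (arg n \<omega> * (\<Sum>q\<in>{n..<n + l}. mg_incr g q \<omega>)) \<partial>M)
      - (\<integral>\<omega>. \<zeta> n \<omega> * complex_of_real (\<Prod>j<l. gauss n j \<omega>) \<partial>M)) \<longlonglongrightarrow> 0"
  using assms
proof (induction l arbitrary: \<zeta>)
  case 0
  then show ?case by simp
next
  case (Suc l)
  let ?S = "\<lambda>n \<omega>. \<Sum>q\<in>{n..<n + l}. mg_incr g q \<omega>"
  let ?\<Pi> = "\<lambda>n \<omega>. \<Prod>i\<in>generation (n + l). dev_char g (arg n \<omega>) (X i \<omega>)"
  let ?\<eta> = "\<lambda>n \<omega>. \<zeta> n \<omega> * iexp (arg n \<omega> * ?S n \<omega>)"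
  \<comment> \<open>The new Gaussian factor is absorbed into the weight. It is known at generation n
    already, so it stays outside while the earlier generations are integrated; this is why the
    induction allows any such weight.\<close>
  let ?\<zeta> = "\<lambda>n \<omega>. \<zeta> n \<omega> * complex_of_real (gauss n l \<omega>)"
  have pm [measurable]: "?\<Pi> n \<in> borel_measurable M" for n
    by (rule finite_range_measurable[OF finite_range_arg arg_measurable prod_dev_char_measurable[OF g]])
  have \<eta>: "?\<eta> n \<in> borel_measurable (F (n + l))" "\<And>\<omega>. cmod (?\<eta> n \<omega>) \<le> 1" for n
  proof -
    have "(\<lambda>\<omega>. arg n \<omega> * ?S n \<omega>) \<in> borel_measurable (F (n + l))"
      by (intro borel_measurable_times arg_measurable_F mg_sum_measurable_F) simp
    from measurable_compose[OF this, where g="\<lambda>x. iexp x" and L=borel]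
    have "(\<lambda>\<omega>. iexp (arg n \<omega> * ?S n \<omega>)) \<in> borel_measurable (F (n + l))" by simp
    then show "?\<eta> n \<in> borel_measurable (F (n + l))"
      by (intro borel_measurable_times Suc.prems(1)) auto
    show "cmod (?\<eta> n \<omega>) \<le> 1" for \<omega> using Suc.prems(2)[of n \<omega>] by (simp add: norm_mult)
  qed
  have \<eta>M [measurable]: "?\<eta> n \<in> borel_measurable M" for n by (rule measurable_from_subalg[OF subalgebra_F \<eta>(1)])
  have step: "(\<integral>\<omega>. \<zeta> n \<omega> * iexp (arg n \<omega> * (\<Sum>q\<in>{n..<n + Suc l}. mg_incr g q \<omega>)) \<partial>M) = (\<integral>\<omega>. ?\<eta> n \<omega> * ?\<Pi> n \<omega> \<partial>M)" for n
  proof -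
    have "(\<integral>\<omega>. \<zeta> n \<omega> * iexp (arg n \<omega> * (\<Sum>q\<in>{n..<n + Suc l}. mg_incr g q \<omega>)) \<partial>M) =
        (\<integral>\<omega>. ?\<eta> n \<omega> * iexp (arg n \<omega> * mg_incr g (n + l) \<omega>) \<partial>M)"
      by (simp add: distrib_left exp_add mult.assoc)
    also have "\<dots> = (\<integral>\<omega>. ?\<eta> n \<omega> * ?\<Pi> n \<omega> \<partial>M)"
      by (rule expectation_iexp_mg_incr_random[OF \<eta> arg_measurable_F finite_range_arg g]) simp
    finally show ?thesis .
  qed
  have gM: "(\<lambda>\<omega>. complex_of_real (gauss n l \<omega>)) \<in> borel_measurable M" for n by measurable
  have intb: "integrable M (\<lambda>\<omega>. ?\<eta> n \<omega> * ?\<Pi> n \<omega>)" "integrable M (\<lambda>\<omega>. ?\<eta> n \<omega> * complex_of_real (gauss n l \<omega>))"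
    "integrable M (\<lambda>\<omega>. cmod (?\<Pi> n \<omega> - complex_of_real (gauss n l \<omega>)))" for n
  proof -
    have a: "cmod (?\<eta> n \<omega>) * cmod (?\<Pi> n \<omega>) \<le> 1 * 1" "cmod (?\<eta> n \<omega>) * \<bar>gauss n l \<omega>\<bar> \<le> 1 * 1" for \<omega>
      using \<eta>(2)[of n \<omega>] norm_prod_dev_char_le[OF g, of "arg n \<omega>" \<omega> "n + l"] gauss_bounds[of n l \<omega>]
      by (intro mult_mono; simp)+
    show "integrable M (\<lambda>\<omega>. ?\<eta> n \<omega> * ?\<Pi> n \<omega>)"
      using a(1) by (intro bounded_integrable[where C=1]) (auto simp only: norm_mult mult_1_left intro!: borel_measurable_times \<eta>M pm)
    show "integrable M (\<lambda>\<omega>. ?\<eta> n \<omega> * complex_of_real (gauss n l \<omega>))"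
      using a(2) by (intro bounded_integrable[where C=1]) (auto simp only: norm_mult mult_1_left norm_of_real intro!: borel_measurable_times \<eta>M gM)
    show "integrable M (\<lambda>\<omega>. cmod (?\<Pi> n \<omega> - complex_of_real (gauss n l \<omega>)))"
    proof (rule bounded_integrable[where C=2])
      show "norm (cmod (?\<Pi> n \<omega> - complex_of_real (gauss n l \<omega>))) \<le> 2" for \<omega>
        using norm_triangle_ineq4[of "?\<Pi> n \<omega>" "complex_of_real (gauss n l \<omega>)"]
          norm_prod_dev_char_le[OF g, of "arg n \<omega>" \<omega> "n + l"] gauss_bounds[of n l \<omega>]
        by simp
    qed measurable
  qed
  have d1: "(\<lambda>n. (\<integral>\<omega>. ?\<eta> n \<omega> * ?\<Pi> n \<omega> \<partial>M) - (\<integral>\<omega>. ?\<eta> n \<omega> * complex_of_real (gauss n l \<omega>) \<partial>M)) \<longlonglongrightarrow> 0"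
  proof (rule Lim_null_comparison[OF always_eventually char_step_error[of l]], rule allI)
    fix n
    have eq: "(\<integral>\<omega>. ?\<eta> n \<omega> * ?\<Pi> n \<omega> \<partial>M) - (\<integral>\<omega>. ?\<eta> n \<omega> * complex_of_real (gauss n l \<omega>) \<partial>M) =
        (\<integral>\<omega>. ?\<eta> n \<omega> * (?\<Pi> n \<omega> - complex_of_real (gauss n l \<omega>)) \<partial>M)"
      using intb(1,2) by (simp add: right_diff_distrib)
    show "norm ((\<integral>\<omega>. ?\<eta> n \<omega> * ?\<Pi> n \<omega> \<partial>M) - (\<integral>\<omega>. ?\<eta> n \<omega> * complex_of_real (gauss n l \<omega>) \<partial>M)) \<le>
        (\<integral>\<omega>. cmod (?\<Pi> n \<omega> - complex_of_real (gauss n l \<omega>)) \<partial>M)"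
      unfolding eq
    proof (rule norm_integral_le[OF _ intb(3)])
      show "integrable M (\<lambda>\<omega>. ?\<eta> n \<omega> * (?\<Pi> n \<omega> - complex_of_real (gauss n l \<omega>)))"
        unfolding right_diff_distrib using intb(1,2) by (rule Bochner_Integration.integrable_diff)
      show "cmod (?\<eta> n \<omega> * (?\<Pi> n \<omega> - complex_of_real (gauss n l \<omega>))) \<le> cmod (?\<Pi> n \<omega> - complex_of_real (gauss n l \<omega>))" for \<omega>
        using mult_right_mono[OF \<eta>(2)[of n \<omega>], of "cmod (?\<Pi> n \<omega> - complex_of_real (gauss n l \<omega>))"]
        by (simp only: norm_mult mult_1_left norm_ge_zero)
    qed
  qed
  have \<zeta>': "?\<zeta> n \<in> borel_measurable (F k)" if "n \<le> k" for n k
  proof -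
    note [measurable] = Suc.prems(1)[OF that] gauss_measurable_F[OF that, of l]
    show ?thesis by measurable
  qed
  have \<zeta>1: "cmod (?\<zeta> n \<omega>) \<le> 1" for n \<omega>
    using mult_mono[OF Suc.prems(2)[of n \<omega>], of "\<bar>gauss n l \<omega>\<bar>" 1] gauss_bounds[of n l \<omega>] by (simp add: norm_mult)
  have d2: "(\<lambda>n. (\<integral>\<omega>. ?\<zeta> n \<omega> * iexp (arg n \<omega> * ?S n \<omega>) \<partial>M) - (\<integral>\<omega>. ?\<zeta> n \<omega> * complex_of_real (\<Prod>j<l. gauss n j \<omega>) \<partial>M)) \<longlonglongrightarrow> 0"
    by (rule Suc.IH) (use \<zeta>' \<zeta>1 in auto)
  have e1: "(\<integral>\<omega>. ?\<zeta> n \<omega> * iexp (arg n \<omega> * ?S n \<omega>) \<partial>M) = (\<integral>\<omega>. ?\<eta> n \<omega> * complex_of_real (gauss n l \<omega>) \<partial>M)" for n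
    by (intro Bochner_Integration.integral_cong refl) (simp add: mult_ac)
  have e2: "(\<integral>\<omega>. ?\<zeta> n \<omega> * complex_of_real (\<Prod>j<l. gauss n j \<omega>) \<partial>M) = (\<integral>\<omega>. \<zeta> n \<omega> * complex_of_real (\<Prod>j<Suc l. gauss n j \<omega>) \<partial>M)" for n
    by (intro Bochner_Integration.integral_cong refl) (simp add: mult_ac)
  show ?case
    using tendsto_add[OF d1 d2] unfolding step e1 e2 by simp
qed

lemma char_limit:
  assumes cont: "continuous_on UNIV \<beta>"
  shows "(\<lambda>n. \<integral>\<omega>. iexp (arg n \<omega> * (\<Sum>q\<in>{n..<n + l}. mg_incr g q \<omega>)) \<partial>M) \<longlonglongrightarrow>
    complex_of_real (\<integral>\<omega>. exp (- ((\<beta> (limit_size \<omega>))\<^sup>2 * s * limit_size \<omega> * (\<Sum>j<l. m ^ j) / 2)) \<partial>M)"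
proof -
  let ?e = "\<lambda>w. exp (- ((\<beta> w)\<^sup>2 * s * w * (\<Sum>j<l. m ^ j) / 2))"
  \<comment> \<open>As m^n rate^(2n) = 1, the product depends on n only through W_n, and the limit
    passes through W_n.\<close>
  have prod: "(\<Prod>j<l. gauss n j \<omega>) = ?e (scaled_size n \<omega>)" for n \<omega>
  proof -
    have "(arg n \<omega>)\<^sup>2 * (s * (m ^ (n + j) * scaled_size n \<omega>)) / 2 = (\<beta> (scaled_size n \<omega>))\<^sup>2 * s * scaled_size n \<omega> / 2 * m ^ j" for j
    proof -
      have "(arg n \<omega>)\<^sup>2 * (s * (m ^ (n + j) * scaled_size n \<omega>)) / 2 =
          (\<beta> (scaled_size n \<omega>))\<^sup>2 * s * scaled_size n \<omega> / 2 * m ^ j * (rate ^ n * rate ^ n * m ^ n)"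
        by (simp add: arg_def power2_eq_square power_add)
      then show ?thesis by (simp only: rate_power mult_1_right)
    qed
    then have "(\<Prod>j<l. gauss n j \<omega>) = (\<Prod>j<l. exp (- ((\<beta> (scaled_size n \<omega>))\<^sup>2 * s * scaled_size n \<omega> / 2 * m ^ j)))"
      unfolding gauss_def by (simp only:)
    also have "\<dots> = ?e (scaled_size n \<omega>)"
      by (subst exp_sum[symmetric], simp, simp only: sum_negf sum_distrib_left[symmetric]) simp
    finally show ?thesis .
  qed
  have "(\<lambda>n. \<integral>\<omega>. complex_of_real (?e (scaled_size n \<omega>)) \<partial>M) \<longlonglongrightarrow> (\<integral>\<omega>. complex_of_real (?e (limit_size \<omega>)) \<partial>M)"
  proof (rule integral_tendsto_bounded[where C=1])
    have "0 \<le> (\<beta> (scaled_size n \<omega>))\<^sup>2 * s * scaled_size n \<omega> * (\<Sum>j<l. m ^ j)" for n \<omega>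
      by (intro mult_nonneg_nonneg sum_nonneg s scaled_size_nonneg) auto
    then show "norm (complex_of_real (?e (scaled_size n \<omega>))) \<le> 1" for n \<omega> by simp
    have \<beta>c: "isCont \<beta> w" for w using cont by (simp add: continuous_on_eq_continuous_at)
    show "AE \<omega> in M. (\<lambda>n. complex_of_real (?e (scaled_size n \<omega>))) \<longlonglongrightarrow> complex_of_real (?e (limit_size \<omega>))"
      using AE_scaled_size_tendsto
    proof eventually_elim
      case (elim \<omega>)
      then show ?case by (intro tendsto_intros isCont_tendsto_compose[OF \<beta>c]) auto
    qed
  qed measurable
  moreover have "(\<lambda>n. (\<integral>\<omega>. 1 * iexp (arg n \<omega> * (\<Sum>q\<in>{n..<n + l}. mg_incr g q \<omega>)) \<partial>M)
      - (\<integral>\<omega>. 1 * complex_of_real (\<Prod>j<l. gauss n j \<omega>) \<partial>M)) \<longlonglongrightarrow> 0"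
    by (rule char_product_approx) auto
  ultimately have "(\<lambda>n. ((\<integral>\<omega>. 1 * iexp (arg n \<omega> * (\<Sum>q\<in>{n..<n + l}. mg_incr g q \<omega>)) \<partial>M)
      - (\<integral>\<omega>. 1 * complex_of_real (\<Prod>j<l. gauss n j \<omega>) \<partial>M)) + (\<integral>\<omega>. complex_of_real (?e (scaled_size n \<omega>)) \<partial>M))
      \<longlonglongrightarrow> 0 + (\<integral>\<omega>. complex_of_real (?e (limit_size \<omega>)) \<partial>M)" by (intro tendsto_add)
  then show ?thesis unfolding prod by (simp add: integral_complex_of_real)
qed

end

end

section \<open>Random norming\<close>

text \<open>The comparison sequence is indexed by the generation n = r - l from which the increments
  are kept, and l depends on \<epsilon>; hence the shift.\<close>

lemma tendsto_by_approx:
  fixes x :: "nat \<Rightarrow> 'b::metric_space"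
  assumes "\<And>\<epsilon>. \<epsilon> > 0 \<Longrightarrow> \<exists>l y y'. y \<longlonglongrightarrow> y' \<and> dist y' x' \<le> \<epsilon> \<and> (\<forall>\<^sub>F n in sequentially. dist (x (n + l)) (y n) \<le> \<epsilon>)"
  shows "x \<longlonglongrightarrow> x'"
proof (rule tendstoI)
  fix e :: real assume e: "e > 0"
  obtain l y y' where y: "y \<longlonglongrightarrow> y'" "dist y' x' \<le> e / 4" "\<forall>\<^sub>F n in sequentially. dist (x (n + l)) (y n) \<le> e / 4"
    using assms[of "e / 4"] e by auto
  have "\<forall>\<^sub>F n in sequentially. dist (y n) y' < e / 4" using tendstoD[OF y(1), of "e / 4"] e by simp
  with y(3) have "\<forall>\<^sub>F n in sequentially. dist (x (n + l)) x' < e"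
  proof eventually_elim
    case (elim n)
    have "dist (x (n + l)) x' \<le> dist (x (n + l)) (y n) + (dist (y n) y' + dist y' x')"
      by (intro order_trans[OF dist_triangle[of _ _ "y n"]] add_left_mono dist_triangle)
    with elim y(2) e show ?case by linarith
  qed
  then show "\<forall>\<^sub>F n in sequentially. dist (x n) x' < e"
    using eventually_sequentially_seg[of "\<lambda>n. dist (x n) x' < e" l] by simp
qed

lemma cmod_iexp_diff: "cmod (iexp x - iexp y) \<le> min 2 \<bar>x - y\<bar>"
proof -
  have eq: "iexp x - iexp y = iexp y * (iexp (x - y) - 1)"
    by (simp add: right_diff_distrib exp_add[symmetric] distrib_left[symmetric])
  have "cmod (iexp (x - y) - 1) \<le> \<bar>x - y\<bar>" using iexp_approx1[of "x - y" 0] by simp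
  then have "cmod (iexp x - iexp y) \<le> \<bar>x - y\<bar>"
    unfolding eq norm_mult by simp
  moreover have "cmod (iexp x - iexp y) \<le> 2" using norm_triangle_ineq4[of "iexp x" "iexp y"] by simp
  ultimately show ?thesis by simp
qed

text \<open>On \<bar>D\<bar> \<le> K the norming a is exchanged for b at a cost K \<bar>t\<bar>
  \<bar>a - b\<bar>, capped by 2 because a may be unbounded. Chebyshev's inequality pays for the
  rest, and removing R costs its first moment times the bound of b.\<close>

lemma (in prob_space) char_perturbation:
  fixes a b D R :: "'a \<Rightarrow> real"
  assumes [measurable]: "a \<in> borel_measurable M" "b \<in> borel_measurable M" "D \<in> borel_measurable M" "R \<in> borel_measurable M"
    and b: "\<And>\<omega>. \<bar>b \<omega>\<bar> \<le> B" and K: "K > 0"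
    and int: "integrable M (\<lambda>\<omega>. (D \<omega>)\<^sup>2)" "integrable M (\<lambda>\<omega>. (R \<omega>)\<^sup>2)" "integrable M R"
  shows "cmod ((\<integral>\<omega>. iexp (t * (a \<omega> * D \<omega>)) \<partial>M) - (\<integral>\<omega>. iexp (t * (b \<omega> * (D \<omega> - R \<omega>))) \<partial>M)) \<le>
    (\<integral>\<omega>. min 2 (K * \<bar>t\<bar> * \<bar>a \<omega> - b \<omega>\<bar>) \<partial>M) + 2 * (\<integral>\<omega>. (D \<omega>)\<^sup>2 \<partial>M) / K\<^sup>2 + \<bar>t\<bar> * B * sqrt (\<integral>\<omega>. (R \<omega>)\<^sup>2 \<partial>M)"
proof -
  let ?x = "\<lambda>\<omega>. t * (a \<omega> * D \<omega>)" and ?y = "\<lambda>\<omega>. t * (b \<omega> * (D \<omega> - R \<omega>))"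
  have B: "0 \<le> B" using b[of undefined] by linarith
  have pt: "cmod (iexp (?x \<omega>) - iexp (?y \<omega>)) \<le> min 2 (K * \<bar>t\<bar> * \<bar>a \<omega> - b \<omega>\<bar>) + 2 * (D \<omega>)\<^sup>2 / K\<^sup>2 + \<bar>t\<bar> * B * \<bar>R \<omega>\<bar>" for \<omega>
  proof -
    let ?z = "t * (b \<omega> * D \<omega>)"
    have "cmod (iexp (?x \<omega>) - iexp ?z) \<le> min 2 \<bar>?x \<omega> - ?z\<bar>" by (rule cmod_iexp_diff)
    also have "?x \<omega> - ?z = t * (a \<omega> - b \<omega>) * D \<omega>" by (simp add: algebra_simps)
    also have "min 2 \<bar>t * (a \<omega> - b \<omega>) * D \<omega>\<bar> \<le> min 2 (K * \<bar>t\<bar> * \<bar>a \<omega> - b \<omega>\<bar>) + 2 * (D \<omega>)\<^sup>2 / K\<^sup>2"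
    proof (cases "\<bar>D \<omega>\<bar> \<le> K")
      case True
      then have "\<bar>D \<omega>\<bar> * (\<bar>t\<bar> * \<bar>a \<omega> - b \<omega>\<bar>) \<le> K * (\<bar>t\<bar> * \<bar>a \<omega> - b \<omega>\<bar>)" by (intro mult_right_mono) auto
      then have "\<bar>t * (a \<omega> - b \<omega>) * D \<omega>\<bar> \<le> K * \<bar>t\<bar> * \<bar>a \<omega> - b \<omega>\<bar>" by (simp add: abs_mult mult_ac)
      moreover have "0 \<le> 2 * (D \<omega>)\<^sup>2 / K\<^sup>2" by simp
      ultimately show ?thesis by linarith
    next
      case False
      then have "K\<^sup>2 \<le> (D \<omega>)\<^sup>2" using K by (intro abs_le_square_iff[THEN iffD1]) auto
      then have "2 \<le> 2 * (D \<omega>)\<^sup>2 / K\<^sup>2" using K by (simp add: le_divide_eq)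
      moreover have "0 \<le> min 2 (K * \<bar>t\<bar> * \<bar>a \<omega> - b \<omega>\<bar>)" using K by simp
      ultimately show ?thesis by linarith
    qed
    finally have 1: "cmod (iexp (?x \<omega>) - iexp ?z) \<le> min 2 (K * \<bar>t\<bar> * \<bar>a \<omega> - b \<omega>\<bar>) + 2 * (D \<omega>)\<^sup>2 / K\<^sup>2" .
    have "cmod (iexp ?z - iexp (?y \<omega>)) \<le> min 2 \<bar>?z - ?y \<omega>\<bar>" by (rule cmod_iexp_diff)
    then have "cmod (iexp ?z - iexp (?y \<omega>)) \<le> \<bar>?z - ?y \<omega>\<bar>" by simp
    also have "?z - ?y \<omega> = t * (b \<omega> * R \<omega>)" by (simp add: algebra_simps)
    also have "\<bar>t * (b \<omega> * R \<omega>)\<bar> \<le> \<bar>t\<bar> * B * \<bar>R \<omega>\<bar>"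
      using b[of \<omega>] by (simp add: abs_mult mult.assoc mult_left_mono mult_right_mono)
    finally have 2: "cmod (iexp ?z - iexp (?y \<omega>)) \<le> \<bar>t\<bar> * B * \<bar>R \<omega>\<bar>" .
    have "iexp (?x \<omega>) - iexp (?y \<omega>) = (iexp (?x \<omega>) - iexp ?z) + (iexp ?z - iexp (?y \<omega>))" by simp
    then show ?thesis using norm_triangle_le[OF add_mono[OF 1 2]] by (simp only:)
  qed
  have ie: "integrable M (\<lambda>\<omega>. iexp (?x \<omega>))" "integrable M (\<lambda>\<omega>. iexp (?y \<omega>))"
    by (rule bounded_integrable[where C=1]; simp)+
  have im: "integrable M (\<lambda>\<omega>. min 2 (K * \<bar>t\<bar> * \<bar>a \<omega> - b \<omega>\<bar>))"
    using K by (intro bounded_integrable[where C=2]) auto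
  have "(\<integral>\<omega>. iexp (?x \<omega>) \<partial>M) - (\<integral>\<omega>. iexp (?y \<omega>) \<partial>M) = (\<integral>\<omega>. iexp (?x \<omega>) - iexp (?y \<omega>) \<partial>M)"
    by (rule Bochner_Integration.integral_diff[OF ie, symmetric])
  then have "cmod ((\<integral>\<omega>. iexp (?x \<omega>) \<partial>M) - (\<integral>\<omega>. iexp (?y \<omega>) \<partial>M)) \<le>
      (\<integral>\<omega>. min 2 (K * \<bar>t\<bar> * \<bar>a \<omega> - b \<omega>\<bar>) + 2 * (D \<omega>)\<^sup>2 / K\<^sup>2 + \<bar>t\<bar> * B * \<bar>R \<omega>\<bar> \<partial>M)"
    using pt im int ie by (simp only:) (intro norm_integral_le, auto)
  also have "\<dots> = (\<integral>\<omega>. min 2 (K * \<bar>t\<bar> * \<bar>a \<omega> - b \<omega>\<bar>) \<partial>M) + 2 * (\<integral>\<omega>. (D \<omega>)\<^sup>2 \<partial>M) / K\<^sup>2 + \<bar>t\<bar> * B * (\<integral>\<omega>. \<bar>R \<omega>\<bar> \<partial>M)"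
    using im int by simp
  also have "\<dots> \<le> (\<integral>\<omega>. min 2 (K * \<bar>t\<bar> * \<bar>a \<omega> - b \<omega>\<bar>) \<partial>M) + 2 * (\<integral>\<omega>. (D \<omega>)\<^sup>2 \<partial>M) / K\<^sup>2 + \<bar>t\<bar> * B * sqrt (\<integral>\<omega>. (R \<omega>)\<^sup>2 \<partial>M)"
    using B int by (intro add_left_mono mult_left_mono abs_expectation_le_sqrt) auto
  finally show ?thesis .
qed

section \<open>Limit and cut-off of the random norming\<close>

context supercritical_chain
begin

text \<open>On {W = 0} extinction makes the sequence eventually 0; on {W > 0} all late generations
  are nonempty and the guard disappears. Convergence therefore has to be checked on {W > 0}
  only.\<close>

lemma AE_alive_tendsto:
  assumes "AE \<omega> in M. limit_size \<omega> > 0 \<longrightarrow> (\<lambda>r. u r \<omega>) \<longlonglongrightarrow> U \<omega>"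
  shows "AE \<omega> in M. (\<lambda>r. if gen_sum X r living \<omega> > 0 then u r \<omega> else 0) \<longlonglongrightarrow> (if limit_size \<omega> = 0 then 0 else U \<omega> :: real)"
  using assms AE_survival AE_scaled_size_tendsto limit_size_nonneg_AE
proof eventually_elim
  case (elim \<omega>)
  show ?case
  proof (cases "limit_size \<omega> = 0")
    case True
    with elim obtain k where "\<forall>j\<ge>k. gen_sum X j living \<omega> = 0" by auto
    then have "\<forall>\<^sub>F r in sequentially. (if gen_sum X r living \<omega> > 0 then u r \<omega> else 0) = 0"
      by (auto simp: eventually_sequentially intro!: exI[of _ k])
    with True show ?thesis by (simp add: tendsto_eventually)
  next
    case False
    with elim have pos: "limit_size \<omega> > 0" by simp
    have "\<forall>\<^sub>F r in sequentially. scaled_size r \<omega> > 0" using order_tendstoD(1)[OF elim(3) pos] .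
    then have "\<forall>\<^sub>F r in sequentially. u r \<omega> = (if gen_sum X r living \<omega> > 0 then u r \<omega> else 0)"
      by eventually_elim
        (use super_critical gen_sum_living_nonneg in \<open>auto simp: scaled_size_def zero_less_divide_iff not_less\<close>)
    with elim(1) pos False show ?thesis by (simp add: Lim_transform_eventually)
  qed
qed

definition tree_const :: real where "tree_const = m / (m - 1)"

lemma tree_const_pos: "0 < tree_const"
  using super_critical by (simp add: tree_const_def)

definition norming :: "nat \<Rightarrow> 'w \<Rightarrow> real" where
  "norming r \<omega> = (if gen_sum X r living \<omega> > 0 then 1 / sqrt (tree_size r \<omega>) else 0)"

definition limit_norming :: "'w \<Rightarrow> real" where
  "limit_norming \<omega> = (if limit_size \<omega> = 0 then 0 else 1 / sqrt (tree_const * limit_size \<omega>))"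

lemma norming_measurable [measurable]: "norming r \<in> borel_measurable M"
  unfolding norming_def[abs_def] by measurable

lemma limit_norming_measurable [measurable]: "limit_norming \<in> borel_measurable M"
  unfolding limit_norming_def[abs_def] by measurable

lemma AE_norming_tendsto: "AE \<omega> in M. (\<lambda>r. norming r \<omega> / rate ^ r) \<longlonglongrightarrow> limit_norming \<omega>"
proof -
  have eq: "norming r \<omega> / rate ^ r = (if gen_sum X r living \<omega> > 0 then 1 / sqrt (tree_size r \<omega> / m ^ r) else 0)" for r \<omega>
    by (simp add: norming_def rate_def real_sqrt_power[symmetric] real_sqrt_divide power_one_over)
  show ?thesis
    unfolding eq limit_norming_def
  proof (rule AE_alive_tendsto)
    show "AE \<omega> in M. limit_size \<omega> > 0 \<longrightarrow> (\<lambda>r. 1 / sqrt (tree_size r \<omega> / m ^ r)) \<longlonglongrightarrow> 1 / sqrt (tree_const * limit_size \<omega>)"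
      using AE_tree_size_tendsto
    proof eventually_elim
      case (elim \<omega>)
      show ?case
      proof
        assume "limit_size \<omega> > 0"
        then have "sqrt (tree_const * limit_size \<omega>) \<noteq> 0" using tree_const_pos by simp
        moreover have "(\<lambda>r. sqrt (tree_size r \<omega> / m ^ r)) \<longlonglongrightarrow> sqrt (tree_const * limit_size \<omega>)"
          using elim unfolding tree_const_def by (rule tendsto_real_sqrt)
        ultimately show "(\<lambda>r. 1 / sqrt (tree_size r \<omega> / m ^ r)) \<longlonglongrightarrow> 1 / sqrt (tree_const * limit_size \<omega>)"
          by (intro tendsto_divide tendsto_const)
      qed
    qed
  qed
qed

text \<open>Equal to 1 / sqrt (\<open>tree_const\<close> w) for w \<ge> \<delta>, linear on
  [0, \<delta>] and 0 below: a bounded continuous substitute that agrees with the limiting norming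
  at w = 0.\<close>

definition cutoff_norming :: "real \<Rightarrow> real \<Rightarrow> real" where
  "cutoff_norming \<delta> w = max 0 w / (max w \<delta> * sqrt (max w \<delta> * tree_const))"

lemma cutoff_norming_continuous: "\<delta> > 0 \<Longrightarrow> continuous_on UNIV (cutoff_norming \<delta>)"
  unfolding cutoff_norming_def[abs_def] using tree_const_pos
  by (intro continuous_intros) (auto simp: max_def)

lemma cutoff_norming_bound:
  assumes "\<delta> > 0"
  shows "\<bar>cutoff_norming \<delta> w\<bar> \<le> 1 / sqrt (\<delta> * tree_const)"
proof -
  have pos: "0 < max w \<delta>" "\<delta> \<le> max w \<delta>" using assms by auto
  have "max 0 w / max w \<delta> \<le> 1" using pos assms by (auto simp: divide_le_eq)
  moreover have "1 / sqrt (max w \<delta> * tree_const) \<le> 1 / sqrt (\<delta> * tree_const)"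
    using pos assms tree_const_pos by (intro divide_left_mono real_sqrt_le_mono mult_right_mono) auto
  ultimately have "max 0 w / max w \<delta> * (1 / sqrt (max w \<delta> * tree_const)) \<le> 1 * (1 / sqrt (\<delta> * tree_const))"
    using pos assms tree_const_pos by (intro mult_mono) auto
  then have "cutoff_norming \<delta> w \<le> 1 / sqrt (\<delta> * tree_const)" by (simp add: cutoff_norming_def)
  moreover have "0 \<le> cutoff_norming \<delta> w" using pos tree_const_pos by (simp add: cutoff_norming_def)
  ultimately show ?thesis by linarith
qed

lemma cutoff_norming_tendsto:
  "0 \<le> limit_size \<omega> \<Longrightarrow> (\<lambda>j. cutoff_norming (1 / real (Suc j)) (limit_size \<omega>)) \<longlonglongrightarrow> limit_norming \<omega>"
proof (cases "limit_size \<omega> = 0")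
  case True
  then show ?thesis by (simp add: cutoff_norming_def limit_norming_def)
next
  case False
  assume "0 \<le> limit_size \<omega>"
  with False have pos: "limit_size \<omega> > 0" by simp
  have "\<forall>\<^sub>F j in sequentially. 1 / real (Suc j) < limit_size \<omega>"
    using order_tendstoD(2)[OF LIMSEQ_inverse_real_of_nat pos] by (simp add: inverse_eq_divide)
  then have "\<forall>\<^sub>F j in sequentially. cutoff_norming (1 / real (Suc j)) (limit_size \<omega>) = limit_norming \<omega>"
  proof eventually_elim
    case (elim j)
    then have "max (limit_size \<omega>) (1 / real (Suc j)) = limit_size \<omega>" by simp
    then show ?case using pos by (simp add: cutoff_norming_def limit_norming_def mult.commute)
  qed
  then show ?thesis by (rule tendsto_eventually)
qed

end

section \<open>Characteristic functions under the random norming\<close>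

context clt_setup
begin

lemma second_moment_mg_total:
  "(\<integral>\<omega>. (\<Sum>q\<in>{0..<n}. mg_incr g q \<omega>)\<^sup>2 \<partial>M) \<le> C\<^sup>2 / (m - 1) * m ^ n"
proof -
  have "(\<integral>\<omega>. (\<Sum>q\<in>{0..<n}. 1 * mg_incr g q \<omega>)\<^sup>2 \<partial>M) = (\<Sum>q\<in>{0..<n}. 1\<^sup>2 * (\<integral>\<omega>. (mg_incr g q \<omega>)\<^sup>2 \<partial>M))"
    by (rule second_moment_sum_mg_incr[OF g])
  also have "\<dots> \<le> (\<Sum>q\<in>{0..<n}. C\<^sup>2 * m ^ q)"
    by (intro sum_mono) (simp add: second_moment_mg_incr_le[OF g C])
  also have "\<dots> = C\<^sup>2 * ((m ^ n - 1) / (m - 1))"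
    using super_critical by (simp add: sum_distrib_left[symmetric] atLeast0LessThan geometric_sum)
  also have "\<dots> \<le> C\<^sup>2 / (m - 1) * m ^ n"
    using super_critical by (simp add: divide_right_mono mult_left_mono)
  finally show ?thesis by simp
qed

lemma mg_total_bdd: "(\<lambda>\<omega>. \<Sum>q\<in>{a..<n}. mg_incr g q \<omega>) \<in> bdd_measurable M"
  by (intro bdd_measurable_sum mg_incr_bdd[OF g])

text \<open>The generations before n, measured on the scale of generation n + l, contribute at most
  order m^(-l) uniformly in n. The case l = 0 bounds a full sum on its own scale.\<close>

lemma rate_scaled_second_moment:
  "(\<integral>\<omega>. (rate ^ (n + l) * (\<Sum>q\<in>{0..<n}. mg_incr g q \<omega>))\<^sup>2 \<partial>M) \<le> C\<^sup>2 / (m - 1) * (1 / m) ^ l"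
proof -
  have "(rate ^ (n + l))\<^sup>2 * m ^ n = (rate ^ n * rate ^ n * m ^ n) * (rate\<^sup>2) ^ l"
    by (simp add: power_add power2_eq_square power_mult_distrib)
  then have r: "(rate ^ (n + l))\<^sup>2 * m ^ n = (1 / m) ^ l" by (simp only: rate_power rate(3) mult_1_left)
  have "(\<integral>\<omega>. (rate ^ (n + l) * (\<Sum>q\<in>{0..<n}. mg_incr g q \<omega>))\<^sup>2 \<partial>M) =
      (rate ^ (n + l))\<^sup>2 * (\<integral>\<omega>. (\<Sum>q\<in>{0..<n}. mg_incr g q \<omega>)\<^sup>2 \<partial>M)"
    by (simp add: power_mult_distrib)
  also have "\<dots> \<le> (rate ^ (n + l))\<^sup>2 * (C\<^sup>2 / (m - 1) * m ^ n)"
    by (intro mult_left_mono second_moment_mg_total) simp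
  also have "\<dots> = C\<^sup>2 / (m - 1) * ((rate ^ (n + l))\<^sup>2 * m ^ n)" by (simp add: mult_ac)
  finally show ?thesis unfolding r .
qed

text \<open>
  Comparison with the sum over the last \<open>l + 1\<close> generations, normed by a bounded continuous function
  of \<open>W\<^sub>n\<close>, where \<open>n = r - l\<close>: the truncation level \<open>K\<close> of the normed sum is chosen first, then the
  cutoff \<open>\<delta>\<close> of the norming, then \<open>l\<close>.
\<close>

lemma char_norming_tendsto:
  "(\<lambda>r. \<integral>\<omega>. iexp (t * (norming r \<omega> * (\<Sum>q\<in>{0..<Suc r}. mg_incr g q \<omega>))) \<partial>M) \<longlonglongrightarrow>
    complex_of_real (\<integral>\<omega>. exp (- (t\<^sup>2 * s / 2 * (if limit_size \<omega> = 0 then 0 else 1))) \<partial>M)"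
proof (rule tendsto_by_approx)
  fix \<epsilon> :: real assume \<epsilon>: "\<epsilon> > 0"
  define V where "V = C\<^sup>2 / (m - 1)"
  have V: "0 \<le> V" using super_critical by (simp add: V_def)
  \<comment> \<open>Chosen to make the Chebyshev term 2 V m / K^2 at most \<epsilon> / 4; the
    summand 1 ensures K \<le> K^2.\<close>
  define K where "K = 1 + 8 * (V * m) / \<epsilon>"
  have K1: "1 \<le> K" using V \<epsilon> by (simp add: K_def)
  have K: "2 * (V * m) / K\<^sup>2 \<le> \<epsilon> / 4"
  proof -
    have "8 * (V * m) / \<epsilon> \<le> K" by (simp add: K_def)
    also have "K \<le> K\<^sup>2" using K1 by (simp add: power2_eq_square)
    finally have "8 * (V * m) \<le> \<epsilon> * K\<^sup>2" using \<epsilon> by (simp add: divide_le_eq mult.commute)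
    then show ?thesis using K1 by (simp add: divide_le_eq)
  qed
  let ?L = "\<lambda>\<omega>. limit_norming \<omega>" and ?W = "limit_size"
  let ?c = "\<lambda>j w. cutoff_norming (1 / real (Suc j)) w"
  have cm: "?c j \<in> borel_measurable borel" for j
    by (rule borel_measurable_continuous_onI[OF cutoff_norming_continuous]) simp
  have cW [measurable]: "(\<lambda>\<omega>. ?c j (?W \<omega>)) \<in> borel_measurable M" for j
    by (rule measurable_compose[OF limit_size_measurable cm])
  have c1: "(\<lambda>j. \<integral>\<omega>. min 2 (K * \<bar>t\<bar> * \<bar>?L \<omega> - ?c j (?W \<omega>)\<bar>) \<partial>M) \<longlonglongrightarrow> (\<integral>\<omega>. 0 \<partial>M)"
  proof (rule integral_tendsto_bounded[where C=2])
    show "AE \<omega> in M. (\<lambda>j. min 2 (K * \<bar>t\<bar> * \<bar>?L \<omega> - ?c j (?W \<omega>)\<bar>)) \<longlonglongrightarrow> 0"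
      using limit_size_nonneg_AE
    proof eventually_elim
      case (elim \<omega>)
      have "(\<lambda>j. min 2 (K * \<bar>t\<bar> * \<bar>?L \<omega> - ?c j (?W \<omega>)\<bar>)) \<longlonglongrightarrow> min 2 (K * \<bar>t\<bar> * \<bar>?L \<omega> - ?L \<omega>\<bar>)"
        by (intro tendsto_intros cutoff_norming_tendsto elim)
      then show ?case by simp
    qed
    show "(\<lambda>\<omega>. min 2 (K * \<bar>t\<bar> * \<bar>?L \<omega> - ?c j (?W \<omega>)\<bar>)) \<in> borel_measurable M" for j by measurable
  qed (use K1 in auto)
  \<comment> \<open>W is nonnegative only almost surely; \<open>max 0\<close> bounds the integrand
    by 1 everywhere.\<close>
  have c2: "(\<lambda>j. \<integral>\<omega>. exp (- max 0 (t\<^sup>2 * (?c j (?W \<omega>))\<^sup>2 * s * ?W \<omega> * tree_const / 2)) \<partial>M) \<longlonglongrightarrow>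
      (\<integral>\<omega>. exp (- (t\<^sup>2 * s / 2 * (if ?W \<omega> = 0 then 0 else 1))) \<partial>M)"
  proof (rule integral_tendsto_bounded[where C=1])
    show "AE \<omega> in M. (\<lambda>j. exp (- max 0 (t\<^sup>2 * (?c j (?W \<omega>))\<^sup>2 * s * ?W \<omega> * tree_const / 2))) \<longlonglongrightarrow>
        exp (- (t\<^sup>2 * s / 2 * (if ?W \<omega> = 0 then 0 else 1)))"
      using limit_size_nonneg_AE
    proof eventually_elim
      case (elim \<omega>)
      have "(\<lambda>j. exp (- max 0 (t\<^sup>2 * (?c j (?W \<omega>))\<^sup>2 * s * ?W \<omega> * tree_const / 2))) \<longlonglongrightarrow>
          exp (- max 0 (t\<^sup>2 * (?L \<omega>)\<^sup>2 * s * ?W \<omega> * tree_const / 2))"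
        by (intro tendsto_intros cutoff_norming_tendsto elim) simp
      moreover have "t\<^sup>2 * (?L \<omega>)\<^sup>2 * s * ?W \<omega> * tree_const / 2 = t\<^sup>2 * s / 2 * (if ?W \<omega> = 0 then 0 else 1)"
        using elim tree_const_pos by (auto simp: limit_norming_def power_divide)
      ultimately show ?case using s by simp
    qed
    show "(\<lambda>\<omega>. exp (- max 0 (t\<^sup>2 * (?c j (?W \<omega>))\<^sup>2 * s * ?W \<omega> * tree_const / 2))) \<in> borel_measurable M" for j
      by measurable
  qed auto
  obtain j where j: "(\<integral>\<omega>. min 2 (K * \<bar>t\<bar> * \<bar>?L \<omega> - ?c j (?W \<omega>)\<bar>) \<partial>M) < \<epsilon> / 4"
    "\<bar>(\<integral>\<omega>. exp (- max 0 (t\<^sup>2 * (?c j (?W \<omega>))\<^sup>2 * s * ?W \<omega> * tree_const / 2)) \<partial>M) -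
      (\<integral>\<omega>. exp (- (t\<^sup>2 * s / 2 * (if ?W \<omega> = 0 then 0 else 1))) \<partial>M)\<bar> < \<epsilon> / 2"
  proof -
    have "\<forall>\<^sub>F j in sequentially. (\<integral>\<omega>. min 2 (K * \<bar>t\<bar> * \<bar>?L \<omega> - ?c j (?W \<omega>)\<bar>) \<partial>M) < \<epsilon> / 4"
      using \<epsilon> by (intro order_tendstoD(2)[OF c1]) simp
    moreover have "\<forall>\<^sub>F j in sequentially. dist (\<integral>\<omega>. exp (- max 0 (t\<^sup>2 * (?c j (?W \<omega>))\<^sup>2 * s * ?W \<omega> * tree_const / 2)) \<partial>M)
        (\<integral>\<omega>. exp (- (t\<^sup>2 * s / 2 * (if ?W \<omega> = 0 then 0 else 1))) \<partial>M) < \<epsilon> / 2"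
      using \<epsilon> by (intro tendstoD[OF c2]) simp
    ultimately have "\<exists>j. (\<integral>\<omega>. min 2 (K * \<bar>t\<bar> * \<bar>?L \<omega> - ?c j (?W \<omega>)\<bar>) \<partial>M) < \<epsilon> / 4 \<and>
      dist (\<integral>\<omega>. exp (- max 0 (t\<^sup>2 * (?c j (?W \<omega>))\<^sup>2 * s * ?W \<omega> * tree_const / 2)) \<partial>M)
        (\<integral>\<omega>. exp (- (t\<^sup>2 * s / 2 * (if ?W \<omega> = 0 then 0 else 1))) \<partial>M) < \<epsilon> / 2"
      by (intro eventually_happens'[OF sequentially_bot eventually_conj])
    then show ?thesis using that by (auto simp: dist_real_def)
  qed
  define b where "b = ?c j"
  define B where "B = 1 / sqrt (1 / real (Suc j) * tree_const)"
  have b_cont: "continuous_on UNIV b" unfolding b_def by (rule cutoff_norming_continuous) simp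
  have b_le: "\<bar>b w\<bar> \<le> B" for w unfolding b_def B_def by (rule cutoff_norming_bound) simp
  have bm [measurable]: "b \<in> borel_measurable borel" unfolding b_def by (rule cm)
  \<comment> \<open>The weights m^0, ..., m^l of the last l + 1 generations, divided by m^l and read
    backwards; their sum tends to m / (m - 1), the constant inside the norming.\<close>
  let ?G = "\<lambda>l. \<Sum>i<Suc l. (1 / m) ^ i"
  have G: "?G \<longlonglongrightarrow> tree_const"
  proof -
    have "(\<lambda>i. (1 / m) ^ i) sums (1 / (1 - 1 / m))" using super_critical by (intro geometric_sums) simp
    then have "(\<lambda>l. \<Sum>i<l. (1 / m) ^ i) \<longlonglongrightarrow> 1 / (1 - 1 / m)" by (simp add: sums_def)
    then have "?G \<longlonglongrightarrow> 1 / (1 - 1 / m)" by (rule LIMSEQ_Suc)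
    moreover have "1 / (1 - 1 / m) = tree_const" using super_critical by (simp add: tree_const_def field_simps)
    ultimately show ?thesis by (simp only:)
  qed
  let ?I = "\<lambda>c. \<integral>\<omega>. exp (- max 0 (t\<^sup>2 * (b (?W \<omega>))\<^sup>2 * s * ?W \<omega> * c / 2)) \<partial>M"
  have I: "(\<lambda>l. ?I (?G l)) \<longlonglongrightarrow> ?I tree_const"
  proof (rule integral_tendsto_bounded[where C=1])
    show "AE \<omega> in M. (\<lambda>l. exp (- max 0 (t\<^sup>2 * (b (?W \<omega>))\<^sup>2 * s * ?W \<omega> * ?G l / 2))) \<longlonglongrightarrow>
        exp (- max 0 (t\<^sup>2 * (b (?W \<omega>))\<^sup>2 * s * ?W \<omega> * tree_const / 2))"
      by (intro AE_I2 tendsto_intros G) simp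
  qed auto
  have R0: "(\<lambda>l. \<bar>t\<bar> * B * sqrt (V * (1 / m) ^ l)) \<longlonglongrightarrow> \<bar>t\<bar> * B * sqrt (V * 0)"
    using super_critical by (intro tendsto_intros LIMSEQ_power_zero) simp
  obtain l where l: "\<bar>t\<bar> * B * sqrt (V * (1 / m) ^ l) < \<epsilon> / 4" "\<bar>?I (?G l) - ?I tree_const\<bar> < \<epsilon> / 2"
  proof -
    have "\<forall>\<^sub>F l in sequentially. \<bar>t\<bar> * B * sqrt (V * (1 / m) ^ l) < \<epsilon> / 4"
      using \<epsilon> by (intro order_tendstoD(2)[OF R0]) simp
    moreover have "\<forall>\<^sub>F l in sequentially. dist (?I (?G l)) (?I tree_const) < \<epsilon> / 2"
      using \<epsilon> by (intro tendstoD[OF I]) simp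
    ultimately have "\<exists>l. \<bar>t\<bar> * B * sqrt (V * (1 / m) ^ l) < \<epsilon> / 4 \<and> dist (?I (?G l)) (?I tree_const) < \<epsilon> / 2"
      by (intro eventually_happens'[OF sequentially_bot eventually_conj])
    then show ?thesis using that by (auto simp: dist_real_def)
  qed
  \<comment> \<open>With r = n + l the scale rate^r splits into rate^n, supplied by
    \<open>arg\<close>, and rate^l, placed here together with t.\<close>
  define \<beta> where "\<beta> w = t * b w * rate ^ l" for w
  have \<beta>_le: "\<bar>\<beta> w\<bar> \<le> \<bar>t\<bar> * B * rate ^ l" for w
    using b_le[of w] rate by (simp add: \<beta>_def abs_mult mult_left_mono mult_right_mono)
  have \<beta>m: "\<beta> \<in> borel_measurable borel" unfolding \<beta>_def[abs_def] by measurable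
  have \<beta>c: "continuous_on UNIV \<beta>" unfolding \<beta>_def[abs_def] by (intro continuous_intros b_cont)
  let ?y = "\<lambda>n. \<integral>\<omega>. iexp (arg \<beta> n \<omega> * (\<Sum>q\<in>{n..<n + Suc l}. mg_incr g q \<omega>)) \<partial>M"
  let ?y' = "\<integral>\<omega>. exp (- ((\<beta> (?W \<omega>))\<^sup>2 * s * ?W \<omega> * (\<Sum>j<Suc l. m ^ j) / 2)) \<partial>M"
  have y: "?y \<longlonglongrightarrow> complex_of_real ?y'"
    by (rule char_limit[OF \<beta>m \<beta>_le \<beta>c])
  have y': "?y' = ?I (?G l)"
  proof (rule integral_cong_AE)
    have "(rate ^ l)\<^sup>2 * (\<Sum>j<Suc l. m ^ j) = ?G l"
    proof -
      have "(rate ^ l)\<^sup>2 = (1 / m) ^ l" using rate(3) by (simp add: power_mult[symmetric] mult.commute[of l] power_mult)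
      then have "(rate ^ l)\<^sup>2 * (\<Sum>j<Suc l. m ^ j) = (\<Sum>j<Suc l. (1 / m) ^ l * m ^ j)" by (simp only: sum_distrib_left)
      also have "\<dots> = (\<Sum>j<Suc l. (1 / m) ^ (Suc l - Suc j))"
        by (intro sum.cong refl) (simp add: power_diff power_divide)
      also have "\<dots> = ?G l" by (rule sum.nat_diff_reindex)
      finally show ?thesis .
    qed
    moreover have "(\<beta> w)\<^sup>2 * s * w * c / 2 = t\<^sup>2 * (b w)\<^sup>2 * s * w * ((rate ^ l)\<^sup>2 * c) / 2" for w c
      unfolding \<beta>_def power_mult_distrib by (simp add: mult_ac)
    ultimately have eq: "(\<beta> w)\<^sup>2 * s * w * (\<Sum>j<Suc l. m ^ j) / 2 = t\<^sup>2 * (b w)\<^sup>2 * s * w * ?G l / 2" for w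
      by (simp only:)
    show "AE \<omega> in M. exp (- ((\<beta> (?W \<omega>))\<^sup>2 * s * ?W \<omega> * (\<Sum>j<Suc l. m ^ j) / 2)) =
        exp (- max 0 (t\<^sup>2 * (b (?W \<omega>))\<^sup>2 * s * ?W \<omega> * ?G l / 2))"
      using limit_size_nonneg_AE
    proof eventually_elim
      case (elim \<omega>)
      have "0 \<le> t\<^sup>2 * (b (?W \<omega>))\<^sup>2 * s * ?W \<omega> * ?G l / 2"
        using elim s by (intro divide_nonneg_nonneg mult_nonneg_nonneg sum_nonneg) auto
      then show ?case unfolding eq by simp
    qed
  qed (use \<beta>m in measurable)
  \<comment> \<open>D is the whole sum on the scale m^(-r/2) and R its part before generation n, so
    D - R is the part treated by \<open>char_limit\<close>.\<close>
  let ?D = "\<lambda>n \<omega>. rate ^ (n + l) * (\<Sum>q\<in>{0..<Suc (n + l)}. mg_incr g q \<omega>)"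
  let ?R = "\<lambda>n \<omega>. rate ^ (n + l) * (\<Sum>q\<in>{0..<n}. mg_incr g q \<omega>)"
  let ?a = "\<lambda>n \<omega>. norming (n + l) \<omega> / rate ^ (n + l)"
  let ?b = "\<lambda>n \<omega>. b (scaled_size n \<omega>)"
  have DR: "?D n \<in> bdd_measurable M" "?R n \<in> bdd_measurable M" for n
    by (intro bdd_measurable_mult bdd_measurable_const mg_total_bdd)+
  have x_eq: "t * (norming (n + l) \<omega> * (\<Sum>q\<in>{0..<Suc (n + l)}. mg_incr g q \<omega>)) = t * (?a n \<omega> * ?D n \<omega>)" for n \<omega>
    using rate(1) by simp
  have y_eq: "arg \<beta> n \<omega> * (\<Sum>q\<in>{n..<n + Suc l}. mg_incr g q \<omega>) = t * (?b n \<omega> * (?D n \<omega> - ?R n \<omega>))" for n \<omega>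
  proof -
    have "(\<Sum>q\<in>{0..<n + Suc l}. mg_incr g q \<omega>) = (\<Sum>q\<in>{0..<n}. mg_incr g q \<omega>) + (\<Sum>q\<in>{n..<n + Suc l}. mg_incr g q \<omega>)"
      by (rule sum.atLeastLessThan_concat[symmetric]) auto
    then have "?D n \<omega> - ?R n \<omega> = rate ^ (n + l) * (\<Sum>q\<in>{n..<n + Suc l}. mg_incr g q \<omega>)"
      by (simp add: algebra_simps)
    then show ?thesis by (simp add: arg_def[OF \<beta>m \<beta>_le] \<beta>_def power_add mult_ac)
  qed
  have lim_ab: "(\<lambda>n. \<integral>\<omega>. min 2 (K * \<bar>t\<bar> * \<bar>?a n \<omega> - ?b n \<omega>\<bar>) \<partial>M) \<longlonglongrightarrow> (\<integral>\<omega>. min 2 (K * \<bar>t\<bar> * \<bar>?L \<omega> - b (?W \<omega>)\<bar>) \<partial>M)"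
  proof (rule integral_tendsto_bounded[where C=2])
    show "AE \<omega> in M. (\<lambda>n. min 2 (K * \<bar>t\<bar> * \<bar>?a n \<omega> - ?b n \<omega>\<bar>)) \<longlonglongrightarrow> min 2 (K * \<bar>t\<bar> * \<bar>?L \<omega> - b (?W \<omega>)\<bar>)"
      using AE_norming_tendsto AE_scaled_size_tendsto
    proof eventually_elim
      case (elim \<omega>)
      have "isCont b (?W \<omega>)" using b_cont by (simp add: continuous_on_eq_continuous_at)
      from isCont_tendsto_compose[OF this elim(2)] LIMSEQ_ignore_initial_segment[OF elim(1), of l]
      show ?case by (intro tendsto_intros)
    qed
  qed (use K1 in auto)
  have "\<forall>\<^sub>F n in sequentially. (\<integral>\<omega>. min 2 (K * \<bar>t\<bar> * \<bar>?a n \<omega> - ?b n \<omega>\<bar>) \<partial>M) < \<epsilon> / 4"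
    using j(1) unfolding b_def[symmetric] by (intro order_tendstoD(2)[OF lim_ab])
  then have ev: "\<forall>\<^sub>F n in sequentially. dist (\<integral>\<omega>. iexp (t * (norming (n + l) \<omega> * (\<Sum>q\<in>{0..<Suc (n + l)}. mg_incr g q \<omega>))) \<partial>M) (?y n) \<le> \<epsilon>"
  proof eventually_elim
    case (elim n)
    have "cmod ((\<integral>\<omega>. iexp (t * (?a n \<omega> * ?D n \<omega>)) \<partial>M) - (\<integral>\<omega>. iexp (t * (?b n \<omega> * (?D n \<omega> - ?R n \<omega>))) \<partial>M)) \<le>
      (\<integral>\<omega>. min 2 (K * \<bar>t\<bar> * \<bar>?a n \<omega> - ?b n \<omega>\<bar>) \<partial>M) + 2 * (\<integral>\<omega>. (?D n \<omega>)\<^sup>2 \<partial>M) / K\<^sup>2 + \<bar>t\<bar> * B * sqrt (\<integral>\<omega>. (?R n \<omega>)\<^sup>2 \<partial>M)"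
      using K1 bdd_imp_integrable[OF DR(2)] bdd_imp_integrable[OF bdd_measurable_power2[OF DR(1)]]
        bdd_imp_integrable[OF bdd_measurable_power2[OF DR(2)]] DR[THEN bdd_measurable_measurable] b_le
      by (intro char_perturbation) auto
    moreover have "2 * (\<integral>\<omega>. (?D n \<omega>)\<^sup>2 \<partial>M) / K\<^sup>2 \<le> \<epsilon> / 4"
    proof -
      \<comment> \<open>The sum has r + 1 generations but is scaled by rate^r. Pulling out one
        factor \<open>rate\<close> allows the bound at r + 1, whence V m instead of V.\<close>
      have "?D n \<omega> = rate ^ (Suc (n + l) + 0) * (\<Sum>q\<in>{0..<Suc (n + l)}. mg_incr g q \<omega>) / rate" for \<omega>
        using rate(1) by simp
      then have "(\<integral>\<omega>. (?D n \<omega>)\<^sup>2 \<partial>M) = (\<integral>\<omega>. (rate ^ (Suc (n + l) + 0) * (\<Sum>q\<in>{0..<Suc (n + l)}. mg_incr g q \<omega>))\<^sup>2 / rate\<^sup>2 \<partial>M)"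
        by (simp only: power_divide)
      also have "\<dots> = (\<integral>\<omega>. (rate ^ (Suc (n + l) + 0) * (\<Sum>q\<in>{0..<Suc (n + l)}. mg_incr g q \<omega>))\<^sup>2 \<partial>M) / rate\<^sup>2"
        by simp
      also have "\<dots> \<le> (V * (1 / m) ^ 0) / rate\<^sup>2"
        unfolding V_def by (intro divide_right_mono rate_scaled_second_moment) simp
      also have "\<dots> = V * m" by (simp add: rate)
      finally have "2 * (\<integral>\<omega>. (?D n \<omega>)\<^sup>2 \<partial>M) / K\<^sup>2 \<le> 2 * (V * m) / K\<^sup>2" by (intro divide_right_mono) auto
      then show ?thesis using K by linarith
    qed
    moreover have "\<bar>t\<bar> * B * sqrt (\<integral>\<omega>. (?R n \<omega>)\<^sup>2 \<partial>M) \<le> \<bar>t\<bar> * B * sqrt (V * (1 / m) ^ l)"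
      unfolding V_def using tree_const_pos
      by (intro mult_left_mono real_sqrt_le_mono rate_scaled_second_moment) (auto simp: B_def)
    ultimately show ?case unfolding x_eq y_eq dist_norm using elim l(1) \<epsilon> by linarith
  qed
  have "dist (complex_of_real ?y') (complex_of_real (\<integral>\<omega>. exp (- (t\<^sup>2 * s / 2 * (if ?W \<omega> = 0 then 0 else 1))) \<partial>M)) \<le> \<epsilon>"
    unfolding dist_of_real y' dist_real_def using l(2) j(2) unfolding b_def[symmetric] by linarith
  with y ev show "\<exists>l y y'. y \<longlonglongrightarrow> y' \<and>
      dist y' (complex_of_real (\<integral>\<omega>. exp (- (t\<^sup>2 * s / 2 * (if ?W \<omega> = 0 then 0 else 1))) \<partial>M)) \<le> \<epsilon> \<and>
      (\<forall>\<^sub>F n in sequentially. dist (\<integral>\<omega>. iexp (t * (norming (n + l) \<omega> * (\<Sum>q\<in>{0..<Suc (n + l)}. mg_incr g q \<omega>))) \<partial>M) (y n) \<le> \<epsilon>)"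
    by blast
qed

end

section \<open>The limit theorems\<close>

text \<open>It turns a sum over living mothers into a sum over the whole generation. The factor
  depends on the mother alone, so it passes through the kernel mean.\<close>

definition live_part ::
    "('a option \<times> 'a option \<times> 'a option \<Rightarrow> real) \<Rightarrow> 'a option \<times> 'a option \<times> 'a option \<Rightarrow> real" where
  "live_part f t = living (fst t) * f t"

lemma live_part_bdd:
  "f \<in> bdd_measurable triple_borel \<Longrightarrow> live_part f \<in> bdd_measurable (triple_borel :: ('a::topological_space option \<times> _) measure)"
  unfolding live_part_def[abs_def]
  by (intro bdd_measurable_mult bdd_measurable_comp[OF living_bdd]) auto

lemma Cb_imp_bdd: "f \<in> Cb E \<Longrightarrow> f \<in> bdd_measurable E"
  by (simp add: Cb_def bdd_measurable_def)

lemma Cb_comp_Some: "k \<in> Cb (borel :: 'a::topological_space option measure) \<Longrightarrow> (\<lambda>x. k (Some x)) \<in> Cb borel"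
  unfolding Cb_borel by (auto simp: continuous_on_option_iff intro: bounded_subset)

lemma Cb_power2: "f \<in> Cb E \<Longrightarrow> (\<lambda>x. (f x)\<^sup>2) \<in> Cb E"
  using bdd_measurable_power2[of f E] by (auto simp: Cb_def bdd_measurable_def intro!: continuous_intros)

lemma Cb_diff: "f \<in> Cb E \<Longrightarrow> g \<in> Cb E \<Longrightarrow> (\<lambda>x. f x - g x) \<in> Cb E"
  using bdd_measurable_diff[of f E g] by (auto simp: Cb_def bdd_measurable_def intro!: continuous_intros)

context bifurcating_chain
begin

lemma kernel_op_live_part: "kernel_op P (live_part f) x = living x * kernel_op P f x"
  by (simp add: kernel_op_eq live_part_def)

lemma kernel_var_live_part: "kernel_var P (live_part f) x = living x * kernel_var P f x"
  by (cases x) (simp_all add: kernel_var_def kernel_op_eq live_part_def)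

lemma tri_sum_live_part: "tri_sum X k (live_part f) \<omega> = (\<Sum>i\<in>alive X (generation k) \<omega>. f (Delta X i \<omega>))"
  unfolding tri_sum_def
  by (subst alive_sum) (auto intro!: sum.cong simp: live_part_def living_def Delta_def)

lemma mg_incr_live_part:
  "mg_incr (live_part f) k \<omega> = (\<Sum>i\<in>alive X (generation k) \<omega>. f (Delta X i \<omega>) - kernel_op P f (X i \<omega>))"
  unfolding mg_incr_def tri_sum_def gen_sum_def sum_subtractf[symmetric]
  by (subst alive_sum) (auto intro!: sum.cong simp: kernel_op_live_part live_part_def living_def Delta_def)

lemma sum_alive_tree:
  "(\<Sum>i\<in>alive X (tree r) \<omega>. u i) = (\<Sum>q\<le>r. \<Sum>i\<in>alive X (generation q) \<omega>. u i)"
  by (simp add: alive_sum sum_tree)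

end

section \<open>Weak laws for generations and for the tree\<close>

context supercritical_chain
begin

text \<open>Centring happens on S only: the constant c extends to c \<open>living\<close>, whose
  scaled generation sum is c W_k and not c.\<close>

lemma lln_generation:
  assumes h: "h \<in> bdd_measurable (borel :: 'a measure)"
    and lim: "\<And>x. (\<lambda>n. (Qop ^^ n) (extend (\<lambda>x. h x - c)) (Some x)) \<longlonglongrightarrow> 0"
  shows "(\<lambda>k. \<integral>\<omega>. (gen_sum X k (extend h) \<omega> / m ^ k - c * scaled_size k \<omega>)\<^sup>2 \<partial>M) \<longlonglongrightarrow> 0"
proof -
  have hc: "(\<lambda>x. h x - c) \<in> bdd_measurable borel" by (intro bdd_intros h)
  obtain C where "\<And>x. \<bar>h x - c\<bar> \<le> C" using bdd_measurable_ex[OF hc] by blast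
  then have e: "extend (\<lambda>x. h x - c) \<in> live_bdd C" by (intro extend_live_bdd bdd_measurable_measurable[OF hc])
  have "(\<lambda>n. (Qop ^^ n) (extend (\<lambda>x. h x - c)) x) \<longlonglongrightarrow> 0" for x
    using lim Qop_funpow_None[OF e] by (cases x) auto
  then have "(\<lambda>k. scaled_moment k (extend (\<lambda>x. h x - c))) \<longlonglongrightarrow> 0"
    by (rule scaled_moment_tendsto_0[OF e])
  moreover have "gen_sum X k (extend (\<lambda>x. h x - c)) \<omega> / m ^ k = gen_sum X k (extend h) \<omega> / m ^ k - c * scaled_size k \<omega>" for k \<omega>
  proof -
    have "extend (\<lambda>x. h x - c) y = extend h y - c * living y" for y by (cases y) auto
    then show ?thesis
      by (simp add: gen_sum_def scaled_size_def sum_subtractf sum_distrib_left diff_divide_distrib)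
  qed
  ultimately show ?thesis by (simp add: scaled_moment_def)
qed

lemma lln_generation_markov:
  assumes h: "h \<in> bdd_measurable (borel :: 'a measure)"
    and Y: "\<And>x. markov_chain (N x) (return borel x) (Q_kernel m P) Y"
    and lim: "\<And>x. (\<lambda>k. \<integral>\<omega>. h (Y k \<omega>) \<partial>N x) \<longlonglongrightarrow> c"
  shows "(\<lambda>k. \<integral>\<omega>. (gen_sum X k (extend h) \<omega> / m ^ k - c * scaled_size k \<omega>)\<^sup>2 \<partial>M) \<longlonglongrightarrow> 0"
proof (rule lln_generation[OF h])
  fix x
  interpret N: prob_space "N x" using Y[of x] by (simp add: markov_chain_def)
  have Ym [measurable]: "Y n \<in> N x \<rightarrow>\<^sub>M borel" for n using Y[of x] by (simp add: markov_chain_def)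
  have hY: "integrable (N x) (\<lambda>\<omega>. h (Y n \<omega>))" for n
  proof -
    obtain C where "\<And>x. \<bar>h x\<bar> \<le> C" using bdd_measurable_ex[OF h] by blast
    then show ?thesis using bdd_measurable_measurable[OF h]
      by (intro N.integrable_const_bound[where B=C]) auto
  qed
  have "(Qop ^^ n) (extend (\<lambda>x. h x - c)) (Some x) = (\<integral>\<omega>. h (Y n \<omega>) \<partial>N x) - c" for n
    using markov_chain_expectation[OF Y[of x], of "\<lambda>x. h x - c" n] hY[of n] h
    by (simp add: bdd_intros N.prob_space)
  moreover have "(\<lambda>n. (\<integral>\<omega>. h (Y n \<omega>) \<partial>N x) - c) \<longlonglongrightarrow> c - c" by (intro tendsto_intros lim)
  ultimately show "(\<lambda>n. (Qop ^^ n) (extend (\<lambda>x. h x - c)) (Some x)) \<longlonglongrightarrow> 0" by simp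
qed

context
  fixes g :: "'a option \<times> 'a option \<times> 'a option \<Rightarrow> real" and c :: real
  assumes g: "g \<in> bdd_measurable triple_borel"
    and lln: "(\<lambda>k. \<integral>\<omega>. (gen_sum X k (kernel_op P g) \<omega> / m ^ k - c * scaled_size k \<omega>)\<^sup>2 \<partial>M) \<longlonglongrightarrow> 0"
begin

definition "gen_dev k \<omega> = tri_sum X k g \<omega> / m ^ k - c * scaled_size k \<omega>"

definition "tree_dev r \<omega> = ((\<Sum>q\<le>r. tri_sum X q g \<omega>) - c * tree_size r \<omega>) / m ^ r"

lemma gen_dev_bdd: "gen_dev k \<in> bdd_measurable M"
  unfolding gen_dev_def[abs_def] divide_inverse by (intro bdd_intros tri_sum_bdd g scaled_size_bdd)

lemma tree_dev_bdd: "tree_dev r \<in> bdd_measurable M"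
  unfolding tree_dev_def[abs_def] tree_size_def divide_inverse
  by (intro bdd_intros bdd_measurable_sum tri_sum_bdd gen_sum_bdd g living_bdd)

text \<open>The deviation of g is a martingale increment, of second moment O(m^(-k)) after scaling,
  plus the deviation of its kernel mean, which \<open>lln\<close> controls.\<close>

lemma gen_dev_L2: "(\<lambda>k. \<integral>\<omega>. (gen_dev k \<omega>)\<^sup>2 \<partial>M) \<longlonglongrightarrow> 0"
proof -
  obtain C where C: "\<And>t. \<bar>g t\<bar> \<le> C" using bdd_measurable_ex[OF g] by blast
  let ?A = "\<lambda>k \<omega>. gen_sum X k (kernel_op P g) \<omega> / m ^ k - c * scaled_size k \<omega>"
  have A: "?A k \<in> bdd_measurable M" for k
    unfolding divide_inverse by (intro bdd_intros gen_sum_bdd kernel_op_bdd g scaled_size_bdd)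
  have le: "\<forall>\<^sub>F k in sequentially. (\<integral>\<omega>. (gen_dev k \<omega>)\<^sup>2 \<partial>M) \<le> 2 * (C\<^sup>2 * (1 / m) ^ k) + 2 * (\<integral>\<omega>. (?A k \<omega>)\<^sup>2 \<partial>M)"
  proof (rule always_eventually, rule allI)
    fix k
    have "gen_dev k \<omega> = mg_incr g k \<omega> / m ^ k + ?A k \<omega>" for \<omega>
      by (simp add: gen_dev_def mg_incr_def diff_divide_distrib)
    then have "(gen_dev k \<omega>)\<^sup>2 \<le> 2 * ((mg_incr g k \<omega>)\<^sup>2 / (m ^ k)\<^sup>2) + 2 * (?A k \<omega>)\<^sup>2" for \<omega>
      using sum_squares_bound[of "mg_incr g k \<omega> / m ^ k" "?A k \<omega>"]
      by (simp only: power2_sum power_divide)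
    then have "(\<integral>\<omega>. (gen_dev k \<omega>)\<^sup>2 \<partial>M) \<le> (\<integral>\<omega>. 2 * ((mg_incr g k \<omega>)\<^sup>2 / (m ^ k)\<^sup>2) + 2 * (?A k \<omega>)\<^sup>2 \<partial>M)"
      using bdd_imp_integrable[OF bdd_measurable_power2[OF mg_incr_bdd[OF g]], of k] bdd_imp_integrable[OF bdd_measurable_power2[OF A], of k]
        bdd_imp_integrable[OF bdd_measurable_power2[OF gen_dev_bdd], of k]
      by (intro integral_mono) auto
    also have "\<dots> = 2 * ((\<integral>\<omega>. (mg_incr g k \<omega>)\<^sup>2 \<partial>M) / (m ^ k)\<^sup>2) + 2 * (\<integral>\<omega>. (?A k \<omega>)\<^sup>2 \<partial>M)"
      using bdd_imp_integrable[OF bdd_measurable_power2[OF mg_incr_bdd[OF g]], of k] bdd_imp_integrable[OF bdd_measurable_power2[OF A], of k]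
      by simp
    also have "\<dots> \<le> 2 * (C\<^sup>2 * m ^ k / (m ^ k)\<^sup>2) + 2 * (\<integral>\<omega>. (?A k \<omega>)\<^sup>2 \<partial>M)"
      by (intro add_right_mono mult_left_mono divide_right_mono second_moment_mg_incr_le g C) auto
    also have "C\<^sup>2 * m ^ k / (m ^ k)\<^sup>2 = C\<^sup>2 * (1 / m) ^ k" by (simp add: power2_eq_square power_divide)
    finally show "(\<integral>\<omega>. (gen_dev k \<omega>)\<^sup>2 \<partial>M) \<le> 2 * (C\<^sup>2 * (1 / m) ^ k) + 2 * (\<integral>\<omega>. (?A k \<omega>)\<^sup>2 \<partial>M)" .
  qed
  have "(\<lambda>k. 2 * (C\<^sup>2 * (1 / m) ^ k) + 2 * (\<integral>\<omega>. (?A k \<omega>)\<^sup>2 \<partial>M)) \<longlonglongrightarrow> 2 * (C\<^sup>2 * 0) + 2 * 0"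
    using super_critical by (intro tendsto_add tendsto_mult tendsto_const lln LIMSEQ_power_zero) simp
  then have "(\<lambda>k. 2 * (C\<^sup>2 * (1 / m) ^ k) + 2 * (\<integral>\<omega>. (?A k \<omega>)\<^sup>2 \<partial>M)) \<longlonglongrightarrow> 0" by simp
  from tendsto_sandwich[OF _ le tendsto_const this] show ?thesis by simp
qed

text \<open>One more generation divides the old deviation by m and adds that of the new generation,
  so the tree inherits the limit 0 through a contracting recursion.\<close>

lemma tree_dev_L2: "(\<lambda>r. \<integral>\<omega>. (tree_dev r \<omega>)\<^sup>2 \<partial>M) \<longlonglongrightarrow> 0"
proof (rule geometric_recursion_tendsto_0[where \<rho>="1 / m"])
  fix r
  have rec: "tree_dev (Suc r) \<omega> = tree_dev r \<omega> / m + gen_dev (Suc r) \<omega>" for \<omega>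
    by (simp add: tree_dev_def gen_dev_def tree_size_def scaled_size_def field_simps)
  \<comment> \<open>Convexity of the square with weights 1/m and 1 - 1/m, applied to a and m b / (m
    - 1). It retains the contraction factor 1/m, which the cruder factor 2 could lose.\<close>
  have sq: "(a / m + b)\<^sup>2 \<le> 1 / m * a\<^sup>2 + m / (m - 1) * b\<^sup>2" for a b :: real
  proof -
    have "1 / m * a\<^sup>2 + m / (m - 1) * b\<^sup>2 - (a / m + b)\<^sup>2 = ((m - 1) * a / m - b)\<^sup>2 / (m - 1)"
      using super_critical by (simp add: power2_eq_square divide_simps) (simp add: algebra_simps)
    moreover have "0 \<le> ((m - 1) * a / m - b)\<^sup>2 / (m - 1)" using super_critical by simp
    ultimately show ?thesis by linarith
  qed
  note int = bdd_imp_integrable[OF bdd_measurable_power2[OF tree_dev_bdd]] bdd_imp_integrable[OF bdd_measurable_power2[OF gen_dev_bdd]]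
  have "(\<integral>\<omega>. (tree_dev (Suc r) \<omega>)\<^sup>2 \<partial>M) \<le> (\<integral>\<omega>. 1 / m * (tree_dev r \<omega>)\<^sup>2 + m / (m - 1) * (gen_dev (Suc r) \<omega>)\<^sup>2 \<partial>M)"
  proof (rule integral_mono)
    show "(tree_dev (Suc r) \<omega>)\<^sup>2 \<le> 1 / m * (tree_dev r \<omega>)\<^sup>2 + m / (m - 1) * (gen_dev (Suc r) \<omega>)\<^sup>2" for \<omega>
      unfolding rec by (rule sq)
  qed (use int in auto)
  also have "\<dots> = 1 / m * (\<integral>\<omega>. (tree_dev r \<omega>)\<^sup>2 \<partial>M) + m / (m - 1) * (\<integral>\<omega>. (gen_dev (Suc r) \<omega>)\<^sup>2 \<partial>M)"
    using int by simp
  finally show "(\<integral>\<omega>. (tree_dev (Suc r) \<omega>)\<^sup>2 \<partial>M) \<le> 1 / m * (\<integral>\<omega>. (tree_dev r \<omega>)\<^sup>2 \<partial>M) + m / (m - 1) * (\<integral>\<omega>. (gen_dev (Suc r) \<omega>)\<^sup>2 \<partial>M)" .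
next
  have "(\<lambda>r. m / (m - 1) * (\<integral>\<omega>. (gen_dev (Suc r) \<omega>)\<^sup>2 \<partial>M)) \<longlonglongrightarrow> m / (m - 1) * 0"
    by (intro tendsto_mult tendsto_const LIMSEQ_Suc[OF gen_dev_L2])
  then show "(\<lambda>r. m / (m - 1) * (\<integral>\<omega>. (gen_dev (Suc r) \<omega>)\<^sup>2 \<partial>M)) \<longlonglongrightarrow> 0" by simp
qed (use super_critical in auto)

lemma weak_law_generation:
  "converges_in_probability M
    (\<lambda>r \<omega>. if gen_sum X r living \<omega> > 0 then tri_sum X r g \<omega> / gen_sum X r living \<omega> else 0)
    (\<lambda>\<omega>. if limit_size \<omega> = 0 then 0 else c)"
proof -
  have "converges_in_probability M
    (\<lambda>r \<omega>. (if gen_sum X r living \<omega> > 0 then 1 / scaled_size r \<omega> else 0) * gen_dev r \<omega> + (if gen_sum X r living \<omega> > 0 then c else 0))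
    (\<lambda>\<omega>. if limit_size \<omega> = 0 then 0 else c)"
  proof (rule converges_in_probability_slutsky)
    show "AE \<omega> in M. (\<lambda>r. if gen_sum X r living \<omega> > 0 then 1 / scaled_size r \<omega> else 0) \<longlonglongrightarrow> (if limit_size \<omega> = 0 then 0 else 1 / limit_size \<omega>)"
      using AE_scaled_size_tendsto by (intro AE_alive_tendsto) (auto elim!: eventually_mono intro!: tendsto_intros)
    show "AE \<omega> in M. (\<lambda>r. if gen_sum X r living \<omega> > 0 then c else 0) \<longlonglongrightarrow> (if limit_size \<omega> = 0 then 0 else c)"
      by (intro AE_alive_tendsto) simp
  qed (use gen_dev_L2 bdd_measurable_measurable[OF gen_dev_bdd] bdd_imp_integrable[OF bdd_measurable_power2[OF gen_dev_bdd]] in auto)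
  moreover have "(if gen_sum X r living \<omega> > 0 then 1 / scaled_size r \<omega> else 0) * gen_dev r \<omega> + (if gen_sum X r living \<omega> > 0 then c else 0) =
      (if gen_sum X r living \<omega> > 0 then tri_sum X r g \<omega> / gen_sum X r living \<omega> else 0)" for r \<omega>
    by (simp add: scaled_size_def gen_dev_def field_simps)
  ultimately show ?thesis by simp
qed

lemma weak_law_tree:
  "converges_in_probability M
    (\<lambda>r \<omega>. if gen_sum X r living \<omega> > 0 then (\<Sum>q\<le>r. tri_sum X q g \<omega>) / tree_size r \<omega> else 0)
    (\<lambda>\<omega>. if limit_size \<omega> = 0 then 0 else c)"
proof -
  have "converges_in_probability M
    (\<lambda>r \<omega>. (if gen_sum X r living \<omega> > 0 then 1 / (tree_size r \<omega> / m ^ r) else 0) * tree_dev r \<omega> + (if gen_sum X r living \<omega> > 0 then c else 0))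
    (\<lambda>\<omega>. if limit_size \<omega> = 0 then 0 else c)"
  proof (rule converges_in_probability_slutsky)
    show "AE \<omega> in M. (\<lambda>r. if gen_sum X r living \<omega> > 0 then 1 / (tree_size r \<omega> / m ^ r) else 0) \<longlonglongrightarrow>
        (if limit_size \<omega> = 0 then 0 else 1 / (m / (m - 1) * limit_size \<omega>))"
    proof (rule AE_alive_tendsto)
      show "AE \<omega> in M. limit_size \<omega> > 0 \<longrightarrow> (\<lambda>r. 1 / (tree_size r \<omega> / m ^ r)) \<longlonglongrightarrow> 1 / (m / (m - 1) * limit_size \<omega>)"
        using AE_tree_size_tendsto
      proof eventually_elim
        case (elim \<omega>)
        then show ?case using super_critical by (intro impI tendsto_divide[OF tendsto_const]) auto
      qed
    qed
    show "AE \<omega> in M. (\<lambda>r. if gen_sum X r living \<omega> > 0 then c else 0) \<longlonglongrightarrow> (if limit_size \<omega> = 0 then 0 else c)"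
      by (intro AE_alive_tendsto) simp
  qed (use tree_dev_L2 bdd_measurable_measurable[OF tree_dev_bdd] bdd_imp_integrable[OF bdd_measurable_power2[OF tree_dev_bdd]] in auto)
  moreover have "(if gen_sum X r living \<omega> > 0 then 1 / (tree_size r \<omega> / m ^ r) else 0) * tree_dev r \<omega> + (if gen_sum X r living \<omega> > 0 then c else 0) =
      (if gen_sum X r living \<omega> > 0 then (\<Sum>q\<le>r. tri_sum X q g \<omega>) / tree_size r \<omega> else 0)" for r \<omega>
  proof (cases "gen_sum X r living \<omega> > 0")
    case True
    also have "gen_sum X r living \<omega> \<le> tree_size r \<omega>"
      unfolding tree_size_def by (rule member_le_sum) (auto simp: gen_sum_living_nonneg)
    finally show ?thesis using True by (simp add: tree_dev_def field_simps)
  qed simp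
  ultimately show ?thesis by simp
qed

end

end

text \<open>For u in {0, 1}, exp(i x u) = 1 - u + u exp(i x), and independence factors the last
  term. The result depends on W' only through its law, so that of W can be substituted.\<close>

lemma char_mixture:
  fixes G W' :: "'u \<Rightarrow> real"
  assumes M': "prob_space M'" and W' [measurable]: "W' \<in> borel_measurable M'"
    and G: "distributed M' lborel G std_normal_density"
    and indep: "prob_space.indep_var M' borel G borel W'"
  shows "char (distr M' borel (\<lambda>\<omega>. indicator {\<omega>. W' \<omega> \<noteq> 0} \<omega> * \<sigma> * G \<omega>)) t =
    complex_of_real (\<integral>w. exp (- (t\<^sup>2 * \<sigma>\<^sup>2 / 2 * (if w = 0 then 0 else 1))) \<partial>distr M' borel W')"
proof -
  interpret prob_space M' by (rule M')
  have Gm [measurable]: "G \<in> borel_measurable M'" using distributed_measurable[OF G] by simp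
  let ?p = "\<integral>\<omega>. (if W' \<omega> = 0 then 0 else 1 :: real) \<partial>M'"
  have G_char: "(\<integral>\<omega>. iexp (u * G \<omega>) \<partial>M') = complex_of_real (exp (- u\<^sup>2 / 2))" for u
  proof -
    have "(\<integral>\<omega>. iexp (u * G \<omega>) \<partial>M') = char (distr M' lborel G) u"
      unfolding char_def by (subst integral_distr) auto
    also have "distr M' lborel G = std_normal_distribution" using G by (simp add: distributed_def)
    finally show ?thesis by (simp add: char_std_normal_distribution)
  qed
  have int0: "integrable M' (\<lambda>\<omega>. if W' \<omega> = 0 then 0 else 1 :: real)"
    by (rule bounded_integrable[where C=1]) auto
  have int1: "integrable M' (\<lambda>\<omega>. complex_of_real (if W' \<omega> = 0 then 0 else 1))"
    using int0 by (rule integrable_of_real)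
  have int2: "integrable M' (\<lambda>\<omega>. iexp (t * \<sigma> * G \<omega>))"
    by (rule bounded_integrable[where C=1]) auto
  have "indep_var borel ((\<lambda>x. iexp (t * \<sigma> * x)) \<circ> G) borel ((\<lambda>w. complex_of_real (if w = 0 then 0 else 1)) \<circ> W')"
    by (rule indep_var_compose[OF indep]) auto
  then have indep': "indep_var borel (\<lambda>\<omega>. iexp (t * \<sigma> * G \<omega>)) borel (\<lambda>\<omega>. complex_of_real (if W' \<omega> = 0 then 0 else 1))"
    by (simp add: o_def)
  have "char (distr M' borel (\<lambda>\<omega>. indicator {\<omega>. W' \<omega> \<noteq> 0} \<omega> * \<sigma> * G \<omega>)) t =
      (\<integral>\<omega>. iexp (t * (indicator {\<omega>. W' \<omega> \<noteq> 0} \<omega> * \<sigma> * G \<omega>)) \<partial>M')"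
  proof -
    have "(\<lambda>\<omega>. (if W' \<omega> = 0 then 0 else 1) * \<sigma> * G \<omega>) \<in> borel_measurable M'" by measurable
    also have "(\<lambda>\<omega>. (if W' \<omega> = 0 then 0 else 1) * \<sigma> * G \<omega>) = (\<lambda>\<omega>. indicator {\<omega>. W' \<omega> \<noteq> 0} \<omega> * \<sigma> * G \<omega>)"
      by (auto simp: fun_eq_iff indicator_def)
    finally show ?thesis unfolding char_def by (subst integral_distr) auto
  qed
  also have "\<dots> = (\<integral>\<omega>. 1 - complex_of_real (if W' \<omega> = 0 then 0 else 1) + iexp (t * \<sigma> * G \<omega>) * complex_of_real (if W' \<omega> = 0 then 0 else 1) \<partial>M')"
    by (intro Bochner_Integration.integral_cong refl) (simp add: indicator_def mult_ac)
  also have "\<dots> = 1 - complex_of_real ?p + complex_of_real (exp (- (t * \<sigma>)\<^sup>2 / 2)) * complex_of_real ?p"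
    using indep_var_integrable[OF indep' int2 int1] int1 indep_var_lebesgue_integral[OF indep' int2 int1]
    by (simp add: prob_space G_char integral_complex_of_real del: of_real_mult)
  also have "\<dots> = complex_of_real (1 - ?p + exp (- (t * \<sigma>)\<^sup>2 / 2) * ?p)" by simp
  also have "1 - ?p + exp (- (t * \<sigma>)\<^sup>2 / 2) * ?p =
      (\<integral>\<omega>. 1 - (if W' \<omega> = 0 then 0 else 1) + exp (- (t * \<sigma>)\<^sup>2 / 2) * (if W' \<omega> = 0 then 0 else 1) \<partial>M')"
    using int0 by (simp add: prob_space)
  also have "\<dots> = (\<integral>\<omega>. exp (- (t\<^sup>2 * \<sigma>\<^sup>2 / 2 * (if W' \<omega> = 0 then 0 else 1))) \<partial>M')"
    by (intro Bochner_Integration.integral_cong refl) (simp add: power_mult_distrib)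
  also have "\<dots> = (\<integral>w. exp (- (t\<^sup>2 * \<sigma>\<^sup>2 / 2 * (if w = 0 then 0 else 1))) \<partial>distr M' borel W')"
    by (subst integral_distr) auto
  finally show ?thesis .
qed

text \<open>Convergence in distribution asks for no coupling with the chain: the limit variable is
  formed on any space carrying a copy W' of W and a standard Gaussian independent of it.\<close>

theorem theorem1p3:
  fixes M :: "'w measure"
    and X :: "bool list \<Rightarrow> 'w \<Rightarrow> 'a::metric_space option"
    and P :: "'a option \<Rightarrow> ('a option \<times> 'a option) measure"
    and \<nu> :: "'a option measure"
    and p10 p0 p1 m \<sigma> :: real
    and W :: "'w \<Rightarrow> real"
    and N :: "'a \<Rightarrow> 'v measure"
    and Y :: "nat \<Rightarrow> 'v \<Rightarrow> 'a"
    and \<mu> :: "'a measure"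
    and f :: "'a option \<times> 'a option \<times> 'a option \<Rightarrow> real"
  assumes M: "prob_space M"
    and P: "bmc_kernel P"
    and X: "bmc M \<nu> P X"
    and \<nu>: "measure \<nu> (range Some) = 1"
    and homogeneous: "spatially_homogeneous P p10 p0 p1"
    and m: "m = 2 * p10 + p0 + p1"
    and super_critical: "m > 1"
    and W: "W = (\<lambda>\<omega>. lim (\<lambda>q. real (card (alive X (generation q) \<omega>)) / m ^ q))"
    and Y: "\<And>x. markov_chain (N x) (return borel x) (Q_kernel m P) Y"
    and \<mu>: "prob_space \<mu>" "sets \<mu> = sets borel"
    and ergodic: "\<And>h x. h \<in> Cb borel \<Longrightarrow>
                    (\<lambda>k. \<integral>\<omega>. h (Y k \<omega>) \<partial>N x) \<longlonglongrightarrow> (\<integral>x. h x \<partial>\<mu>)"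
    and feller: "\<And>g. g \<in> Cb triple_borel \<Longrightarrow> kernel_op P g \<in> Cb borel"
    and f: "f \<in> Cb triple_borel"
    and \<sigma>: "\<sigma>\<^sup>2 = (\<integral>x. kernel_op P (\<lambda>t. (f t)\<^sup>2) (Some x) - (kernel_op P f (Some x))\<^sup>2 \<partial>\<mu>)"
  shows
    "((AE \<omega> in M. (\<lambda>q. real (card (alive X (generation q) \<omega>)) / m ^ q) \<longlonglongrightarrow> W \<omega>) \<and>
      (\<lambda>q. \<integral>\<^sup>+\<omega>. ennreal ((real (card (alive X (generation q) \<omega>)) / m ^ q - W \<omega>)\<^sup>2) \<partial>M)
        \<longlonglongrightarrow> 0) \<and>
     converges_in_probability M
       (\<lambda>r \<omega>. indicator {\<omega>. card (alive X (generation r) \<omega>) > 0} \<omega> *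
          (1 / real (card (alive X (generation r) \<omega>))) *
          (\<Sum>i\<in>alive X (generation r) \<omega>. f (Delta X i \<omega>)))
       (\<lambda>\<omega>. (\<integral>x. kernel_op P f (Some x) \<partial>\<mu>) * indicator {\<omega>. W \<omega> \<noteq> 0} \<omega>) \<and>
     converges_in_probability M
       (\<lambda>r \<omega>. indicator {\<omega>. card (alive X (generation r) \<omega>) > 0} \<omega> *
          (1 / real (card (alive X (tree r) \<omega>))) *
          (\<Sum>i\<in>alive X (tree r) \<omega>. f (Delta X i \<omega>)))
       (\<lambda>\<omega>. (\<integral>x. kernel_op P f (Some x) \<partial>\<mu>) * indicator {\<omega>. W \<omega> \<noteq> 0} \<omega>) \<and>
     (\<forall>(M' :: 'u measure) W' G.
        prob_space M' \<and>
        W' \<in> borel_measurable M' \<and> distr M' borel W' = distr M borel W \<and>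
        distributed M' lborel G std_normal_density \<and>
        prob_space.indep_var M' borel G borel W' \<longrightarrow>
        weak_conv_m
          (\<lambda>r. distr M borel
             (\<lambda>\<omega>. indicator {\<omega>. card (alive X (generation r) \<omega>) > 0} \<omega> *
                (1 / sqrt (real (card (alive X (tree r) \<omega>)))) *
                (\<Sum>i\<in>alive X (tree r) \<omega>. f (Delta X i \<omega>) - kernel_op P f (X i \<omega>))))
          (distr M' borel (\<lambda>\<omega>. indicator {\<omega>. W' \<omega> \<noteq> 0} \<omega> * \<sigma> * G \<omega>)))"
  proof -
  let ?g = "live_part f" and ?h = "\<lambda>x. kernel_op P f (Some x)" and ?v = "\<lambda>x. kernel_var P f (Some x)"
  interpret prob_space M by (rule M)
  interpret supercritical_chain M \<nu> P X p10 p0 p1 m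
    by unfold_locales (use P X \<nu> homogeneous m super_critical in auto)
  have W_eq: "W = limit_size"
    unfolding W limit_size_def[abs_def] scaled_size_def gen_sum_living ..
  have card_eq: "real (card (alive X (generation r) \<omega>)) = gen_sum X r living \<omega>" for r \<omega>
    by (rule gen_sum_living[symmetric])
  have ind_eq: "indicator {\<omega>. card (alive X (generation r) \<omega>) > 0} \<omega> = (if gen_sum X r living \<omega> > 0 then 1 else 0 :: real)" for r \<omega>
    by (simp add: card_eq[symmetric] indicator_def)
  have fb: "f \<in> bdd_measurable triple_borel" by (rule Cb_imp_bdd[OF f])
  have gb: "?g \<in> bdd_measurable triple_borel" by (rule live_part_bdd[OF fb])
  \<comment> \<open>The Feller hypothesis for f and f^2 makes the conditional mean and the
    conditional variance continuous and bounded on S, hence admissible in the ergodicity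
    assumption.\<close>
  have h: "?h \<in> Cb borel" by (rule Cb_comp_Some[OF feller[OF f]])
  have v: "?v \<in> Cb borel"
    unfolding kernel_var_def
    by (intro Cb_diff Cb_power2 h Cb_comp_Some[OF feller[OF Cb_power2[OF f]]])
  have Pg: "kernel_op P ?g = extend ?h"
  proof
    show "kernel_op P ?g x = extend ?h x" for x by (cases x) (auto simp: kernel_op_live_part)
  qed
  have Vg: "kernel_var P ?g = extend ?v"
  proof
    show "kernel_var P ?g x = extend ?v x" for x by (cases x) (auto simp: kernel_var_live_part)
  qed
  have lln_h: "(\<lambda>k. \<integral>\<omega>. (gen_sum X k (kernel_op P ?g) \<omega> / m ^ k - (\<integral>x. ?h x \<partial>\<mu>) * scaled_size k \<omega>)\<^sup>2 \<partial>M) \<longlonglongrightarrow> 0"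
    unfolding Pg by (rule lln_generation_markov[OF Cb_imp_bdd[OF h] Y ergodic[OF h]])
  have \<sigma>_eq: "\<sigma>\<^sup>2 = (\<integral>x. ?v x \<partial>\<mu>)" using \<sigma> by (simp add: kernel_var_def)
  have lln_v: "(\<lambda>k. \<integral>\<omega>. (gen_sum X k (kernel_var P ?g) \<omega> / m ^ k - \<sigma>\<^sup>2 * scaled_size k \<omega>)\<^sup>2 \<partial>M) \<longlonglongrightarrow> 0"
    unfolding Vg \<sigma>_eq by (rule lln_generation_markov[OF Cb_imp_bdd[OF v] Y ergodic[OF v]])
  obtain C where C: "\<And>t. \<bar>?g t\<bar> \<le> C" using bdd_measurable_ex[OF gb] by blast
  interpret clt_setup M \<nu> P X p10 p0 p1 m ?g C "\<sigma>\<^sup>2"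
    by unfold_locales (use gb C lln_v in auto)
  have lim_eq: "(\<integral>x. ?h x \<partial>\<mu>) * indicator {\<omega>. W \<omega> \<noteq> 0} \<omega> = (if limit_size \<omega> = 0 then 0 else \<integral>x. ?h x \<partial>\<mu>)" for \<omega>
    by (simp add: W_eq indicator_def)
  have W1: "AE \<omega> in M. (\<lambda>q. real (card (alive X (generation q) \<omega>)) / m ^ q) \<longlonglongrightarrow> W \<omega>"
    using AE_scaled_size_tendsto by (simp add: card_eq W_eq scaled_size_def)
  have W2: "(\<lambda>q. \<integral>\<^sup>+\<omega>. ennreal ((real (card (alive X (generation q) \<omega>)) / m ^ q - W \<omega>)\<^sup>2) \<partial>M) \<longlonglongrightarrow> 0"
    using limit_size_L2_tendsto by (simp add: card_eq W_eq scaled_size_def)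
  have L1: "converges_in_probability M
       (\<lambda>r \<omega>. indicator {\<omega>. card (alive X (generation r) \<omega>) > 0} \<omega> *
          (1 / real (card (alive X (generation r) \<omega>))) * (\<Sum>i\<in>alive X (generation r) \<omega>. f (Delta X i \<omega>)))
       (\<lambda>\<omega>. (\<integral>x. ?h x \<partial>\<mu>) * indicator {\<omega>. W \<omega> \<noteq> 0} \<omega>)"
  proof -
    have "indicator {\<omega>. card (alive X (generation r) \<omega>) > 0} \<omega> *
          (1 / real (card (alive X (generation r) \<omega>))) * (\<Sum>i\<in>alive X (generation r) \<omega>. f (Delta X i \<omega>)) =
        (if gen_sum X r living \<omega> > 0 then tri_sum X r ?g \<omega> / gen_sum X r living \<omega> else 0)" for r \<omega>
      unfolding ind_eq card_eq tri_sum_live_part by simp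
    then show ?thesis unfolding lim_eq using weak_law_generation[OF gb lln_h] by (simp only:)
  qed
  have L2: "converges_in_probability M
       (\<lambda>r \<omega>. indicator {\<omega>. card (alive X (generation r) \<omega>) > 0} \<omega> *
          (1 / real (card (alive X (tree r) \<omega>))) * (\<Sum>i\<in>alive X (tree r) \<omega>. f (Delta X i \<omega>)))
       (\<lambda>\<omega>. (\<integral>x. ?h x \<partial>\<mu>) * indicator {\<omega>. W \<omega> \<noteq> 0} \<omega>)"
  proof -
    have "indicator {\<omega>. card (alive X (generation r) \<omega>) > 0} \<omega> *
          (1 / real (card (alive X (tree r) \<omega>))) * (\<Sum>i\<in>alive X (tree r) \<omega>. f (Delta X i \<omega>)) =
        (if gen_sum X r living \<omega> > 0 then (\<Sum>q\<le>r. tri_sum X q ?g \<omega>) / tree_size r \<omega> else 0)" for r \<omega>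
      unfolding ind_eq card_alive_tree tri_sum_live_part sum_alive_tree by simp
    then show ?thesis unfolding lim_eq using weak_law_tree[OF gb lln_h] by (simp only:)
  qed
  have CLT: "weak_conv_m
      (\<lambda>r. distr M borel
         (\<lambda>\<omega>. indicator {\<omega>. card (alive X (generation r) \<omega>) > 0} \<omega> *
            (1 / sqrt (real (card (alive X (tree r) \<omega>)))) *
            (\<Sum>i\<in>alive X (tree r) \<omega>. f (Delta X i \<omega>) - kernel_op P f (X i \<omega>))))
      (distr M' borel (\<lambda>\<omega>. indicator {\<omega>. W' \<omega> \<noteq> 0} \<omega> * \<sigma> * G \<omega>))"
    if M': "prob_space M'" and W': "W' \<in> borel_measurable M'" "distr M' borel W' = distr M borel W"
      and G: "distributed M' lborel G std_normal_density" "prob_space.indep_var M' borel G borel W'"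
    for M' :: "'u measure" and W' G
  proof -
    let ?U = "\<lambda>r \<omega>. norming r \<omega> * (\<Sum>q\<in>{0..<Suc r}. mg_incr ?g q \<omega>)"
    have U: "(\<lambda>\<omega>. indicator {\<omega>. card (alive X (generation r) \<omega>) > 0} \<omega> *
            (1 / sqrt (real (card (alive X (tree r) \<omega>)))) *
            (\<Sum>i\<in>alive X (tree r) \<omega>. f (Delta X i \<omega>) - kernel_op P f (X i \<omega>))) = ?U r" for r
      unfolding ind_eq card_alive_tree sum_alive_tree mg_incr_live_part norming_def
      by (simp add: atLeast0LessThan lessThan_Suc_atMost fun_eq_iff)
    have Um [measurable]: "?U r \<in> borel_measurable M" for r
      by (intro borel_measurable_times norming_measurable bdd_measurable_measurable[OF mg_total_bdd])
    interpret M': prob_space M' by (rule M')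
    have Gm [measurable]: "G \<in> borel_measurable M'" using distributed_measurable[OF G(1)] by simp
    note W'(1) [measurable]
    have "(\<lambda>\<omega>. (if W' \<omega> = 0 then 0 else 1) * \<sigma> * G \<omega>) \<in> borel_measurable M'" by measurable
    also have "(\<lambda>\<omega>. (if W' \<omega> = 0 then 0 else 1) * \<sigma> * G \<omega>) = (\<lambda>\<omega>. indicator {\<omega>. W' \<omega> \<noteq> 0} \<omega> * \<sigma> * G \<omega>)"
      by (auto simp: fun_eq_iff indicator_def)
    finally have lim_meas: "(\<lambda>\<omega>. indicator {\<omega>. W' \<omega> \<noteq> 0} \<omega> * \<sigma> * G \<omega>) \<in> borel_measurable M'" .
    show ?thesis
      unfolding U
    proof (rule levy_continuity)
      show "real_distribution (distr M borel (?U r))" for r by (rule real_distribution_distr[OF Um])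
      show "real_distribution (distr M' borel (\<lambda>\<omega>. indicator {\<omega>. W' \<omega> \<noteq> 0} \<omega> * \<sigma> * G \<omega>))"
        by (rule M'.real_distribution_distr[OF lim_meas])
      fix t
      \<comment> \<open>Equality of the laws of W' and W carries the mixture back to the original
        space.\<close>
      have "char (distr M' borel (\<lambda>\<omega>. indicator {\<omega>. W' \<omega> \<noteq> 0} \<omega> * \<sigma> * G \<omega>)) t =
          complex_of_real (\<integral>\<omega>. exp (- (t\<^sup>2 * \<sigma>\<^sup>2 / 2 * (if limit_size \<omega> = 0 then 0 else 1))) \<partial>M)"
        unfolding char_mixture[OF M' W'(1) G] W'(2) W_eq by (subst integral_distr) auto
      moreover have "char (distr M borel (?U r)) t = (\<integral>\<omega>. iexp (t * ?U r \<omega>) \<partial>M)" for r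
        unfolding char_def by (rule integral_distr[OF Um]) simp
      ultimately show "(\<lambda>r. char (distr M borel (?U r)) t) \<longlonglongrightarrow> char (distr M' borel (\<lambda>\<omega>. indicator {\<omega>. W' \<omega> \<noteq> 0} \<omega> * \<sigma> * G \<omega>)) t"
        using char_norming_tendsto[of t] by (simp only:)
    qed
  qed
  show ?thesis using W1 W2 L1 L2 CLT by blast
qed

end
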